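(* The following decision problem is $NP$-complete. Instance: an even bipartite graph $G$ with $\Delta(G)=4$. Question: does $G$ have a locally-balanced $2$-partition with an open neighborhood?
   Context: All graphs are finite, undirected, without loops or multiple edges. $V(G)$ denotes the vertex set of $G$, $N_G(v)$ the set of neighbors of a vertex $v$, and $\Delta(G)$ the maximum degree of $G$. A graph is even if the degree of every vertex is even. A $2$-partition of a graph $G$ is a function $f:V(G)\to\{0,1\}$. A $2$-partition $f$ of $G$ is locally-balanced with an open neighborhood if for every $v\in V(G)$, $\bigl|\,|\{u\in N_G(v): f(u)=0\}|-|\{u\in N_G(v): f(u)=1\}|\,\bigr|\le 1$. *)

theory Defs
  imports Main "HOL-Computational_Algebra.Polynomial"
begin

section \<open>Deterministic multi-tape Turing machines\<close>

text \<open>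
  States and tape symbols are initial segments of the natural numbers. State 0 is the start
  state and states 1 and 2 are the (halting) accepting and rejecting states. Symbol 0 is the
  blank, symbols 1 and 2 stand for the bits False and True. Every tape is infinite in both
  directions. Tape 0 holds the input; tape 1 holds the second input (if there is one) and, for
  machines computing a function, the output.
\<close>

datatype move = Left | Stay | Right

record tm =
  tm_tapes :: nat
  tm_symbols :: nat
  tm_states :: nat
  tm_delta :: "nat \<Rightarrow> nat list \<Rightarrow> nat \<times> (nat \<times> move) list"

abbreviation accept_state :: nat where "accept_state \<equiv> 1"
abbreviation reject_state :: nat where "reject_state \<equiv> 2"

text \<open>
  Only the values of the transition function on the finitely many pairs of a non-halting state and
  a tuple of symbols matter, so a well-formed machine is a finite object.
\<close>

definition wf_tm :: "tm \<Rightarrow> bool" where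
  "wf_tm M \<longleftrightarrow> tm_tapes M \<ge> 2 \<and> tm_symbols M \<ge> 3 \<and> tm_states M \<ge> 3 \<and>
     (\<forall>q ss. q < tm_states M \<longrightarrow> q \<notin> {accept_state, reject_state} \<longrightarrow>
        length ss = tm_tapes M \<longrightarrow> set ss \<subseteq> {..<tm_symbols M} \<longrightarrow>
        (case tm_delta M q ss of (q', as) \<Rightarrow>
           q' < tm_states M \<and> length as = tm_tapes M \<and> fst ` set as \<subseteq> {..<tm_symbols M}))"

text \<open>A tape is a head position together with the contents of the cells.\<close>

type_synonym tape = "int \<times> (int \<Rightarrow> nat)"
type_synonym config = "nat \<times> tape list"

fun offset :: "move \<Rightarrow> int" where
  "offset Left = -1"
| "offset Stay = 0"
| "offset Right = 1"

fun read_tape :: "tape \<Rightarrow> nat" where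
  "read_tape (p, c) = c p"

fun act_tape :: "nat \<times> move \<Rightarrow> tape \<Rightarrow> tape" where
  "act_tape (s, m) (p, c) = (p + offset m, c(p := s))"

fun tm_step :: "tm \<Rightarrow> config \<Rightarrow> config" where
  "tm_step M (q, ts) =
     (if q \<in> {accept_state, reject_state} then (q, ts)
      else case tm_delta M q (map read_tape ts) of (q', as) \<Rightarrow> (q', map2 act_tape as ts))"

definition word_cells :: "bool list \<Rightarrow> int \<Rightarrow> nat" where
  "word_cells w i =
     (if 0 \<le> i \<and> i < int (length w) then (if w ! nat i then 2 else 1) else 0)"

definition tm_start :: "tm \<Rightarrow> bool list list \<Rightarrow> config" where
  "tm_start M ws =
     (0, map (\<lambda>i. (0, word_cells (if i < length ws then ws ! i else []))) [0..<tm_tapes M])"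

text \<open>Since halting configurations are fixed by \<^const>\<open>tm_step\<close>, this is the configuration
  after at most \<open>t\<close> steps.\<close>

definition tm_run :: "tm \<Rightarrow> bool list list \<Rightarrow> nat \<Rightarrow> config" where
  "tm_run M ws t = (tm_step M ^^ t) (tm_start M ws)"


section \<open>Polynomial time, NP and NP-completeness\<close>

definition poly_time_fun :: "(bool list \<Rightarrow> bool list) \<Rightarrow> bool" where
  "poly_time_fun f \<longleftrightarrow>
     (\<exists>M (p :: nat poly). wf_tm M \<and>
        (\<forall>x. case tm_run M [x] (poly p (length x)) of (q, ts) \<Rightarrow>
           q = accept_state \<and> snd (ts ! 1) = word_cells (f x)))"

definition poly_time_rel :: "(bool list \<Rightarrow> bool list \<Rightarrow> bool) \<Rightarrow> bool" where
  "poly_time_rel R \<longleftrightarrow>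
     (\<exists>M (p :: nat poly). wf_tm M \<and>
        (\<forall>x y. fst (tm_run M [x, y] (poly p (length x + length y))) =
           (if R x y then accept_state else reject_state)))"

definition NP :: "bool list set set" where
  "NP = {L. \<exists>R (p :: nat poly). poly_time_rel R \<and>
     (\<forall>x. x \<in> L \<longleftrightarrow> (\<exists>c. length c \<le> poly p (length x) \<and> R x c))}"

definition poly_reducible :: "bool list set \<Rightarrow> bool list set \<Rightarrow> bool" (infix \<open>\<le>\<^sub>p\<close> 50) where
  "L \<le>\<^sub>p L' \<longleftrightarrow> (\<exists>f. poly_time_fun f \<and> (\<forall>x. x \<in> L \<longleftrightarrow> f x \<in> L'))"

definition NP_complete :: "bool list set \<Rightarrow> bool" where
  "NP_complete L \<longleftrightarrow> L \<in> NP \<and> (\<forall>L' \<in> NP. L' \<le>\<^sub>p L)"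


section \<open>Graphs\<close>

record 'a ugraph =
  verts :: "'a set"
  edges :: "'a set set"

definition simple_graph :: "'a ugraph \<Rightarrow> bool" where
  "simple_graph G \<longleftrightarrow> finite (verts G) \<and>
     (\<forall>e \<in> edges G. \<exists>u \<in> verts G. \<exists>v \<in> verts G. u \<noteq> v \<and> e = {u, v})"

definition neighbors :: "'a ugraph \<Rightarrow> 'a \<Rightarrow> 'a set" where
  "neighbors G v = {u. {u, v} \<in> edges G}"

definition vertex_degree :: "'a ugraph \<Rightarrow> 'a \<Rightarrow> nat" where
  "vertex_degree G v = card (neighbors G v)"

text \<open>The maximum degree of the graph without vertices is 0.\<close>

definition max_degree :: "'a ugraph \<Rightarrow> nat" where
  "max_degree G = Max (insert 0 (vertex_degree G ` verts G))"

definition even_graph :: "'a ugraph \<Rightarrow> bool" where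
  "even_graph G \<longleftrightarrow> (\<forall>v \<in> verts G. even (vertex_degree G v))"

definition bipartite :: "'a ugraph \<Rightarrow> bool" where
  "bipartite G \<longleftrightarrow> (\<exists>X Y. X \<union> Y = verts G \<and> X \<inter> Y = {} \<and>
     (\<forall>e \<in> edges G. \<exists>x \<in> X. \<exists>y \<in> Y. e = {x, y}))"

definition two_partition :: "'a ugraph \<Rightarrow> ('a \<Rightarrow> nat) \<Rightarrow> bool" where
  "two_partition G f \<longleftrightarrow> f ` verts G \<subseteq> {0, 1}"

definition locally_balanced_open :: "'a ugraph \<Rightarrow> ('a \<Rightarrow> nat) \<Rightarrow> bool" where
  "locally_balanced_open G f \<longleftrightarrow> (\<forall>v \<in> verts G.
     \<bar>int (card {u \<in> neighbors G v. f u = 0}) - int (card {u \<in> neighbors G v. f u = 1})\<bar> \<le> 1)"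


section \<open>Encoding of graphs as bit strings\<close>

text \<open>
  A graph with vertex set \<open>{0, ..., n - 1}\<close> (up to isomorphism, any finite graph) is encoded by
  \<open>n\<close> in unary, a terminating False, and its adjacency matrix row by row.
\<close>

definition graph_code :: "nat ugraph \<Rightarrow> bool list" where
  "graph_code G = (let n = card (verts G) in
     replicate n True @ [False] @
     concat (map (\<lambda>i. map (\<lambda>j. {i, j} \<in> edges G) [0..<n]) [0..<n]))"

lemma graph_code_inject:
  assumes G: "simple_graph G" "verts G = {0..<n}"
    and H: "simple_graph H" "verts H = {0..<m}"
    and eq: "graph_code G = graph_code H"
  shows "G = H"
proof -
  have aux: "takeWhile id (replicate k True @ False # xs) = replicate k True" for k xs
    by (induction k) auto
  have pre: "takeWhile id (graph_code G) = replicate n True"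
    "takeWhile id (graph_code H) = replicate m True"
    using G H by (simp_all add: graph_code_def Let_def aux)
  have nm: "n = m"
    using pre eq by (metis length_replicate)
  let ?rows = "\<lambda>K. map (\<lambda>i. map (\<lambda>j. {i, j} \<in> edges K) [0..<n]) [0..<n]"
  have cG: "graph_code G = replicate n True @ [False] @ concat (?rows G)"
    using G by (simp add: graph_code_def)
  have cH: "graph_code H = replicate n True @ [False] @ concat (?rows H)"
    using H nm by (simp add: graph_code_def)
  have "concat (?rows G) = concat (?rows H)"
    using eq unfolding cG cH by simp
  moreover have "length a = length b" if ab: "(a, b) \<in> set (zip (?rows G) (?rows H))" for a b
  proof -
    have "a \<in> set (?rows G)" "b \<in> set (?rows H)"
      using set_zip_leftD[OF ab] set_zip_rightD[OF ab] .
    then show ?thesis by (elim imageE | simp)+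
  qed
  ultimately have rows: "?rows G = ?rows H"
    by (intro concat_injective) (simp, simp, blast)
  have iff: "{i, j} \<in> edges G \<longleftrightarrow> {i, j} \<in> edges H" if "i < n" "j < n" for i j
  proof -
    have "?rows G ! i ! j = ?rows H ! i ! j"
      unfolding rows ..
    then show ?thesis using that by simp
  qed
  have "e \<in> edges G \<longleftrightarrow> e \<in> edges H" for e
  proof
    assume e: "e \<in> edges G"
    then obtain u v where "u < n" "v < n" "e = {u, v}"
      using G unfolding simple_graph_def by fastforce
    then show "e \<in> edges H" using e iff by simp
  next
    assume e: "e \<in> edges H"
    then obtain u v where "u < n" "v < n" "e = {u, v}"
      using H nm unfolding simple_graph_def by fastforce
    then show "e \<in> edges G" using e iff by simp
  qed
  then have "edges G = edges H" by blast
  then show ?thesis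
    using G H nm by simp
qed

text \<open>
  The language of a decision problem about graphs consists of the codes of the yes-instances;
  strings that do not encode an instance are outside the language.
\<close>

definition graph_language :: "(nat ugraph \<Rightarrow> bool) \<Rightarrow> (nat ugraph \<Rightarrow> bool) \<Rightarrow> bool list set" where
  "graph_language inst question =
     {graph_code G | G. simple_graph G \<and> (\<exists>n. verts G = {0..<n}) \<and> inst G \<and> question G}"

end

theory Submission
  imports Defs
begin

text \<open>
  Hardness is a generic reduction: the run of a verifier on an unknown certificate is expressed as a tiling of
  a rectangle, the tiling as a formula whose constraints ask for exactly two true literals out of four,
  and the formula as a graph. A row of the tiling is the configuration of the machine seen from the
  heads (tapes move under fixed heads), so that a cell of the next row depends only on three cells and
  on the central cell, which is broadcast along the row. In the graph a variable is a long even cycle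
  of alternating slots and degree-2 vertices, around which the values of a balanced partition
  alternate; a constraint is a pair of twin vertices adjacent to four slots. Since each constraint
  occurs twice, every slot has degree 2 or 4, and the balance conditions at the slots can always be met
  by giving consecutive degree-2 vertices, and also twins, different values.

  All algorithms are arithmetic expressions with bounded sums, evaluated on unary counters: a counter
  is a tape with a mark on cell 0 whose value is the position of its head. Polynomially bounded
  expressions suffice both to check certificates and to decide adjacency in the constructed graph.
\<close>

section \<open>Counter programs\<close>

text \<open>The graph class dictates the source problem. In an even graph balance is exact, so a
  vertex of degree 2 makes its two neighbours differ and a vertex of degree 4 asks for exactly two
  ones among four. Negation costs nothing, since values alternate around a cycle. These conditions
  survive complementing all values, so no constant can be enforced; by the same symmetry one
  variable may be declared to be True. The reduction must itself be run by a Turing machine. Hence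
  vertices, constraints and variables are numbered by closed arithmetic formulas, and all that
  depends on the given verifier is a finite table of constraint patterns. The table does not grow
  with the input because a cell is described by a tile from a fixed set and one of boundedly many
  kinds. The rectangle needs no boundary conditions: wrong information entering at its sides
  advances one column per row, and the rectangle is wide enough that it cannot reach the central
  column in time.\<close>

datatype cmd = Skip | Inc nat | Dec nat | Put nat | Seq cmd cmd
  | If nat nat cmd cmd | While nat nat cmd

text \<open>Programs change the contents of tape 1 only: tape 0 keeps the input and a counter tape
  keeps its single mark. Head positions and the contents of tape 1 are therefore the whole data
  state.\<close>

type_synonym store = "(nat \<Rightarrow> int) \<times> (int \<Rightarrow> nat)"

definition cell :: "bool list \<Rightarrow> (int \<Rightarrow> nat) \<Rightarrow> nat \<Rightarrow> int \<Rightarrow> nat" where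
  "cell x u i p = (if i = 0 then word_cells x p else if i = 1 then u p else if p = 0 then 1 else 0)"

fun scan :: "bool list \<Rightarrow> nat \<Rightarrow> store \<Rightarrow> nat" where
  "scan x i (h, u) = cell x u i (h i)"

fun step :: "bool list \<Rightarrow> cmd list \<times> store \<Rightarrow> cmd list \<times> store" where
  "step x ([], s) = ([], s)"
| "step x (Skip # K, s) = (K, s)"
| "step x (Inc i # K, (h, u)) = (K, (h(i := h i + 1), u))"
| "step x (Dec i # K, (h, u)) = (K, (h(i := h i - 1), u))"
| "step x (Put a # K, (h, u)) = (K, (h, u(h 1 := a)))"
| "step x (Seq c d # K, s) = (c # d # K, s)"
| "step x (If i a c d # K, s) = ((if scan x i s = a then c else d) # K, s)"
| "step x (While i a c # K, s) = (if scan x i s = a then K else c # While i a c # K, s)"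

fun wf_cmd :: "nat \<Rightarrow> cmd \<Rightarrow> bool" where
  "wf_cmd k Skip \<longleftrightarrow> True"
| "wf_cmd k (Inc i) \<longleftrightarrow> i < k"
| "wf_cmd k (Dec i) \<longleftrightarrow> i < k"
| "wf_cmd k (Put a) \<longleftrightarrow> a < 3 \<and> 1 < k"
| "wf_cmd k (Seq c d) \<longleftrightarrow> wf_cmd k c \<and> wf_cmd k d"
| "wf_cmd k (If i a c d) \<longleftrightarrow> i < k \<and> wf_cmd k c \<and> wf_cmd k d"
| "wf_cmd k (While i a c) \<longleftrightarrow> i < k \<and> wf_cmd k c"

text \<open>The one condition of \<open>wf_cmd\<close> that a larger number of tapes cannot
  repair.\<close>

fun puts_ok :: "cmd \<Rightarrow> bool" where
  "puts_ok (Put a) \<longleftrightarrow> a < 3"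
| "puts_ok (Seq c d) \<longleftrightarrow> puts_ok c \<and> puts_ok d"
| "puts_ok (If i a c d) \<longleftrightarrow> puts_ok c \<and> puts_ok d"
| "puts_ok (While i a c) \<longleftrightarrow> puts_ok c"
| "puts_ok _ \<longleftrightarrow> True"

lemma wf_cmd_mono: "wf_cmd k c \<Longrightarrow> k \<le> l \<Longrightarrow> wf_cmd l c"
  by (induction c) auto

lemma wf_cmd_exists: "puts_ok c \<Longrightarrow> \<exists>k. wf_cmd k c"
proof (induction c)
  case (Put a)
  then show ?case by (auto intro!: exI[of _ 2])
next
  case (Seq c d)
  then obtain k l where "wf_cmd k c" "wf_cmd l d" by auto
  then show ?case by (auto intro!: exI[of _ "max k l"] elim: wf_cmd_mono)
next
  case (If i a c d)
  then obtain k l where "wf_cmd k c" "wf_cmd l d" by auto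
  then show ?case by (auto intro!: exI[of _ "max (Suc i) (max k l)"] elim: wf_cmd_mono)
next
  case (While i a c)
  then obtain k where "wf_cmd k c" by auto
  then show ?case by (auto intro!: exI[of _ "max (Suc i) k"] elim: wf_cmd_mono)
qed auto

section \<open>Programs as Turing machines\<close>

fun control :: "cmd list \<Rightarrow> nat list \<Rightarrow> cmd list" where
  "control [] ss = []"
| "control (Seq c d # K) ss = c # d # K"
| "control (If i a c d # K) ss = (if ss ! i = a then c else d) # K"
| "control (While i a c # K) ss = (if ss ! i = a then K else c # While i a c # K)"
| "control (_ # K) ss = K"

fun action :: "cmd list \<Rightarrow> nat \<Rightarrow> nat \<Rightarrow> nat \<times> move" where
  "action (Inc i # K) j s = (s, if j = i then Right else Stay)"
| "action (Dec i # K) j s = (s, if j = i then Left else Stay)"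
| "action (Put a # K) j s = (if j = 1 then a else s, Stay)"
| "action _ j s = (s, Stay)"

text \<open>These become states of the machine: the continuations that can occur while
  \<open>c\<close> runs on top of \<open>K\<close>, without \<open>K\<close> itself. The body of a
  loop is followed by the same loop, so unfolding creates nothing new and the set stays
  finite.\<close>

fun conts :: "cmd \<Rightarrow> cmd list \<Rightarrow> cmd list set" where
  "conts (Seq c d) K = insert (Seq c d # K) (conts c (d # K) \<union> conts d K)"
| "conts (If i a c d) K = insert (If i a c d # K) (conts c K \<union> conts d K)"
| "conts (While i a c) K = insert (While i a c # K) (conts c (While i a c # K))"
| "conts c K = {c # K}"

lemma finite_conts: "finite (conts c K)"
  by (induction c arbitrary: K) auto

lemma conts_self: "c # K \<in> conts c K"
  by (cases c) auto

lemma control_conts: "L \<in> conts c K \<Longrightarrow> control L ss \<in> insert K (conts c K)"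
proof (induction c arbitrary: K L)
  case (Seq c d)
  show ?case using Seq.prems Seq.IH(1)[of L "d # K"] Seq.IH(2)[of L K]
    conts_self[of c "d # K"] conts_self[of d K] by auto
next
  case (If i a c d)
  show ?case using If.prems If.IH(1)[of L K] If.IH(2)[of L K]
    conts_self[of c K] conts_self[of d K] by auto
next
  case (While i a c)
  show ?case using While.prems While.IH[of L "While i a c # K"]
    conts_self[of c "While i a c # K"] by (auto split: if_splits)
qed auto

lemma conts_wf: "wf_cmd k c \<Longrightarrow> L \<in> conts c K \<Longrightarrow> list_all (wf_cmd k) K \<Longrightarrow> list_all (wf_cmd k) L"
proof (induction c arbitrary: K L)
  case (Seq c d)
  show ?case using Seq.prems Seq.IH(1)[of L "d # K"] Seq.IH(2)[of L K] by auto
next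
  case (If i a c d)
  show ?case using If.prems If.IH(1)[of L K] If.IH(2)[of L K] by auto
next
  case (While i a c)
  show ?case using While.prems While.IH[of L "While i a c # K"] by auto
qed auto

definition tapes :: "nat \<Rightarrow> bool list \<Rightarrow> store \<Rightarrow> tape list" where
  "tapes k x s = map (\<lambda>i. (fst s i, cell x (snd s) i)) [0..<k]"

lemma tapes_step:
  assumes "list_all (wf_cmd k) K"
  shows "tapes k x (snd (step x (K, s))) =
    map2 act_tape (map2 (action K) [0..<k] (map read_tape (tapes k x s))) (tapes k x s)"
    and "fst (step x (K, s)) = control K (map read_tape (tapes k x s))"
proof -
  obtain h u where s: "s = (h, u)" by (cases s)
  let ?ss = "map read_tape (tapes k x s)"
  have ss: "?ss ! i = cell x u i (h i)" if "i < k" for i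
    using that by (simp add: tapes_def s)
  show "fst (step x (K, s)) = control K ?ss"
  proof (cases K)
    case (Cons c L)
    then show ?thesis using assms ss s by (cases c) auto
  qed auto
  show "tapes k x (snd (step x (K, s))) =
    map2 act_tape (map2 (action K) [0..<k] ?ss) (tapes k x s)" (is "?l = ?r")
  proof (rule nth_equalityI)
    fix i assume "i < length ?l"
    then have i: "i < k" by (simp add: tapes_def)
    have r: "?r ! i = act_tape (action K i (cell x u i (h i))) (h i, cell x u i)"
      using i by (simp add: tapes_def s)
    show "?l ! i = ?r ! i"
    proof (cases K)
      case Nil
      then show ?thesis using i r by (simp add: tapes_def s)
    next
      case (Cons c L)
      then show ?thesis using i r by (cases c) (auto simp add: tapes_def s cell_def fun_eq_iff)
    qed
  qed (simp add: tapes_def)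
qed

text \<open>State 0 writes the marks of the counter tapes, and the empty continuation is the state that
  accepts iff the counter \<open>r\<close> is nonzero.\<close>

definition machine :: "nat \<Rightarrow> nat \<Rightarrow> cmd \<Rightarrow> (cmd list \<Rightarrow> nat) \<Rightarrow> nat \<Rightarrow> tm" where
  "machine k r P e n = \<lparr>tm_tapes = k, tm_symbols = 3, tm_states = n,
     tm_delta = (\<lambda>q ss. if q = 0 then (e [P], map (\<lambda>i. (if i < 2 then ss ! i else 1, Stay)) [0..<k])
       else let K = inv_into (insert [] (conts P [])) e q in
         (if K = [] then (if ss ! r = 1 then reject_state else accept_state) else e (control K ss),
          map2 (action K) [0..<k] ss))\<rparr>"

text \<open>A single input amounts to an empty second input, so \<open>program_machine\<close>
  serves relations and functions alike.\<close>

lemma tm_start_second_empty: "tm_start M [x] = tm_start M [x, []]"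
  by (auto simp add: tm_start_def word_cells_def less_Suc_eq fun_eq_iff)

lemma tm_run_add: "tm_run M ws (s + t) = (tm_step M ^^ t) (tm_run M ws s)"
  by (simp add: tm_run_def add.commute[of s] funpow_add)

lemma tm_run_halted:
  assumes "fst (tm_run M ws s) \<in> {accept_state, reject_state}" "s \<le> t"
  shows "tm_run M ws t = tm_run M ws s"
proof -
  obtain q ts where q: "tm_run M ws s = (q, ts)" by fastforce
  have "tm_step M (q, ts) = (q, ts)" using assms(1) q by auto
  then have "(tm_step M ^^ n) (q, ts) = (q, ts)" for n by (induction n) auto
  then show ?thesis using tm_run_add[of M ws s "t - s"] assms(2) q by simp
qed

text \<open>One step of the program is one step of the machine. The two extra steps are the initial
  one, which writes the marks, and the final one, which inspects counter \<open>r\<close>.\<close>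

lemma program_machine:
  assumes P: "wf_cmd k P" and k: "2 \<le> r" "r < k"
  shows "\<exists>M. wf_tm M \<and> (\<forall>x w t h u. (step x ^^ t) ([P], (\<lambda>_. 0, word_cells w)) = ([], (h, u)) \<longrightarrow>
    (\<forall>t' \<ge> t + 2. \<exists>ts. tm_run M [x, w] t' = (if h r = 0 then reject_state else accept_state, ts) \<and>
      snd (ts ! 1) = u))"
proof -
  let ?S = "insert [] (conts P [])"
  have fin: "finite ?S" by (simp add: finite_conts)
  obtain e0 where e0: "bij_betw e0 ?S {0..<card ?S}"
    using ex_bij_betw_finite_nat[OF fin] by blast
  \<comment> \<open>The shift keeps states 0, 1 and 2 free for starting, accepting and
    rejecting.\<close>
  define e where "e = (\<lambda>K. e0 K + 3)"
  have inj: "inj_on e ?S"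
    using e0 by (auto simp add: e_def bij_betw_def inj_on_def)
  have elt: "e K < card ?S + 3" if "K \<in> ?S" for K
    using bij_betwE[OF e0] that by (fastforce simp add: e_def)
  have e3: "3 \<le> e K" for K by (simp add: e_def)
  define M where "M = machine k r P e (card ?S + 3)"
  have eimg: "K \<in> ?S \<Longrightarrow> inv_into ?S e (e K) = K" for K
    using inj by simp
  have surj: "\<exists>K\<in>?S. q = e K" if "q < card ?S + 3" "q \<noteq> 0" "q \<notin> {1, 2}" for q
  proof -
    have "q - 3 \<in> e0 ` ?S" using that e0 unfolding bij_betw_def by auto
    then obtain K where "K \<in> ?S" "q - 3 = e0 K" by auto
    moreover have "3 \<le> q" using that by auto
    ultimately show ?thesis by (auto simp add: e_def intro!: bexI[of _ K])
  qed
  have wfS: "list_all (wf_cmd k) K" if "K \<in> ?S" for K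
    using conts_wf[OF P, of K "[]"] that by auto
  have ctl: "control K ss \<in> ?S" if "K \<in> ?S" for K ss
    using control_conts[of K P "[]" ss] that by auto
  have act3: "fst (action K j s) < 3" if "K \<in> ?S" "s < 3" for K j s
  proof (cases K)
    case (Cons c L)
    then show ?thesis using wfS[OF that(1)] that(2) by (cases c) auto
  qed (use that in auto)
  have PS: "[P] \<in> ?S" using conts_self by auto
  have wf: "wf_tm M"
    unfolding wf_tm_def
  proof (intro conjI allI impI)
    fix q ss assume q: "q < tm_states M" "q \<notin> {accept_state, reject_state}"
      and ss: "length ss = tm_tapes M" "set ss \<subseteq> {..<tm_symbols M}"
    have lss: "ss ! i < 3" if "i < k" for i
      using ss that nth_mem[of i ss] unfolding M_def machine_def by (simp add: subset_eq)
    show "case tm_delta M q ss of (q', as) \<Rightarrow>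
           q' < tm_states M \<and> length as = tm_tapes M \<and> fst ` set as \<subseteq> {..<tm_symbols M}"
    proof (cases "q = 0")
      case True
      then show ?thesis using elt[OF PS] lss by (auto simp add: M_def machine_def)
    next
      case False
      then obtain K where K: "K \<in> ?S" "q = e K"
        using surj[of q] q by (auto simp add: M_def machine_def)
      show ?thesis using False K eimg[OF K(1)] elt[OF ctl[OF K(1)], of ss] ss act3[OF K(1)] lss
        by (auto simp add: M_def machine_def Let_def set_zip)
    qed
  qed (use k in \<open>auto simp add: M_def machine_def\<close>)
  have stepM: "tm_step M (e K, tapes k x s) =
      (e (fst (step x (K, s))), tapes k x (snd (step x (K, s))))" if "K \<in> ?S" "K \<noteq> []" for K x s
  proof -
    have "e K \<notin> {0, 1, 2}" using e3[of K] by auto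
    then show ?thesis
      using tapes_step[OF wfS[OF that(1)], of x s] eimg[OF that(1)] that(2)
      by (simp add: M_def machine_def Let_def)
  qed
  \<comment> \<open>A finished program idles, whereas the machine leaves \<open>e []\<close> in its
    next step. So the simulation is claimed for some \<open>n \<le> t\<close> only; halting makes up
    for the difference.\<close>
  have sim: "\<exists>n \<le> t. (tm_step M ^^ n) (e K, tapes k x s) = (e [], tapes k x s')"
    if "(step x ^^ t) (K, s) = ([], s')" "K \<in> ?S" for t K x s s'
    using that
  proof (induction t arbitrary: K s)
    case (Suc t)
    show ?case
    proof (cases "K = []")
      case True
      have "(step x ^^ n) ([], s) = ([], s)" for n by (induction n) auto
      from this[of "Suc t"] have "s' = s" using Suc.prems True by (simp del: funpow.simps)
      then show ?thesis using True by (intro exI[of _ 0]) auto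
    next
      case False
      obtain K1 s1 where 1: "step x (K, s) = (K1, s1)" by (metis surj_pair)
      have "K1 \<in> ?S" using tapes_step(2)[OF wfS[OF Suc.prems(2)], of x s] ctl[OF Suc.prems(2)] 1
        by simp
      moreover have "(step x ^^ t) (K1, s1) = ([], s')"
        using Suc.prems 1 by (simp add: funpow_swap1)
      ultimately obtain n where n: "n \<le> t" "(tm_step M ^^ n) (e K1, tapes k x s1) = (e [], tapes k x s')"
        using Suc.IH by blast
      show ?thesis using n stepM[OF Suc.prems(2) False, of x s] 1
        by (intro exI[of _ "Suc n"]) (simp add: funpow_swap1 del: funpow.simps(2) add: funpow.simps(2))
    qed
  qed (auto intro: exI[of _ 0])
  have "\<exists>ts. tm_run M [x, w] t' = (if h r = 0 then reject_state else accept_state, ts) \<and> snd (ts ! 1) = u"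
    if run: "(step x ^^ t) ([P], (\<lambda>_. 0, word_cells w)) = ([], (h, u))" and t': "t' \<ge> t + 2"
    for x w t h u t'
  proof -
    let ?q = "if h r = 0 then reject_state else accept_state"
    have st: "tm_start M [x, w] = (0, map (\<lambda>i. (0, if i = 0 then word_cells x else if i = 1 then word_cells w else word_cells [])) [0..<k])"
      by (auto simp add: tm_start_def M_def machine_def less_Suc_eq)
    have first: "tm_step M (tm_start M [x, w]) = (e [P], tapes k x (\<lambda>_. 0, word_cells w))"
      unfolding st
      by (auto simp add: M_def machine_def tapes_def cell_def word_cells_def fun_eq_iff intro!: nth_equalityI)
    obtain n where n: "n \<le> t"
      "(tm_step M ^^ n) (e [P], tapes k x (\<lambda>_. 0, word_cells w)) = (e [], tapes k x (h, u))"
      using sim[OF run PS] by blast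
    have last: "tm_step M (e [], tapes k x (h, u)) = (?q, tapes k x (h, u))"
    proof -
      have "e [] \<notin> {0, 1, 2}" using e3[of "[]"] by auto
      moreover have "inv_into ?S e (e []) = []" using eimg by simp
      moreover have "action [] = (\<lambda>j s. (s, Stay))" by (simp add: fun_eq_iff)
      ultimately show ?thesis
        using tapes_step(1)[of k "[]" x "(h, u)"] k
        by (simp add: M_def machine_def Let_def) (simp add: tapes_def cell_def)
    qed
    have run1: "tm_run M [x, w] (Suc n) = (e [], tapes k x (h, u))"
      unfolding tm_run_def by (simp add: funpow_swap1 first n)
    have run2: "tm_run M [x, w] (n + 2) = (?q, tapes k x (h, u))"
      using tm_run_add[of M "[x, w]" "Suc n" 1] run1 last by simp
    have "tm_run M [x, w] t' = (?q, tapes k x (h, u))"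
      using tm_run_halted[of M "[x, w]" "n + 2" t'] run2 n t' by (auto split: if_splits)
    then show ?thesis using k by (auto simp add: tapes_def cell_def fun_eq_iff)
  qed
  then show ?thesis using wf by blast
qed

section \<open>Timed runs on nonnegative head positions\<close>

fun embed :: "(nat \<Rightarrow> nat) \<times> (int \<Rightarrow> nat) \<Rightarrow> store" where
  "embed (g, u) = (\<lambda>i. int (g i), u)"

text \<open>The number \<open>t\<close> is chosen before the continuation \<open>K\<close>: a run
  does not depend on what follows it, so time bounds add up under sequencing.\<close>

definition exec :: "bool list \<Rightarrow> cmd \<Rightarrow> (nat \<Rightarrow> nat) \<times> (int \<Rightarrow> nat) \<Rightarrow>
    (nat \<Rightarrow> nat) \<times> (int \<Rightarrow> nat) \<Rightarrow> nat \<Rightarrow> bool" where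
  "exec x c s s' T \<longleftrightarrow> (\<exists>t \<le> T. \<forall>K. (step x ^^ t) (c # K, embed s) = (K, embed s'))"

lemma exec_mono: "exec x c s s' T \<Longrightarrow> T \<le> T' \<Longrightarrow> exec x c s s' T'"
  unfolding exec_def by (meson le_trans)

lemma exec_single: "(\<And>K. step x (c # K, embed s) = (K, embed s')) \<Longrightarrow> 1 \<le> T \<Longrightarrow> exec x c s s' T"
  unfolding exec_def by (intro exI[of _ 1]) auto

lemma exec_unfold:
  assumes "\<And>K. step x (c # K, embed s) = (d # K, embed s)" "exec x d s s' T"
  shows "exec x c s s' (Suc T)"
proof -
  obtain t where "t \<le> T" "\<And>K. (step x ^^ t) (d # K, embed s) = (K, embed s')"
    using assms(2) unfolding exec_def by blast
  then show ?thesis unfolding exec_def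
    by (intro exI[of _ "Suc t"]) (simp add: assms(1) funpow_swap1)
qed

lemma exec_unfold2:
  assumes "\<And>K. step x (c # K, embed s) = (d # e # K, embed s)"
    "exec x d s s1 T1" "exec x e s1 s' T2"
  shows "exec x c s s' (Suc (T1 + T2))"
proof -
  obtain t1 where 1: "t1 \<le> T1" "\<And>K. (step x ^^ t1) (d # K, embed s) = (K, embed s1)"
    using assms(2) unfolding exec_def by blast
  obtain t2 where 2: "t2 \<le> T2" "\<And>K. (step x ^^ t2) (e # K, embed s1) = (K, embed s')"
    using assms(3) unfolding exec_def by blast
  have "(step x ^^ (t2 + t1)) (d # e # K, embed s) = (K, embed s')" for K
    by (simp add: funpow_add 1 2)
  then show ?thesis using 1(1) 2(1) unfolding exec_def
    by (intro exI[of _ "Suc (t2 + t1)"]) (simp add: assms(1) funpow_swap1)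
qed

lemma exec_Skip: "1 \<le> T \<Longrightarrow> exec x Skip s s T"
  by (rule exec_single) simp_all

lemma exec_Inc: "g' = g(i := Suc (g i)) \<Longrightarrow> 1 \<le> T \<Longrightarrow> exec x (Inc i) (g, u) (g', u) T"
  by (rule exec_single) (auto simp add: fun_eq_iff)

lemma exec_Dec: "0 < g i \<Longrightarrow> g' = g(i := g i - 1) \<Longrightarrow> 1 \<le> T \<Longrightarrow> exec x (Dec i) (g, u) (g', u) T"
  by (rule exec_single) (auto simp add: fun_eq_iff)

lemma exec_Put: "u' = u(int (g 1) := a) \<Longrightarrow> 1 \<le> T \<Longrightarrow> exec x (Put a) (g, u) (g, u') T"
  by (rule exec_single) (auto simp add: fun_eq_iff)

lemma exec_Seq: "exec x c s s1 T1 \<Longrightarrow> exec x d s1 s' T2 \<Longrightarrow> exec x (Seq c d) s s' (Suc (T1 + T2))"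
  by (rule exec_unfold2) auto

lemma exec_If:
  "exec x (if scan x i (embed s) = a then c else d) s s' T \<Longrightarrow> exec x (If i a c d) s s' (Suc T)"
  by (rule exec_unfold) auto

lemma exec_While_exit: "scan x i (embed s) = a \<Longrightarrow> 1 \<le> T \<Longrightarrow> exec x (While i a c) s s T"
  by (rule exec_single) auto

lemma exec_While_step:
  "scan x i (embed s) \<noteq> a \<Longrightarrow> exec x c s s1 T1 \<Longrightarrow> exec x (While i a c) s1 s' T2 \<Longrightarrow>
    exec x (While i a c) s s' (Suc (T1 + T2))"
  by (rule exec_unfold2) auto

lemma scan_counter: "2 \<le> i \<Longrightarrow> scan x i (embed (g, u)) = (if g i = 0 then 1 else 0)"
  by (auto simp add: cell_def)

text \<open>The symbol 1 is the mark on cell 0, read exactly when counter \<open>i\<close> is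
  exhausted.\<close>

definition Loop :: "nat \<Rightarrow> cmd \<Rightarrow> cmd" where
  "Loop i c = While i 1 (Seq (Dec i) c)"

text \<open>\<open>G m\<close> and \<open>U m\<close> describe the state after \<open>m\<close>
  rounds apart from counter \<open>i\<close>, which the loop itself controls. A round costs three
  steps more than its body: the test, the sequencing and the decrement.\<close>

lemma exec_Loop:
  assumes i: "2 \<le> i"
    and body: "\<And>m. m < n \<Longrightarrow>
      exec x c ((G m)(i := n - Suc m), U m) ((G (Suc m))(i := n - Suc m), U (Suc m)) T"
    and s: "s = ((G 0)(i := n), U 0)" and s': "s' = ((G n)(i := 0), U n)"
  shows "exec x (Loop i c) s s' (n * (T + 3) + 1)"
proof -
  have "j \<le> n \<Longrightarrow> exec x (Loop i c) ((G (n - j))(i := j), U (n - j)) s' (j * (T + 3) + 1)" for j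
  proof (induction j)
    case 0
    have "exec x (While i 1 (Seq (Dec i) c)) ((G n)(i := 0), U n) ((G n)(i := 0), U n) 1"
      by (rule exec_While_exit) (use i in \<open>simp_all add: cell_def\<close>)
    then show ?case unfolding Loop_def s' by (simp only: diff_zero mult_0 add_0)
  next
    case (Suc j)
    have m: "n - Suc j < n" "n - Suc (n - Suc j) = j" "Suc (n - Suc j) = n - j"
      using Suc.prems by auto
    have b: "exec x (Seq (Dec i) c) ((G (n - Suc j))(i := Suc j), U (n - Suc j))
        ((G (n - j))(i := j), U (n - j)) (Suc (1 + T))"
      by (rule exec_Seq[OF exec_Dec]) (use body[OF m(1)] m i in \<open>auto\<close>)
    have "exec x (Loop i c) ((G (n - Suc j))(i := Suc j), U (n - Suc j)) s'
        (Suc (Suc (1 + T) + (j * (T + 3) + 1)))"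
      unfolding Loop_def
      by (rule exec_While_step[OF _ b Suc.IH[unfolded Loop_def]])
        (use Suc.prems i in \<open>auto simp add: cell_def\<close>)
    then show ?case by (rule exec_mono) simp
  qed
  from this[of n] show ?thesis by (simp add: s)
qed

lemma exec_move:
  assumes "2 \<le> i" "i \<noteq> j" "g i \<le> n" "g' = g(j := g j + g i, i := 0)"
  shows "exec x (Loop i (Inc j)) (g, u) (g', u) (n * 4 + 1)"
proof -
  have "exec x (Loop i (Inc j)) (g, u) (g', u) (g i * (1 + 3) + 1)"
    by (rule exec_Loop[where G = "\<lambda>m. g(j := g j + m)" and U = "\<lambda>_. u"])
      (use assms in \<open>auto intro!: exec_Inc simp add: fun_eq_iff\<close>)
  then show ?thesis by (rule exec_mono) (simp add: assms)
qed

lemma exec_clear: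
  assumes "2 \<le> i" "g i \<le> n" "g' = g(i := 0)"
  shows "exec x (Loop i Skip) (g, u) (g', u) (n * 4 + 1)"
proof -
  have "exec x (Loop i Skip) (g, u) (g', u) (g i * (1 + 3) + 1)"
    by (rule exec_Loop[where G = "\<lambda>m. g" and U = "\<lambda>_. u"])
      (use assms in \<open>auto intro!: exec_Skip\<close>)
  then show ?thesis by (rule exec_mono) (simp add: assms)
qed

text \<open>Tapes 0 and 1 carry data instead of a mark and cannot be tested for zero, so the source
  must not exceed the target. This is how their heads return after reading.\<close>

lemma exec_retreat:
  assumes "2 \<le> i" "i \<noteq> j" "g i \<le> g j" "g i \<le> n" "g' = g(j := g j - g i, i := 0)"
  shows "exec x (Loop i (Dec j)) (g, u) (g', u) (n * 4 + 1)"
proof -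
  have "exec x (Loop i (Dec j)) (g, u) (g', u) (g i * (1 + 3) + 1)"
    by (rule exec_Loop[where G = "\<lambda>m. g(j := g j - m)" and U = "\<lambda>_. u"])
      (use assms in \<open>auto intro!: exec_Dec simp add: fun_eq_iff\<close>)
  then show ?thesis by (rule exec_mono) (simp add: assms)
qed

lemma exec_monus:
  assumes "2 \<le> i" "2 \<le> j" "i \<noteq> j" "g i \<le> n" "g' = g(j := g j - g i, i := 0)"
  shows "exec x (Loop i (If j 1 Skip (Dec j))) (g, u) (g', u) (n * 5 + 1)"
proof -
  have "exec x (Loop i (If j 1 Skip (Dec j))) (g, u) (g', u) (g i * (Suc 1 + 3) + 1)"
    by (rule exec_Loop[where G = "\<lambda>m. g(j := g j - m)" and U = "\<lambda>_. u"], fact, rule exec_If)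
      (use assms in \<open>auto intro!: exec_Dec exec_Skip simp add: fun_eq_iff scan_counter
         simp del: scan.simps embed.simps\<close>)
  then show ?thesis by (rule exec_mono) (simp add: assms)
qed

text \<open>Reading a counter destroys it. A copy therefore goes to two places, one of which is
  later used to undo the change.\<close>

lemma exec_copy:
  assumes "2 \<le> i" "i \<noteq> j" "i \<noteq> k" "j \<noteq> k" "g i \<le> n" "g' = g(j := g j + g i, k := g k + g i, i := 0)"
  shows "exec x (Loop i (Seq (Inc j) (Inc k))) (g, u) (g', u) (n * 6 + 1)"
proof -
  have "exec x (Loop i (Seq (Inc j) (Inc k))) (g, u) (g', u) (g i * (Suc (1 + 1) + 3) + 1)"
    by (rule exec_Loop[where G = "\<lambda>m. g(j := g j + m, k := g k + m)" and U = "\<lambda>_. u"], fact,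
        rule exec_Seq[OF exec_Inc[OF refl] exec_Inc])
      (use assms in \<open>auto simp add: fun_eq_iff\<close>)
  then show ?thesis by (rule exec_mono) (simp add: assms)
qed

section \<open>An expression language computable in polynomial time\<close>

datatype exp = N nat | V nat | Add exp exp | Sub exp exp | Mul exp exp
  | Sum nat exp exp | Len | Bit nat exp

fun eval :: "bool list \<Rightarrow> (int \<Rightarrow> nat) \<Rightarrow> exp \<Rightarrow> (nat \<Rightarrow> nat) \<Rightarrow> nat" where
  "eval x u (N c) g = c"
| "eval x u (V i) g = g i"
| "eval x u (Add a b) g = eval x u a g + eval x u b g"
| "eval x u (Sub a b) g = eval x u a g - eval x u b g"
| "eval x u (Mul a b) g = eval x u a g * eval x u b g"
| "eval x u (Sum v a b) g = (\<Sum>i<eval x u a g. eval x u b (g(v := i)))"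
| "eval x u Len g = length x"
| "eval x u (Bit t e) g = (if cell x u t (int (g t + eval x u e g)) = 2 then 1 else 0)"

text \<open>Variables are counter tapes, hence not 0 or 1; the counters from \<open>m\<close> on are
  left to the compiler as scratch space.\<close>

fun wf_exp :: "nat \<Rightarrow> exp \<Rightarrow> bool" where
  "wf_exp m (N c) \<longleftrightarrow> True"
| "wf_exp m (V i) \<longleftrightarrow> 2 \<le> i \<and> i < m"
| "wf_exp m (Add a b) \<longleftrightarrow> wf_exp m a \<and> wf_exp m b"
| "wf_exp m (Sub a b) \<longleftrightarrow> wf_exp m a \<and> wf_exp m b"
| "wf_exp m (Mul a b) \<longleftrightarrow> wf_exp m a \<and> wf_exp m b"
| "wf_exp m (Sum v a b) \<longleftrightarrow> 2 \<le> v \<and> v < m \<and> wf_exp m a \<and> wf_exp m b"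
| "wf_exp m Len \<longleftrightarrow> True"
| "wf_exp m (Bit t e) \<longleftrightarrow> t < 2 \<and> wf_exp m e"

lemma eval_cong:
  "wf_exp m e \<Longrightarrow> 2 \<le> m \<Longrightarrow> (\<And>i. i < m \<Longrightarrow> g i = g' i) \<Longrightarrow> eval x u e g = eval x u e g'"
proof (induction e arbitrary: g g')
  case (Sum v a b)
  have "eval x u a g = eval x u a g'" using Sum by (intro Sum.IH(1)) auto
  moreover have "eval x u b (g(v := i)) = eval x u b (g'(v := i))" for i
    using Sum.prems by (intro Sum.IH(2)) auto
  ultimately show ?case by simp
next
  case (Add a b)
  have "eval x u a g = eval x u a g'" "eval x u b g = eval x u b g'"
    using Add.prems by (intro Add.IH; auto)+
  then show ?case by simp
next
  case (Sub a b)
  have "eval x u a g = eval x u a g'" "eval x u b g = eval x u b g'"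
    using Sub.prems by (intro Sub.IH; auto)+
  then show ?case by simp
next
  case (Mul a b)
  have "eval x u a g = eval x u a g'" "eval x u b g = eval x u b g'"
    using Mul.prems by (intro Mul.IH; auto)+
  then show ?case by simp
next
  case (Bit t e)
  have "eval x u e g = eval x u e g'" using Bit by (intro Bit.IH) auto
  moreover have "g t = g' t" using Bit.prems by auto
  ultimately show ?case by simp
qed simp_all

text \<open>Here \<open>n\<close> bounds the input length and all variables. A variable bound by a
  sum may exceed \<open>n\<close>, but not \<open>n + vbound a n\<close>, which is therefore the
  argument for the summand.\<close>

fun vbound :: "exp \<Rightarrow> nat \<Rightarrow> nat" where
  "vbound (N c) n = c"
| "vbound (V i) n = n"
| "vbound (Add a b) n = vbound a n + vbound b n"
| "vbound (Sub a b) n = vbound a n"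
| "vbound (Mul a b) n = vbound a n * vbound b n"
| "vbound (Sum v a b) n = vbound a n * vbound b (n + vbound a n)"
| "vbound Len n = n"
| "vbound (Bit t e) n = 1"

lemma eval_le_vbound:
  "wf_exp m e \<Longrightarrow> (\<And>i. 2 \<le> i \<Longrightarrow> i < m \<Longrightarrow> g i \<le> n) \<Longrightarrow> length x \<le> n \<Longrightarrow> eval x u e g \<le> vbound e n"
proof (induction e arbitrary: g n)
  case (Sub a b)
  then have "eval x u a g \<le> vbound a n" by simp
  then show ?case by simp
next
  case (Sum v a b)
  have a: "eval x u a g \<le> vbound a n" using Sum by simp
  have "eval x u b (g(v := i)) \<le> vbound b (n + vbound a n)" if "i < eval x u a g" for i
    using Sum.prems a that by (intro Sum.IH(2)) (auto intro: trans_le_add1)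
  then have "eval x u (Sum v a b) g \<le> (\<Sum>i<eval x u a g. vbound b (n + vbound a n))"
    unfolding eval.simps by (intro sum_mono) auto
  also have "\<dots> \<le> vbound a n * vbound b (n + vbound a n)" using a by simp
  finally show ?case by simp
qed (simp_all add: add_mono mult_mono)

text \<open>The costs of the loops emitted by \<open>compile\<close>, with values bounded by
  \<open>vbound\<close>; 4, 5 and 6 steps per unit are the rates of moving, truncated subtraction
  and copying.\<close>

fun tbound :: "exp \<Rightarrow> nat \<Rightarrow> nat" where
  "tbound (N c) n = 2 * c + 1"
| "tbound (V i) n = 10 * n + 3"
| "tbound (Add a b) n = tbound a n + tbound b n + 4 * vbound b n + 3"
| "tbound (Sub a b) n = tbound a n + tbound b n + 5 * vbound b n + 3"
| "tbound (Mul a b) n =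
     tbound a n + vbound a n * (tbound b n + 4 * vbound b n + 5) + 4 * (vbound a n * vbound b n) + 4"
| "tbound (Sum v a b) n = (let k = vbound a n in tbound a n + 8 * n +
     k * (tbound b (n + k) + 4 * vbound b (n + k) + 11) + 4 * (k * vbound b (n + k)) + 10)"
| "tbound Len n = 10 * n + 3"
| "tbound (Bit t e) n = tbound e n + 10 * vbound e n + 7"

fun incs :: "nat \<Rightarrow> nat \<Rightarrow> cmd" where
  "incs 0 d = Skip"
| "incs (Suc n) d = Seq (Inc d) (incs n d)"

text \<open>The counters from \<open>d\<close> on are empty at the start, and at the end only
  \<open>d\<close> has changed. Intermediate values occupy the first of them, so an operand is
  compiled for the next free one. A sum uses the counter \<open>v\<close> itself as bound variable
  and keeps its old value in \<open>d + 2\<close>.\<close>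

fun compile :: "exp \<Rightarrow> nat \<Rightarrow> cmd" where
  "compile (N c) d = incs c d"
| "compile (V i) d = Seq (Loop i (Seq (Inc d) (Inc (d + 1)))) (Loop (d + 1) (Inc i))"
| "compile (Add a b) d = Seq (compile a d) (Seq (compile b (d + 1)) (Loop (d + 1) (Inc d)))"
| "compile (Sub a b) d =
     Seq (compile a d) (Seq (compile b (d + 1)) (Loop (d + 1) (If d 1 Skip (Dec d))))"
| "compile (Mul a b) d =
     Seq (compile a d)
    (Seq (Loop d (Seq (compile b (d + 2)) (Loop (d + 2) (Inc (d + 1)))))
         (Loop (d + 1) (Inc d)))"
| "compile (Sum v a b) d =
     Seq (compile a d)
    (Seq (Loop v (Inc (d + 2)))
    (Seq (Loop d (Seq (compile b (d + 3)) (Seq (Loop (d + 3) (Inc (d + 1))) (Inc v))))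
    (Seq (Loop v Skip)
    (Seq (Loop (d + 2) (Inc v))
         (Loop (d + 1) (Inc d))))))"
| "compile Len d = Seq (While 0 0 (Seq (Inc 0) (Seq (Inc d) (Inc (d + 1))))) (Loop (d + 1) (Dec 0))"
| "compile (Bit t e) d =
     Seq (compile e d)
    (Seq (Loop d (Seq (Inc t) (Inc (d + 1))))
    (Seq (If t 2 (Inc d) Skip)
         (Loop (d + 1) (Dec t))))"

lemma exec_incs: "g' = g(d := g d + c) \<Longrightarrow> exec x (incs c d) (g, u) (g', u) (2 * c + 1)"
proof (induction c arbitrary: g)
  case 0
  then show ?case by (simp add: exec_Skip)
next
  case (Suc c)
  have "exec x (incs (Suc c) d) (g, u) (g', u) (Suc (1 + (2 * c + 1)))"
    unfolding incs.simps
    by (rule exec_Seq[OF exec_Inc[OF refl] Suc.IH]) (use Suc.prems in \<open>auto simp add: fun_eq_iff\<close>)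
  then show ?case by (rule exec_mono) simp
qed

text \<open>The length is counted twice because the second count is spent on bringing the head of
  tape 0 back.\<close>

lemma exec_Len:
  assumes "2 \<le> d" "g d = 0" "g (d + 1) = 0" "g 0 = 0"
  shows "exec x (While 0 0 (Seq (Inc 0) (Seq (Inc d) (Inc (d + 1))))) (g, u)
    (g(0 := length x, d := length x, d + 1 := length x), u) (6 * length x + 1)"
proof -
  let ?g = "\<lambda>i. g(0 := i, d := i, d + 1 := i)"
  let ?c = "Seq (Inc 0) (Seq (Inc d) (Inc (d + 1)))"
  have "j \<le> length x \<Longrightarrow> exec x (While 0 0 ?c) (?g (length x - j), u) (?g (length x), u) (6 * j + 1)"
    for j
  proof (induction j)
    case 0
    have "exec x (While 0 0 ?c) (?g (length x), u) (?g (length x), u) 1"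
      by (rule exec_While_exit) (use assms in \<open>auto simp add: cell_def word_cells_def\<close>)
    then show ?case by (simp only: diff_zero mult_0_right add_0)
  next
    case (Suc j)
    have e: "length x - j = Suc (length x - Suc j)" using Suc.prems by simp
    have b: "exec x ?c (?g (length x - Suc j), u) (?g (length x - j), u) (Suc (1 + Suc (1 + 1)))"
      by (rule exec_Seq[OF exec_Inc[OF refl] exec_Seq[OF exec_Inc[OF refl] exec_Inc]]) (use assms e in \<open>auto simp add: fun_eq_iff\<close>)
    have "exec x (While 0 0 ?c) (?g (length x - Suc j), u) (?g (length x), u)
        (Suc (Suc (1 + Suc (1 + 1)) + (6 * j + 1)))"
      by (rule exec_While_step[OF _ b Suc.IH])
        (use assms Suc.prems in \<open>auto simp add: cell_def word_cells_def\<close>)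
    then show ?case by (rule exec_mono) simp
  qed
  from this[of "length x"] show ?thesis using assms
    by (simp add: fun_upd_idem)
qed

text \<open>The head of tape 0 must be on cell 0, since \<open>Len\<close> measures the input from
  there. The head of tape 1 may be anywhere: expressions are also evaluated while output is being
  written.\<close>

lemma exec_compile:
  assumes "wf_exp m e" "2 \<le> m" "m \<le> d" "\<And>j. d \<le> j \<Longrightarrow> g j = 0"
    "\<And>i. 2 \<le> i \<Longrightarrow> i < m \<Longrightarrow> g i \<le> n" "length x \<le> n" "g 0 = 0"
    "g' = g(d := eval x u e g)"
  shows "exec x (compile e d) (g, u) (g', u) (tbound e n)"
  using assms
proof (induction e arbitrary: d g g' n)
  case (N c)
  then show ?case unfolding compile.simps tbound.simps by (intro exec_incs) auto
next
  case (V i)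
  have "exec x (compile (V i) d) (g, u) (g', u) (Suc ((n * 6 + 1) + (n * 4 + 1)))"
    unfolding compile.simps
    by (rule exec_Seq[OF exec_copy[OF _ _ _ _ _ refl] exec_move]) (use V in \<open>auto simp add: fun_eq_iff\<close>)
  then show ?case by (rule exec_mono) simp
next
  case (Add a b)
  let ?g1 = "g(d := eval x u a g)" and ?g2 = "g(d := eval x u a g, d + 1 := eval x u b g)"
  have a: "exec x (compile a d) (g, u) (?g1, u) (tbound a n)"
    using Add.prems by (intro Add.IH(1)) auto
  have c: "eval x u b ?g1 = eval x u b g"
    using Add.prems by (intro eval_cong[of m]) auto
  have "exec x (compile b (d + 1)) (?g1, u) (?g1(d + 1 := eval x u b ?g1), u) (tbound b n)"
    by (rule Add.IH(2)[OF _ _ _ _ _ _ _ refl]) (use Add.prems in auto)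
  note b = this[unfolded c]
  have bv: "eval x u b g \<le> vbound b n"
    using Add.prems by (intro eval_le_vbound[of m]) auto
  have "exec x (compile (Add a b) d) (g, u) (g', u) (Suc (tbound a n + Suc (tbound b n + (vbound b n * 4 + 1))))"
    unfolding compile.simps
    by (rule exec_Seq[OF a exec_Seq[OF b exec_move]]) (use Add.prems bv in \<open>auto simp add: fun_eq_iff\<close>)
  then show ?case by (rule exec_mono) simp
next
  case (Sub a b)
  let ?g1 = "g(d := eval x u a g)" and ?g2 = "g(d := eval x u a g, d + 1 := eval x u b g)"
  have a: "exec x (compile a d) (g, u) (?g1, u) (tbound a n)"
    using Sub.prems by (intro Sub.IH(1)) auto
  have c: "eval x u b ?g1 = eval x u b g"
    using Sub.prems by (intro eval_cong[of m]) auto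
  have "exec x (compile b (d + 1)) (?g1, u) (?g1(d + 1 := eval x u b ?g1), u) (tbound b n)"
    by (rule Sub.IH(2)[OF _ _ _ _ _ _ _ refl]) (use Sub.prems in auto)
  note b = this[unfolded c]
  have bv: "eval x u b g \<le> vbound b n"
    using Sub.prems by (intro eval_le_vbound[of m]) auto
  have "exec x (compile (Sub a b) d) (g, u) (g', u) (Suc (tbound a n + Suc (tbound b n + (vbound b n * 5 + 1))))"
    unfolding compile.simps
    by (rule exec_Seq[OF a exec_Seq[OF b exec_monus]]) (use Sub.prems bv in \<open>auto simp add: fun_eq_iff\<close>)
  then show ?case by (rule exec_mono) simp
next
  case (Mul a b)
  let ?A = "eval x u a g" and ?B = "eval x u b g"
  let ?G = "\<lambda>i. g(d + 1 := i * ?B)"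
  have av: "?A \<le> vbound a n" and bv: "?B \<le> vbound b n"
    using Mul.prems by (intro eval_le_vbound[of m]; auto)+
  have a: "exec x (compile a d) (g, u) (g(d := ?A), u) (tbound a n)"
    using Mul.prems by (intro Mul.IH(1)) auto
  have body: "exec x (Seq (compile b (d + 2)) (Loop (d + 2) (Inc (d + 1))))
      ((?G i)(d := ?A - Suc i), u) ((?G (Suc i))(d := ?A - Suc i), u)
      (Suc (tbound b n + (vbound b n * 4 + 1)))" for i
  proof -
    let ?h = "(?G i)(d := ?A - Suc i)"
    have c: "eval x u b ?h = ?B"
      using Mul.prems by (intro eval_cong[of m]) auto
    have "exec x (compile b (d + 2)) (?h, u) (?h(d + 2 := eval x u b ?h), u) (tbound b n)"
      by (rule Mul.IH(2)[OF _ _ _ _ _ _ _ refl]) (use Mul.prems in auto)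
    note b = this[unfolded c]
    show ?thesis
      by (rule exec_Seq[OF b exec_move]) (use Mul.prems bv in \<open>auto simp add: fun_eq_iff\<close>)
  qed
  have l: "exec x (Loop d (Seq (compile b (d + 2)) (Loop (d + 2) (Inc (d + 1))))) (g(d := ?A), u)
      ((?G ?A)(d := 0), u) (?A * (Suc (tbound b n + (vbound b n * 4 + 1)) + 3) + 1)"
    by (rule exec_Loop[where G = ?G and U = "\<lambda>_. u", OF _ body])
      (use Mul.prems in \<open>auto simp add: fun_eq_iff\<close>)
  have ab: "?A * ?B \<le> vbound a n * vbound b n" using av bv by (rule mult_mono) auto
  have "exec x (compile (Mul a b) d) (g, u) (g', u) (Suc (tbound a n +
      Suc ((?A * (Suc (tbound b n + (vbound b n * 4 + 1)) + 3) + 1) + ((vbound a n * vbound b n) * 4 + 1))))"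
    unfolding compile.simps
    by (rule exec_Seq[OF a exec_Seq[OF l exec_move]]) (use Mul.prems ab in \<open>auto simp add: fun_eq_iff\<close>)
  then show ?case
  proof (rule exec_mono)
    have "?A * (tbound b n + 4 * vbound b n + 5) \<le> vbound a n * (tbound b n + 4 * vbound b n + 5)"
      using av by (rule mult_right_mono) simp
    then show "Suc (tbound a n + Suc ((?A * (Suc (tbound b n + (vbound b n * 4 + 1)) + 3) + 1) +
       ((vbound a n * vbound b n) * 4 + 1))) \<le> tbound (Mul a b) n"
      by (simp add: algebra_simps)
  qed
next
  case (Sum v a b)
  let ?A = "eval x u a g" and ?B = "\<lambda>i. eval x u b (g(v := i))"
  let ?k = "vbound a n"
  let ?n = "n + ?k"
  \<comment> \<open>Loop invariant: after \<open>i\<close> rounds \<open>d + 1\<close> holds the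
    partial sum, \<open>d + 2\<close> the saved variable and \<open>v\<close> the index
    \<open>i\<close>.\<close>
  let ?G = "\<lambda>i. g(d + 1 := (\<Sum>j<i. ?B j), d + 2 := g v, v := i)"
  have v: "2 \<le> v" "v < m" "v < d" using Sum.prems by auto
  have av: "?A \<le> ?k" using Sum.prems by (intro eval_le_vbound[of m]) auto
  have bv: "?B i \<le> vbound b ?n" if "i < ?A" for i
    using Sum.prems that av by (intro eval_le_vbound[of m]) (auto intro: trans_le_add1)
  have a: "exec x (compile a d) (g, u) (g(d := ?A), u) (tbound a n)"
    using Sum.prems by (intro Sum.IH(1)) auto
  have s: "exec x (Loop v (Inc (d + 2))) (g(d := ?A), u) (g(d := ?A, d + 2 := g v, v := 0), u) (n * 4 + 1)"
    by (rule exec_move) (use Sum.prems v in \<open>auto simp add: fun_eq_iff\<close>)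
  let ?body = "Seq (compile b (d + 3)) (Seq (Loop (d + 3) (Inc (d + 1))) (Inc v))"
  let ?T = "Suc (tbound b ?n + Suc ((vbound b ?n * 4 + 1) + 1))"
  have body: "exec x ?body ((?G i)(d := ?A - Suc i), u) ((?G (Suc i))(d := ?A - Suc i), u) ?T"
    if i: "i < ?A" for i
  proof -
    let ?h = "(?G i)(d := ?A - Suc i)"
    have c: "eval x u b ?h = ?B i"
      using Sum.prems by (intro eval_cong[of m]) auto
    have "exec x (compile b (d + 3)) (?h, u) (?h(d + 3 := eval x u b ?h), u) (tbound b ?n)"
      by (rule Sum.IH(2)[OF _ _ _ _ _ _ _ refl]) (use Sum.prems v i av in \<open>auto intro: trans_le_add1\<close>)
    note b = this[unfolded c]
    show ?thesis
      by (rule exec_Seq[OF b exec_Seq[OF exec_move[OF _ _ _ refl] exec_Inc]])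
        (use Sum.prems bv[OF i] v in \<open>auto simp add: fun_eq_iff\<close>)
  qed
  have l: "exec x (Loop d ?body) (g(d := ?A, d + 2 := g v, v := 0), u) ((?G ?A)(d := 0), u) (?A * (?T + 3) + 1)"
    by (rule exec_Loop[where G = ?G and U = "\<lambda>_. u", OF _ body])
      (use Sum.prems v in \<open>auto simp add: fun_eq_iff\<close>)
  have c: "exec x (Loop v Skip) ((?G ?A)(d := 0), u) ((?G ?A)(d := 0, v := 0), u) (?k * 4 + 1)"
    by (rule exec_clear) (use v av in auto)
  have r: "exec x (Loop (d + 2) (Inc v)) ((?G ?A)(d := 0, v := 0), u) (g(d + 1 := (\<Sum>j<?A. ?B j)), u) (n * 4 + 1)"
    by (rule exec_move) (use Sum.prems v in \<open>auto simp add: fun_eq_iff\<close>)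
  have "(\<Sum>j<?A. ?B j) \<le> (\<Sum>j<?A. vbound b ?n)" by (intro sum_mono) (use bv in auto)
  also have "\<dots> \<le> ?k * vbound b ?n" using av by simp
  finally have ab: "(\<Sum>j<?A. ?B j) \<le> ?k * vbound b ?n" .
  have f: "exec x (Loop (d + 1) (Inc d)) (g(d + 1 := (\<Sum>j<?A. ?B j)), u) (g', u) ((?k * vbound b ?n) * 4 + 1)"
    by (rule exec_move) (use Sum.prems v ab in \<open>auto simp add: fun_eq_iff\<close>)
  have "exec x (compile (Sum v a b) d) (g, u) (g', u)
     (Suc (tbound a n + Suc ((n * 4 + 1) + Suc ((?A * (?T + 3) + 1) + Suc ((?k * 4 + 1) + Suc ((n * 4 + 1) + ((?k * vbound b ?n) * 4 + 1)))))))"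
    unfolding compile.simps
    by (intro exec_Seq[OF a] exec_Seq[OF s] exec_Seq[OF l] exec_Seq[OF c] exec_Seq[OF r] f)
  then show ?case
  proof (rule exec_mono)
    have "?A * (tbound b ?n + 4 * vbound b ?n + 7) \<le> ?k * (tbound b ?n + 4 * vbound b ?n + 7)"
      using av by (rule mult_right_mono) simp
    then show "Suc (tbound a n + Suc ((n * 4 + 1) + Suc ((?A * (?T + 3) + 1) + Suc ((?k * 4 + 1) + Suc ((n * 4 + 1) + ((?k * vbound b ?n) * 4 + 1)))))) \<le> tbound (Sum v a b) n"
      by (simp add: algebra_simps Let_def)
  qed
next
  case Len
  have 1: "exec x (While 0 0 (Seq (Inc 0) (Seq (Inc d) (Inc (d + 1))))) (g, u)
    (g(0 := length x, d := length x, d + 1 := length x), u) (6 * length x + 1)"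
    by (rule exec_Len) (use Len in auto)
  have "exec x (compile Len d) (g, u) (g', u) (Suc ((6 * length x + 1) + (n * 4 + 1)))"
    unfolding compile.simps
    by (rule exec_Seq[OF 1 exec_retreat]) (use Len in \<open>auto simp add: fun_eq_iff\<close>)
  then show ?case by (rule exec_mono) (use Len in simp)
next
  case (Bit t e)
  let ?A = "eval x u e g"
  have av: "?A \<le> vbound e n" using Bit.prems by (intro eval_le_vbound[of m]) auto
  have a: "exec x (compile e d) (g, u) (g(d := ?A), u) (tbound e n)"
    using Bit.prems by (intro Bit.IH) auto
  let ?g = "g(t := g t + ?A, d + 1 := ?A)"
  let ?r = "eval x u (Bit t e) g"
  have c: "exec x (Loop d (Seq (Inc t) (Inc (d + 1)))) (g(d := ?A), u) (?g, u) (vbound e n * 6 + 1)"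
    by (rule exec_copy) (use Bit.prems av in \<open>auto simp add: fun_eq_iff\<close>)
  have t: "exec x (If t 2 (Inc d) Skip) (?g, u) (?g(d := ?r), u) (Suc 1)"
  proof (rule exec_If)
    have s: "scan x t (embed (?g, u)) = cell x u t (int (g t + ?A))"
      using Bit.prems by simp
    show "exec x (if scan x t (embed (?g, u)) = 2 then Inc d else Skip) (?g, u) (?g(d := ?r), u) 1"
    proof (cases "cell x u t (int (g t + ?A)) = 2")
      case True
      then show ?thesis unfolding s using Bit.prems by (auto intro!: exec_Inc simp add: fun_eq_iff)
    next
      case False
      then have "?g(d := ?r) = ?g" using Bit.prems by (auto simp add: fun_eq_iff)
      then show ?thesis unfolding s using False by (simp add: exec_Skip)
    qed
  qed
  have r: "exec x (Loop (d + 1) (Dec t)) (?g(d := ?r), u) (g', u) (vbound e n * 4 + 1)"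
    by (rule exec_retreat) (use Bit.prems av in \<open>auto simp add: fun_eq_iff\<close>)
  have "exec x (compile (Bit t e) d) (g, u) (g', u)
     (Suc (tbound e n + Suc ((vbound e n * 6 + 1) + Suc (Suc 1 + (vbound e n * 4 + 1)))))"
    unfolding compile.simps
    by (intro exec_Seq[OF a] exec_Seq[OF c] exec_Seq[OF t] r)
  then show ?case by (rule exec_mono) simp
qed

section \<open>Polynomially bounded functions\<close>

definition poly_bounded :: "(nat \<Rightarrow> nat) \<Rightarrow> bool" where
  "poly_bounded f \<longleftrightarrow> (\<exists>k. \<forall>n. f n \<le> (n + 2) ^ k)"

lemma poly_boundedI: "(\<And>n. f n \<le> (n + 2) ^ k) \<Longrightarrow> poly_bounded f"
  unfolding poly_bounded_def by blast

lemma poly_bounded_const: "poly_bounded (\<lambda>_. c)"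
proof (rule poly_boundedI)
  fix n :: nat
  have "c < 2 ^ c" by (rule less_exp)
  also have "(2::nat) ^ c \<le> (n + 2) ^ c" by (rule power_mono) auto
  finally show "c \<le> (n + 2) ^ c" by simp
qed

lemma poly_bounded_ident: "poly_bounded (\<lambda>n. n)"
  by (rule poly_boundedI[of _ 1]) simp

lemma poly_bounded_mult: 
  assumes "poly_bounded f" "poly_bounded g" shows "poly_bounded (\<lambda>n. f n * g n)"
proof -
  obtain k l where "\<And>n. f n \<le> (n + 2) ^ k" "\<And>n. g n \<le> (n + 2) ^ l"
    using assms unfolding poly_bounded_def by blast
  then show ?thesis by (intro poly_boundedI[of _ "k + l"]) (simp add: power_add mult_mono)
qed

text \<open>The base \<open>n + 2\<close> is at least 2 even for \<open>n = 0\<close>, so one more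
  power absorbs the factor 2.\<close>

lemma poly_bounded_add: 
  assumes "poly_bounded f" "poly_bounded g" shows "poly_bounded (\<lambda>n. f n + g n)"
proof -
  obtain k l where kl: "\<And>n. f n \<le> (n + 2) ^ k" "\<And>n. g n \<le> (n + 2) ^ l"
    using assms unfolding poly_bounded_def by blast
  show ?thesis
  proof (rule poly_boundedI[of _ "Suc (max k l)"])
    fix n :: nat
    have "f n \<le> (n + 2) ^ max k l" by (rule order_trans[OF kl(1)], rule power_increasing) auto
    moreover have "g n \<le> (n + 2) ^ max k l" by (rule order_trans[OF kl(2)], rule power_increasing) auto
    ultimately have "f n + g n \<le> 2 * (n + 2) ^ max k l" by simp
    also have "\<dots> \<le> (n + 2) ^ Suc (max k l)" by simp
    finally show "f n + g n \<le> (n + 2) ^ Suc (max k l)" .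
  qed
qed

lemma poly_bounded_compose: 
  assumes "poly_bounded f" "poly_bounded g" shows "poly_bounded (\<lambda>n. f (g n))"
proof -
  obtain k where k: "\<And>n. f n \<le> (n + 2) ^ k"
    using assms unfolding poly_bounded_def by blast
  have "poly_bounded (\<lambda>n. g n + 2)" by (intro poly_bounded_add assms poly_bounded_const)
  then obtain l where l: "\<And>n. g n + 2 \<le> (n + 2) ^ l"
    unfolding poly_bounded_def by blast
  show ?thesis
  proof (rule poly_boundedI[of _ "l * k"])
    fix n
    have "f (g n) \<le> (g n + 2) ^ k" by (rule k)
    also have "\<dots> \<le> ((n + 2) ^ l) ^ k" by (rule power_mono[OF l]) simp
    finally show "f (g n) \<le> (n + 2) ^ (l * k)" by (simp add: power_mult)
  qed
qed

lemma poly_bounded_poly: "poly_bounded (poly p)"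
proof (induction p)
  case (pCons a p)
  then show ?case
    by (simp add: poly_bounded_add poly_bounded_mult poly_bounded_const poly_bounded_ident)
qed (simp add: poly_bounded_const)

lemma poly_boundedE:
  assumes "poly_bounded f"
  obtains p :: "nat poly" where "\<And>n. f n \<le> poly p n"
proof -
  obtain k where "\<And>n. f n \<le> (n + 2) ^ k"
    using assms unfolding poly_bounded_def by blast
  then have "f n \<le> poly ([:2, 1:] ^ k) n" for n by (simp add: poly_power add.commute)
  then show thesis by (rule that)
qed

lemmas poly_bounded_intros = poly_bounded_const poly_bounded_ident poly_bounded_add poly_bounded_mult

lemma poly_bounded_vbound: "poly_bounded (vbound e)"
proof (induction e)
  case (Sum v a b)
  have "poly_bounded (\<lambda>n. vbound b (n + vbound a n))"
    by (rule poly_bounded_compose[of "vbound b"]) (intro Sum poly_bounded_intros)+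
  then show ?case by (auto intro!: Sum poly_bounded_intros)
qed (auto intro!: poly_bounded_intros)

lemma poly_bounded_tbound: "poly_bounded (tbound e)"
proof (induction e)
  case (Sum v a b)
  have "poly_bounded (\<lambda>n. f (n + vbound a n))" if "poly_bounded f" for f
    by (rule poly_bounded_compose[OF that]) (intro poly_bounded_intros poly_bounded_vbound)
  from this[OF poly_bounded_vbound] this[OF Sum(2)] show ?case
    by (auto simp add: Let_def intro!: Sum poly_bounded_intros poly_bounded_vbound)
qed (auto intro!: poly_bounded_intros poly_bounded_vbound)

lemma puts_ok_compile: "puts_ok (compile e d)"
proof -
  have "puts_ok (incs n d)" for n d by (induction n) auto
  then show ?thesis by (induction e arbitrary: d) (auto simp add: Loop_def)
qed

theorem poly_time_rel_exp:
  assumes e: "wf_exp m e" "2 \<le> m"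
  shows "poly_time_rel (\<lambda>x y. eval x (word_cells y) e (\<lambda>_. 0) \<noteq> 0)"
proof -
  obtain k0 where "wf_cmd k0 (compile e m)" using wf_cmd_exists[OF puts_ok_compile] by blast
  then have "wf_cmd (k0 + m + 1) (compile e m)" by (rule wf_cmd_mono) simp
  from program_machine[OF this e(2)] obtain M where M: "wf_tm M" and
    run: "\<And>x w t h u t'. (step x ^^ t) ([compile e m], (\<lambda>_. 0, word_cells w)) = ([], (h, u)) \<Longrightarrow>
    t + 2 \<le> t' \<Longrightarrow> \<exists>ts. tm_run M [x, w] t' = (if h m = 0 then reject_state else accept_state, ts) \<and>
      snd (ts ! 1) = u" by auto
  have "poly_bounded (\<lambda>n. tbound e n + 2)" by (intro poly_bounded_intros poly_bounded_tbound)
  then obtain p where p: "\<And>n. tbound e n + 2 \<le> poly p n" by (rule poly_boundedE) blast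
  have "fst (tm_run M [x, y] (poly p (length x + length y))) =
           (if eval x (word_cells y) e (\<lambda>_. 0) \<noteq> 0 then accept_state else reject_state)" for x y
  proof -
    let ?n = "length x + length y"
    have "exec x (compile e m) (\<lambda>_. 0, word_cells y)
        ((\<lambda>_. 0)(m := eval x (word_cells y) e (\<lambda>_. 0)), word_cells y) (tbound e ?n)"
      by (rule exec_compile[OF e(1)]) (use e in auto)
    then obtain t where "t \<le> tbound e ?n" "(step x ^^ t) ([compile e m], (\<lambda>_. 0, word_cells y)) =
       ([], (\<lambda>i. int (((\<lambda>_. 0)(m := eval x (word_cells y) e (\<lambda>_. 0))) i), word_cells y))"
      unfolding exec_def by auto
    with run[OF this(2), of "poly p ?n"] p[of ?n] show ?thesis by auto
  qed
  with M show ?thesis unfolding poly_time_rel_def by blast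
qed

text \<open>Output bits are computed while tape 1 fills up, so their values must depend on the input
  only.\<close>

fun one_tape :: "exp \<Rightarrow> bool" where
  "one_tape (N c) \<longleftrightarrow> True"
| "one_tape (V i) \<longleftrightarrow> True"
| "one_tape (Add a b) \<longleftrightarrow> one_tape a \<and> one_tape b"
| "one_tape (Sub a b) \<longleftrightarrow> one_tape a \<and> one_tape b"
| "one_tape (Mul a b) \<longleftrightarrow> one_tape a \<and> one_tape b"
| "one_tape (Sum v a b) \<longleftrightarrow> one_tape a \<and> one_tape b"
| "one_tape Len \<longleftrightarrow> True"
| "one_tape (Bit t e) \<longleftrightarrow> t = 0 \<and> one_tape e"

lemma eval_one_tape_cong:
  "one_tape e \<Longrightarrow> wf_exp m e \<Longrightarrow> 2 \<le> m \<Longrightarrow> (\<And>i. i < m \<Longrightarrow> i \<noteq> 1 \<Longrightarrow> g i = g' i) \<Longrightarrow>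
    eval x u e g = eval x u' e g'"
proof (induction e arbitrary: g g')
  case (Add a b)
  have "eval x u a g = eval x u' a g'" "eval x u b g = eval x u' b g'"
    using Add.prems by (intro Add.IH; auto)+
  then show ?case by simp
next
  case (Sub a b)
  have "eval x u a g = eval x u' a g'" "eval x u b g = eval x u' b g'"
    using Sub.prems by (intro Sub.IH; auto)+
  then show ?case by simp
next
  case (Mul a b)
  have "eval x u a g = eval x u' a g'" "eval x u b g = eval x u' b g'"
    using Mul.prems by (intro Mul.IH; auto)+
  then show ?case by simp
next
  case (Sum v a b)
  have "eval x u a g = eval x u' a g'" using Sum.prems by (intro Sum.IH(1)) auto
  moreover have "eval x u b (g(v := i)) = eval x u' b (g'(v := i))" for i
    using Sum.prems by (intro Sum.IH(2)) auto
  ultimately show ?case by simp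
next
  case (Bit t e)
  have "eval x u e g = eval x u' e g'" using Bit.prems by (intro Bit.IH) auto
  moreover have "g t = g' t" using Bit.prems by auto
  ultimately show ?case using Bit.prems by (simp add: cell_def)
qed simp_all

lemma word_cells_snoc:
  "word_cells (w @ [b]) = (word_cells w)(int (length w) := if b then 2 else 1)"
  by (auto simp add: word_cells_def fun_eq_iff nth_append)

text \<open>Head 1 and the counter \<open>v\<close> advance together, so a single expression in the
  position \<open>v\<close> yields all output bits.\<close>

theorem poly_time_fun_exp:
  assumes L: "wf_exp m L" "one_tape L" and B: "wf_exp m B" "one_tape B" and v: "2 \<le> v" "v < m"
  shows "poly_time_fun (\<lambda>x. map (\<lambda>i. eval x (\<lambda>_. 0) B ((\<lambda>_. 0)(v := i)) \<noteq> 0) [0..<eval x (\<lambda>_. 0) L (\<lambda>_. 0)])"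
proof -
  define body where "body = Seq (compile B (m + 1)) (Seq (If (m + 1) 1 (Put 1) (Put 2))
     (Seq (Loop (m + 1) Skip) (Seq (Inc 1) (Inc v))))"
  \<comment> \<open>A machine computing a function must accept; the last \<open>Inc m\<close> makes
    the inspected counter nonzero.\<close>
  define P where "P = Seq (compile L m) (Seq (Loop m body) (Inc m))"
  have "puts_ok P" by (simp add: P_def body_def puts_ok_compile Loop_def)
  then obtain k0 where "wf_cmd k0 P" using wf_cmd_exists by blast
  then have "wf_cmd (k0 + m + 1) P" by (rule wf_cmd_mono) simp
  from program_machine[OF this, of m] v obtain M where M: "wf_tm M" and
    run: "\<And>x w t h u t'. (step x ^^ t) ([P], (\<lambda>_. 0, word_cells w)) = ([], (h, u)) \<Longrightarrow>
    t + 2 \<le> t' \<Longrightarrow> \<exists>ts. tm_run M [x, w] t' = (if h m = 0 then reject_state else accept_state, ts) \<and>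
      snd (ts ! 1) = u" by auto
  let ?n = "\<lambda>n. n + vbound L n"
  let ?Tb = "\<lambda>n. Suc (tbound B (?n n) + Suc (Suc 1 + Suc ((vbound B (?n n) * 4 + 1) + Suc (1 + 1))))"
  let ?T = "\<lambda>n. Suc (tbound L n + Suc ((vbound L n * (?Tb n + 3) + 1) + 1)) + 2"
  have "poly_bounded (\<lambda>n. f (n + vbound L n))" if "poly_bounded f" for f
    by (rule poly_bounded_compose[OF that]) (intro poly_bounded_intros poly_bounded_vbound)
  from this[OF poly_bounded_vbound] this[OF poly_bounded_tbound] have "poly_bounded ?T"
    unfolding Suc_eq_plus1 by (intro poly_bounded_intros poly_bounded_vbound poly_bounded_tbound)
  then obtain p where p: "\<And>n. ?T n \<le> poly p n" by (rule poly_boundedE) blast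
  have "case tm_run M [x] (poly p (length x)) of (q, ts) \<Rightarrow>
           q = accept_state \<and> snd (ts ! 1) = word_cells
      (map (\<lambda>i. eval x (\<lambda>_. 0) B ((\<lambda>_. 0)(v := i)) \<noteq> 0) [0..<eval x (\<lambda>_. 0) L (\<lambda>_. 0)])" for x
  proof -
    let ?k = "length x"
    let ?l = "eval x (\<lambda>_. 0) L (\<lambda>_. 0)" and ?b = "\<lambda>i. eval x (\<lambda>_. 0) B ((\<lambda>_. 0)(v := i))"
    let ?w = "\<lambda>i. map (\<lambda>i. ?b i \<noteq> 0) [0..<i]"
    let ?G = "\<lambda>i. (\<lambda>_. 0::nat)(1 := i, v := i)" and ?U = "\<lambda>i. word_cells (?w i)"
    have lv: "?l \<le> vbound L ?k" using v by (intro eval_le_vbound[OF L(1)]) auto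
    have l: "eval x (word_cells []) L (\<lambda>_. 0) = ?l"
      using v by (intro eval_one_tape_cong[OF L(2,1)]) auto
    have "exec x (compile L m) (\<lambda>_. 0, word_cells [])
        ((\<lambda>_. 0)(m := eval x (word_cells []) L (\<lambda>_. 0)), word_cells []) (tbound L ?k)"
      by (rule exec_compile[OF L(1) _ _ _ _ _ _ refl]) (use v in auto)
    note 1 = this[unfolded l]
    have step: "exec x body ((?G i)(m := ?l - Suc i), ?U i)
        ((?G (Suc i))(m := ?l - Suc i), ?U (Suc i)) (?Tb ?k)" if i: "i < ?l" for i
    proof -
      let ?h = "(?G i)(m := ?l - Suc i)"
      have c: "eval x (?U i) B ?h = ?b i"
        using v by (intro eval_one_tape_cong[OF B(2,1)]) auto
      have "exec x (compile B (m + 1)) (?h, ?U i) (?h(m + 1 := eval x (?U i) B ?h), ?U i) (tbound B (?n ?k))"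
        by (rule exec_compile[OF B(1) _ _ _ _ _ _ refl]) (use v i lv in auto)
      note b = this[unfolded c]
      let ?h1 = "?h(m + 1 := ?b i)"
      have "exec x (if scan x (m + 1) (embed (?h1, ?U i)) = 1 then Put 1 else Put 2)
          (?h1, ?U i) (?h1, ?U (Suc i)) 1"
      proof -
        have s: "scan x (m + 1) (embed (?h1, ?U i)) = (if ?b i = 0 then 1 else 0)"
          using v by (simp add: cell_def)
        show ?thesis unfolding s using v word_cells_snoc[of "?w i" "?b i \<noteq> 0"]
          by (cases "?b i = 0") (auto intro!: exec_Put)
      qed
      note put = exec_If[OF this]
      have clear: "exec x (Loop (m + 1) Skip) (?h1, ?U (Suc i)) (?h, ?U (Suc i)) (vbound B (?n ?k) * 4 + 1)"
      proof (rule exec_clear)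
        have "?b i \<le> vbound B (?n ?k)"
          using v i lv by (intro eval_le_vbound[OF B(1)]) auto
        then show "?h1 (m + 1) \<le> vbound B (?n ?k)" by simp
      qed (use v in \<open>auto simp add: fun_eq_iff\<close>)
      show ?thesis unfolding body_def
        by (rule exec_Seq[OF b exec_Seq[OF put exec_Seq[OF clear exec_Seq[OF exec_Inc[OF refl] exec_Inc]]]])
          (use v in \<open>auto simp add: fun_eq_iff\<close>)
    qed
    have 2: "exec x (Loop m body) ((\<lambda>_. 0)(m := ?l), word_cells []) (?G ?l, ?U ?l) (?l * (?Tb ?k + 3) + 1)"
      by (rule exec_Loop[where G = ?G and U = ?U, OF _ step]) (use v in \<open>auto simp add: fun_eq_iff\<close>)
    have "exec x P (\<lambda>_. 0, word_cells []) ((?G ?l)(m := 1), ?U ?l)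
       (Suc (tbound L ?k + Suc ((?l * (?Tb ?k + 3) + 1) + 1)))"
      unfolding P_def by (rule exec_Seq[OF 1 exec_Seq[OF 2 exec_Inc]]) (use v in auto)
    then obtain t where t: "t \<le> Suc (tbound L ?k + Suc ((?l * (?Tb ?k + 3) + 1) + 1))"
        "(step x ^^ t) ([P], (\<lambda>_. 0, word_cells [])) =
       ([], (\<lambda>i. int (((?G ?l)(m := 1)) i), ?U ?l))"
      unfolding exec_def by auto
    have "?l * (?Tb ?k + 3) \<le> vbound L ?k * (?Tb ?k + 3)" using lv by (rule mult_right_mono) simp
    then have "t + 2 \<le> ?T ?k" using t(1) by linarith
    then have "t + 2 \<le> poly p ?k" using p[of ?k] by (rule order_trans)
    from run[OF t(2) this] show ?thesis
      by (auto simp add: tm_run_def tm_start_second_empty)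
  qed
  with M show ?thesis unfolding poly_time_fun_def by blast
qed

section \<open>Membership in NP\<close>

text \<open>An expression serves as a condition that is true iff its value is nonzero, so
  \<open>Mul\<close>, \<open>Add\<close> and \<open>Sum\<close> are conjunction, disjunction and
  bounded existence. Negation and what is built by it yield 0 or 1; \<open>Less_exp\<close> need
  not.\<close>

definition Not_exp :: "exp \<Rightarrow> exp" where "Not_exp a = Sub (N 1) a"
definition Eq_exp :: "exp \<Rightarrow> exp \<Rightarrow> exp" where "Eq_exp a b = Not_exp (Add (Sub a b) (Sub b a))"
definition Less_exp :: "exp \<Rightarrow> exp \<Rightarrow> exp" where "Less_exp a b = Sub b a"
definition All_exp :: "nat \<Rightarrow> exp \<Rightarrow> exp \<Rightarrow> exp" where
  "All_exp v a b = Not_exp (Sum v a (Not_exp b))"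

lemma one_minus_eq_0: "Suc 0 - k = 0 \<longleftrightarrow> k \<noteq> 0"
  by auto

definition holds :: "bool list \<Rightarrow> (int \<Rightarrow> nat) \<Rightarrow> exp \<Rightarrow> (nat \<Rightarrow> nat) \<Rightarrow> bool" where
  "holds x u e g \<longleftrightarrow> eval x u e g \<noteq> 0"

lemma holds_simps:
  "holds x u (N c) g \<longleftrightarrow> c \<noteq> 0"
  "holds x u (Not_exp a) g \<longleftrightarrow> \<not> holds x u a g"
  "holds x u (Eq_exp a b) g \<longleftrightarrow> eval x u a g = eval x u b g"
  "holds x u (Less_exp a b) g \<longleftrightarrow> eval x u a g < eval x u b g"
  "holds x u (Mul a b) g \<longleftrightarrow> holds x u a g \<and> holds x u b g"
  "holds x u (Add a b) g \<longleftrightarrow> holds x u a g \<or> holds x u b g"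
  "holds x u (Sum v a b) g \<longleftrightarrow> (\<exists>i<eval x u a g. holds x u b (g(v := i)))"
  "holds x u (All_exp v a b) g \<longleftrightarrow> (\<forall>i<eval x u a g. holds x u b (g(v := i)))"
  "holds x u (Bit t e) g \<longleftrightarrow> cell x u t (int (g t + eval x u e g)) = 2"
  by (auto simp add: holds_def Not_exp_def Eq_exp_def Less_exp_def All_exp_def
      one_minus_eq_0 simp del: diff_is_0_eq)

lemma wf_exp_derived:
  "wf_exp m (Not_exp a) \<longleftrightarrow> wf_exp m a"
  "wf_exp m (Eq_exp a b) \<longleftrightarrow> wf_exp m a \<and> wf_exp m b"
  "wf_exp m (Less_exp a b) \<longleftrightarrow> wf_exp m a \<and> wf_exp m b"
  "wf_exp m (All_exp v a b) \<longleftrightarrow> 2 \<le> v \<and> v < m \<and> wf_exp m a \<and> wf_exp m b"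
  by (auto simp add: Not_exp_def Eq_exp_def Less_exp_def All_exp_def)

lemma one_tape_derived:
  "one_tape (Not_exp a) \<longleftrightarrow> one_tape a"
  "one_tape (Eq_exp a b) \<longleftrightarrow> one_tape a \<and> one_tape b"
  "one_tape (Less_exp a b) \<longleftrightarrow> one_tape a \<and> one_tape b"
  "one_tape (All_exp v a b) \<longleftrightarrow> one_tape a \<and> one_tape b"
  by (auto simp add: Not_exp_def Eq_exp_def Less_exp_def All_exp_def)

section \<open>Bit strings, adjacency relations and graphs\<close>

lemma sum_of_bool_card: "(\<Sum>j<(n::nat). of_bool (P j)) = card {j. j < n \<and> P j}"
proof -
  have "(\<Sum>j<n. of_bool (P j)) = (\<Sum>j\<in>{j. j < n \<and> P j}. 1::nat)"
    by (rule sum.mono_neutral_cong_right) auto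
  then show ?thesis by simp
qed

lemma length_concat_rows: "length (concat (map (\<lambda>i. map (f i) [0..<n]) [0..<m])) = m * n"
  by (induction m) auto

lemma nth_concat_rows:
  "i < m \<Longrightarrow> j < n \<Longrightarrow> concat (map (\<lambda>i. map (f i) [0..<n]) [0..<m]) ! (i * n + j) = f i j"
proof (induction m)
  case (Suc m)
  show ?case
  proof (cases "i < m")
    case True
    have "i * n + j < Suc i * n" using Suc.prems by simp
    also have "\<dots> \<le> m * n" using True by (intro mult_right_mono) auto
    finally show ?thesis using Suc.IH[OF True Suc.prems(2)]
      by (simp add: nth_append length_concat_rows)
  next
    case False
    then have "i = m" using Suc.prems by simp
    then show ?thesis using Suc.prems by (simp add: nth_append length_concat_rows)
  qed
qed simp

text \<open>The code of a graph addressed bit by bit, which is how expressions read and write it.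
  Only the values of \<open>a\<close> below \<open>n\<close> count.\<close>

definition graph_bits :: "nat \<Rightarrow> (nat \<Rightarrow> nat \<Rightarrow> bool) \<Rightarrow> bool list \<Rightarrow> bool" where
  "graph_bits n a x \<longleftrightarrow> length x = n + 1 + n * n \<and> (\<forall>i<n. x ! i) \<and> \<not> x ! n \<and>
     (\<forall>i<n. \<forall>j<n. x ! (n + 1 + i * n + j) = a i j)"

lemma graph_bits_unique:
  assumes "graph_bits n a x" "graph_bits n a y" shows "x = y"
proof (rule nth_equalityI)
  show "length x = length y" using assms by (simp add: graph_bits_def)
  fix k assume k: "k < length x"
  consider "k < n" | "k = n" | "n < k" by linarith
  then show "x ! k = y ! k"
  proof cases
    case 3
    define l where "l = k - n - 1"
    have l: "k = n + 1 + l div n * n + l mod n" using 3 by (simp add: l_def)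
    have "l < n * n" using k assms(1) 3 by (simp add: l_def graph_bits_def)
    then have "l div n < n" "l mod n < n"
      by (auto simp add: less_mult_imp_div_less) (metis mod_less_divisor mult_0 neq0_conv not_less0)
    then show ?thesis unfolding l using assms unfolding graph_bits_def by metis
  qed (use assms in \<open>auto simp add: graph_bits_def\<close>)
qed

lemma graph_bits_graph_code:
  assumes "verts G = {0..<n}"
  shows "graph_bits n (\<lambda>i j. {i, j} \<in> edges G) (graph_code G)"
proof -
  have "graph_code G = replicate n True @ [False] @
     concat (map (\<lambda>i. map (\<lambda>j. {i, j} \<in> edges G) [0..<n]) [0..<n])"
    using assms by (simp add: graph_code_def)
  then show ?thesis
    by (simp add: graph_bits_def nth_append length_concat_rows nth_concat_rows add.assoc)
qed

definition adjacency_graph :: "nat \<Rightarrow> (nat \<Rightarrow> nat \<Rightarrow> bool) \<Rightarrow> nat ugraph" where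
  "adjacency_graph n a = \<lparr>verts = {0..<n}, edges = {{i, j} | i j. i < n \<and> j < n \<and> a i j}\<rparr>"

lemma verts_adjacency_graph [simp]: "verts (adjacency_graph n a) = {0..<n}"
  by (simp add: adjacency_graph_def)

locale adjacency =
  fixes n :: nat and a :: "nat \<Rightarrow> nat \<Rightarrow> bool"
  assumes sym: "i < n \<Longrightarrow> j < n \<Longrightarrow> a i j \<Longrightarrow> a j i" and irrefl: "i < n \<Longrightarrow> \<not> a i i"
begin

abbreviation G :: "nat ugraph" where "G \<equiv> adjacency_graph n a"

lemma simple: "simple_graph G"
proof -
  have "\<exists>u \<in> verts G. \<exists>v \<in> verts G. u \<noteq> v \<and> e = {u, v}" if e: "e \<in> edges G" for e
  proof -
    obtain i j where "i < n" "j < n" "a i j" "e = {i, j}" using e by (auto simp add: adjacency_graph_def)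
    moreover from this have "i \<noteq> j" using irrefl by metis
    ultimately show ?thesis by (intro bexI[of _ i] bexI[of _ j]) simp_all
  qed
  then show ?thesis by (simp add: simple_graph_def)
qed

lemma edge_iff: "i < n \<Longrightarrow> j < n \<Longrightarrow> {i, j} \<in> edges G \<longleftrightarrow> a i j"
  unfolding adjacency_graph_def using sym by (simp add: doubleton_eq_iff) metis

lemma neighbors: "i < n \<Longrightarrow> neighbors G i = {j. j < n \<and> a i j}"
  unfolding neighbors_def adjacency_graph_def using sym by (simp add: doubleton_eq_iff set_eq_iff) metis

lemma code: "graph_bits n a x \<longleftrightarrow> x = graph_code G"
proof -
  have "graph_bits n a (graph_code G)"
    using graph_bits_graph_code[of G n] by (simp add: graph_bits_def edge_iff)
  then show ?thesis using graph_bits_unique by blast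
qed

lemma bipartite_iff: "bipartite G \<longleftrightarrow> (\<exists>s. \<forall>i<n. \<forall>j<n. a i j \<longrightarrow> s i \<noteq> (s j :: bool))"
proof
  assume "bipartite G"
  then obtain X Y where XY: "X \<union> Y = {0..<n}" "X \<inter> Y = {}" "\<forall>e \<in> edges G. \<exists>x \<in> X. \<exists>y \<in> Y. e = {x, y}"
    by (auto simp add: bipartite_def)
  have "(i \<in> X) \<noteq> (j \<in> X)" if "i < n" "j < n" "a i j" for i j
  proof -
    have "{i, j} \<in> edges G" using that edge_iff by simp
    then obtain x y where "x \<in> X" "y \<in> Y" "{i, j} = {x, y}" using XY by blast
    then show ?thesis using XY by (auto simp add: doubleton_eq_iff)
  qed
  then show "\<exists>s. \<forall>i<n. \<forall>j<n. a i j \<longrightarrow> s i \<noteq> (s j :: bool)" by (intro exI[of _ "\<lambda>i. i \<in> X"]) auto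
next
  assume "\<exists>s. \<forall>i<n. \<forall>j<n. a i j \<longrightarrow> s i \<noteq> (s j :: bool)"
  then obtain s where s: "\<And>i j. i < n \<Longrightarrow> j < n \<Longrightarrow> a i j \<Longrightarrow> s i \<noteq> (s j :: bool)" by blast
  have "\<exists>x \<in> {i. i < n \<and> s i}. \<exists>y \<in> {i. i < n \<and> \<not> s i}. e = {x, y}" if e: "e \<in> edges G" for e
  proof -
    obtain i j where ij: "i < n" "j < n" "a i j" "e = {i, j}" using e by (auto simp add: adjacency_graph_def)
    then show ?thesis using s[of i j] insert_commute[of i j "{}"] by (cases "s i") auto
  qed
  moreover have "{i. i < n \<and> s i} \<union> {i. i < n \<and> \<not> s i} = {0..<n}" by auto
  ultimately show "bipartite G" unfolding bipartite_def by (intro exI conjI) auto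
qed

end

lemma adjacency_graph_eq:
  assumes "simple_graph G" "verts G = {0..<n}"
  shows "adjacency_graph n (\<lambda>i j. {i, j} \<in> edges G) = G"
proof -
  have "{{i, j} | i j. i < n \<and> j < n \<and> {i, j} \<in> edges G} = edges G"
  proof
    show "edges G \<subseteq> {{i, j} | i j. i < n \<and> j < n \<and> {i, j} \<in> edges G}"
    proof
      fix e assume "e \<in> edges G"
      moreover from this obtain u v where "u \<in> verts G" "v \<in> verts G" "e = {u, v}"
        using assms unfolding simple_graph_def by blast
      ultimately show "e \<in> {{i, j} | i j. i < n \<and> j < n \<and> {i, j} \<in> edges G}" using assms(2) by auto
    qed
  qed auto
  then show ?thesis using assms(2) by (simp add: adjacency_graph_def)
qed

lemma adjacency_of_graph:
  assumes "simple_graph G" shows "adjacency n (\<lambda>i j. {i, j} \<in> edges G)"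
proof
  show "\<not> {i, i} \<in> edges G" for i using assms by (auto simp add: simple_graph_def doubleton_eq_iff)
qed (simp add: insert_commute)

abbreviation (input) instance_graph :: "nat ugraph \<Rightarrow> bool" where
  "instance_graph G \<equiv> even_graph G \<and> bipartite G \<and> max_degree G = 4"

abbreviation (input) balanced_graph :: "nat ugraph \<Rightarrow> bool" where
  "balanced_graph G \<equiv> \<exists>f. two_partition G f \<and> locally_balanced_open G f"

context adjacency
begin

abbreviation deg :: "nat \<Rightarrow> nat" where "deg i \<equiv> \<Sum>j<n. of_bool (a i j)"

lemma vertex_degree: "i < n \<Longrightarrow> vertex_degree G i = deg i"
  by (simp only: vertex_degree_def neighbors sum_of_bool_card)

lemma even_max4_iff: "even_graph G \<and> max_degree G = 4 \<longleftrightarrow>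
  (\<forall>i<n. deg i = 0 \<or> deg i = 2 \<or> deg i = 4) \<and> (\<exists>i<n. deg i = 4)"
proof -
  have m: "max_degree G = Max (insert 0 (deg ` {0..<n}))"
    unfolding max_degree_def verts_adjacency_graph
    by (intro arg_cong[where f = Max] arg_cong[where f = "insert 0"] image_cong refl) (simp add: vertex_degree)
  have e: "even_graph G \<longleftrightarrow> (\<forall>i<n. even (deg i))"
    unfolding even_graph_def verts_adjacency_graph using vertex_degree by fastforce
  have M: "Max (insert 0 (deg ` {0..<n})) = 4 \<longleftrightarrow> (\<forall>i<n. deg i \<le> 4) \<and> (\<exists>i<n. deg i = 4)"
    by (subst Max_eq_iff) (fastforce simp del: sum_of_bool_eq)+
  have k: "even k \<and> k \<le> 4 \<longleftrightarrow> k = 0 \<or> k = 2 \<or> k = 4" for k :: nat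
    by presburger
  show ?thesis unfolding m e M k[symmetric] by blast
qed

lemma near_and_even: "even (k + l) \<Longrightarrow> \<bar>int k - int l\<bar> \<le> 1 \<Longrightarrow> k = l"
  by presburger

text \<open>With an even degree the two counts at a vertex have the same parity, so a difference of
  at most 1 is 0. Doubling one count states this without a difference.\<close>

lemma balanced_iff:
  assumes "\<forall>i<n. even (deg i)"
  shows "balanced_graph G \<longleftrightarrow> (\<exists>f. \<forall>i<n. 2 * (\<Sum>j<n. of_bool (a i j \<and> f j)) = deg i)"
proof
  have split: "card {j \<in> neighbors G i. f j = (0::nat)} + card {j \<in> neighbors G i. f j = 1} = deg i"
    if f: "f ` {0..<n} \<subseteq> {0, 1}" and i: "i < n" for f i
  proof -
    have "f j = 0 \<or> f j = 1" if "j < n" for j using f that by fastforce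
    then have "{j. j < n \<and> a i j} = {j \<in> neighbors G i. f j = 0} \<union> {j \<in> neighbors G i. f j = 1}"
      unfolding neighbors[OF i] by blast
    moreover have "card ({j \<in> neighbors G i. f j = 0} \<union> {j \<in> neighbors G i. f j = 1}) =
        card {j \<in> neighbors G i. f j = 0} + card {j \<in> neighbors G i. f j = 1}"
      by (intro card_Un_disjoint) (auto simp add: neighbors[OF i])
    ultimately show ?thesis unfolding sum_of_bool_card by (simp only:)
  qed
  assume "balanced_graph G"
  then obtain f where f: "f ` {0..<n} \<subseteq> {0, 1::nat}" and lb: "locally_balanced_open G f"
    by (auto simp add: two_partition_def)
  have "2 * (\<Sum>j<n. of_bool (a i j \<and> f j = 1)) = deg i" if i: "i < n" for i
  proof -
    have c: "(\<Sum>j<n. of_bool (a i j \<and> f j = 1)) = card {j \<in> neighbors G i. f j = 1}"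
      unfolding sum_of_bool_card neighbors[OF i] by (rule arg_cong[where f = card]) auto
    have "\<bar>int (card {u \<in> neighbors G i. f u = 0}) - int (card {u \<in> neighbors G i. f u = 1})\<bar> \<le> 1"
      using lb i unfolding locally_balanced_open_def by simp
    then have "card {u \<in> neighbors G i. f u = 0} = card {u \<in> neighbors G i. f u = 1}"
      by (intro near_and_even) (use assms i in \<open>simp_all only: split[OF f i]\<close>)
    then show ?thesis using split[OF f i] c by (simp only: mult_2)
  qed
  then show "\<exists>f. \<forall>i<n. 2 * (\<Sum>j<n. of_bool (a i j \<and> f j)) = deg i"
    by (intro exI[of _ "\<lambda>j. f j = 1"] allI impI)
next
  assume "\<exists>f. \<forall>i<n. 2 * (\<Sum>j<n. of_bool (a i j \<and> f j)) = deg i"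
  then obtain f where f: "\<And>i. i < n \<Longrightarrow> 2 * (\<Sum>j<n. of_bool (a i j \<and> f j)) = deg i" by blast
  let ?f = "\<lambda>j. of_bool (f j) :: nat"
  have "card {u \<in> neighbors G i. ?f u = 0} = card {u \<in> neighbors G i. ?f u = 1}" if i: "i < n" for i
  proof -
    have "(\<Sum>j<n. of_bool (a i j \<and> f j)) = card {j \<in> neighbors G i. ?f j = 1}"
      unfolding sum_of_bool_card neighbors[OF i] by (rule arg_cong[where f = card]) auto
    moreover have "deg i = (\<Sum>j<n. of_bool (a i j \<and> f j)) + (\<Sum>j<n. of_bool (a i j \<and> \<not> f j))"
      unfolding sum.distrib[symmetric] by (rule sum.cong) auto
    moreover have "(\<Sum>j<n. of_bool (a i j \<and> \<not> f j)) = card {j \<in> neighbors G i. ?f j = 0}"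
      unfolding sum_of_bool_card neighbors[OF i] by (rule arg_cong[where f = card]) auto
    ultimately show ?thesis using f[OF i] by (simp only: mult_2 add_left_cancel)
  qed
  then have "two_partition G ?f \<and> locally_balanced_open G ?f"
    unfolding two_partition_def locally_balanced_open_def verts_adjacency_graph by fastforce
  then show "balanced_graph G" by (rule exI[of _ ?f])
qed

end

text \<open>The first \<open>n\<close> values of \<open>c\<close> describe the bipartition, the next \<open>n\<close> values the 2-partition.\<close>

definition certificate :: "nat \<Rightarrow> (nat \<Rightarrow> nat \<Rightarrow> bool) \<Rightarrow> (nat \<Rightarrow> bool) \<Rightarrow> bool" where
  "certificate n a c \<longleftrightarrow>
     (\<forall>i<n. \<not> a i i) \<and> (\<forall>i<n. \<forall>j<n. a i j \<longrightarrow> a j i) \<and>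
     (\<forall>i<n. (\<Sum>j<n. of_bool (a i j)) = (0::nat) \<or> (\<Sum>j<n. of_bool (a i j)) = (2::nat) \<or>
        (\<Sum>j<n. of_bool (a i j)) = (4::nat)) \<and>
     (\<exists>i<n. (\<Sum>j<n. of_bool (a i j)) = (4::nat)) \<and>
     (\<forall>i<n. \<forall>j<n. a i j \<longrightarrow> c i \<noteq> c j) \<and>
     (\<forall>i<n. 2 * (\<Sum>j<n. of_bool (a i j \<and> c (n + j))) = (\<Sum>j<n. of_bool (a i j) :: nat))"

lemma graph_language_iff:
  "x \<in> graph_language (\<lambda>G. instance_graph G) (\<lambda>G. balanced_graph G) \<longleftrightarrow>
     (\<exists>n a. graph_bits n a x \<and> (\<exists>c. certificate n a c))"
proof
  assume "x \<in> graph_language (\<lambda>G. instance_graph G) (\<lambda>G. balanced_graph G)"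
  then obtain H n where H: "x = graph_code H" "simple_graph H" "verts H = {0..<n}"
    "instance_graph H" "balanced_graph H"
    unfolding graph_language_def by blast
  let ?a = "\<lambda>i j. {i, j} \<in> edges H"
  interpret adjacency n ?a using H(2) by (rule adjacency_of_graph)
  have G: "G = H" using H by (intro adjacency_graph_eq)
  have d: "(\<forall>i<n. deg i = 0 \<or> deg i = 2 \<or> deg i = 4) \<and> (\<exists>i<n. deg i = 4)"
    using H(4) even_max4_iff unfolding G by simp
  then have "\<forall>i<n. even (deg i)" by (metis even_numeral even_zero)
  from iffD1[OF balanced_iff[OF this], unfolded G, OF H(5)]
  obtain f where f: "\<forall>i<n. 2 * (\<Sum>j<n. of_bool (?a i j \<and> f j)) = deg i" by auto
  have "bipartite H" using H(4) by blast
  from iffD1[OF bipartite_iff, unfolded G, OF this]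
  obtain s where s: "\<forall>i<n. \<forall>j<n. ?a i j \<longrightarrow> s i \<noteq> (s j :: bool)" by auto
  let ?c = "\<lambda>k. if k < n then s k else f (k - n)"
  have c: "?c (n + j) = f j" for j by simp
  have "\<forall>i<n. \<forall>j<n. ?a i j \<longrightarrow> ?c i \<noteq> ?c j" using s by simp
  then have "certificate n ?a ?c"
    unfolding certificate_def c using d f sym irrefl by blast
  moreover have "graph_bits n ?a x" using code H(1) unfolding G by simp
  ultimately show "\<exists>n a. graph_bits n a x \<and> (\<exists>c. certificate n a c)" by blast
next
  assume "\<exists>n a. graph_bits n a x \<and> (\<exists>c. certificate n a c)"
  then obtain n a c where x: "graph_bits n a x" and c: "certificate n a c" by blast
  interpret adjacency n a
    using c unfolding certificate_def by unfold_locales blast+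
  have d: "(\<forall>i<n. deg i = 0 \<or> deg i = 2 \<or> deg i = 4) \<and> (\<exists>i<n. deg i = 4)"
    using c unfolding certificate_def by blast
  then have "\<forall>i<n. even (deg i)" by (metis even_numeral even_zero)
  note even_deg = this
  have "\<forall>i<n. 2 * (\<Sum>j<n. of_bool (a i j \<and> c (n + j))) = deg i"
    using c unfolding certificate_def by blast
  then have "\<exists>f. \<forall>i<n. 2 * (\<Sum>j<n. of_bool (a i j \<and> f j)) = deg i" by (rule exI[of _ "\<lambda>j. c (n + j)"])
  then have b: "balanced_graph G" by (rule iffD2[OF balanced_iff[OF even_deg]])
  have "\<forall>i<n. \<forall>j<n. a i j \<longrightarrow> c i \<noteq> c j" using c unfolding certificate_def by blast
  then have "bipartite G" unfolding bipartite_iff by (rule exI[of _ c])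
  then have "instance_graph G" using d even_max4_iff by blast
  then show "x \<in> graph_language (\<lambda>G. instance_graph G) (\<lambda>G. balanced_graph G)"
    unfolding graph_language_def using b simple x code verts_adjacency_graph by blast
qed

text \<open>Variable 2 is the number of vertices; 3 and 4 are vertices.\<close>

definition adj_exp :: "nat \<Rightarrow> nat \<Rightarrow> exp" where
  "adj_exp i j = Bit 0 (Add (Add (V 2) (N 1)) (Add (Mul (V i) (V 2)) (V j)))"

definition deg_exp :: exp where
  "deg_exp = Sum 4 (V 2) (adj_exp 3 4)"

definition differ_exp :: exp where
  "differ_exp = Not_exp (Eq_exp (Bit 1 (V 3)) (Bit 1 (V 4)))"

definition half_exp :: exp where
  "half_exp = Mul (N 2) (Sum 4 (V 2) (Mul (adj_exp 3 4) (Bit 1 (Add (V 2) (V 4)))))"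

text \<open>The factors follow the conjuncts of \<open>graph_bits\<close> and
  \<open>certificate\<close>. The outer sum searches for the number of vertices, which is smaller
  than the length of a code.\<close>

definition verifier :: exp where
  "verifier = Sum 2 Len (
     Mul (Eq_exp Len (Add (Add (V 2) (N 1)) (Mul (V 2) (V 2))))
    (Mul (All_exp 3 (V 2) (Bit 0 (V 3)))
    (Mul (Not_exp (Bit 0 (V 2)))
    (Mul (All_exp 3 (V 2) (Not_exp (adj_exp 3 3)))
    (Mul (All_exp 3 (V 2) (All_exp 4 (V 2) (Add (Not_exp (adj_exp 3 4)) (adj_exp 4 3))))
    (Mul (All_exp 3 (V 2) (Add (Eq_exp deg_exp (N 0)) (Add (Eq_exp deg_exp (N 2)) (Eq_exp deg_exp (N 4)))))
    (Mul (Sum 3 (V 2) (Eq_exp deg_exp (N 4)))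
    (Mul (All_exp 3 (V 2) (All_exp 4 (V 2) (Add (Not_exp (adj_exp 3 4))
        differ_exp)))
         (All_exp 3 (V 2) (Eq_exp half_exp deg_exp))))))))))"

lemma certificate_cong:
  assumes ab: "\<And>i j. i < n \<Longrightarrow> j < n \<Longrightarrow> a i j = b i j" and cd: "\<And>k. k < 2 * n \<Longrightarrow> c k = d k"
  shows "certificate n a c = certificate n b d"
proof -
  have s: "(\<Sum>j<n. of_bool (a i j)) = (\<Sum>j<n. of_bool (b i j) :: nat)" if "i < n" for i
    by (rule sum.cong) (use ab that in simp_all)
  have p: "(\<Sum>j<n. of_bool (a i j \<and> c (n + j))) = (\<Sum>j<n. of_bool (b i j \<and> d (n + j)) :: nat)"
    if "i < n" for i
    by (rule sum.cong) (use ab cd that in simp_all)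
  have c: "i < n \<Longrightarrow> c i = d i" for i using cd by simp
  show ?thesis unfolding certificate_def
    by (intro arg_cong2[where f = "(\<and>)"] all_cong ex_cong) (simp_all only: ab s p c)
qed

lemma word_cells_eq_2: "word_cells w (int k) = 2 \<longleftrightarrow> k < length w \<and> w ! k"
  by (auto simp add: word_cells_def)

lemma verifier_correct:
  "eval x (word_cells y) verifier (\<lambda>_. 0) \<noteq> 0 \<longleftrightarrow>
    (\<exists>n a. graph_bits n a x \<and> certificate n a (\<lambda>k. k < length y \<and> y ! k))"
proof -
  let ?u = "word_cells y"
  \<comment> \<open>Past the end of a word a blank is read, which counts as False.\<close>
  let ?a = "\<lambda>n i j. n + 1 + i * n + j < length x \<and> x ! (n + 1 + i * n + j)"
  let ?c = "\<lambda>k. k < length y \<and> y ! k"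
  have bit0: "holds x ?u (Bit 0 e) g \<longleftrightarrow> eval x ?u e g < length x \<and> x ! eval x ?u e g" if "g 0 = 0" for g e
    using that by (simp add: holds_simps cell_def word_cells_eq_2)
  have bit1: "eval x ?u (Bit 1 e) g = of_bool (?c (eval x ?u e g))" if "g 1 = 0" for g e
    using that by (simp add: cell_def word_cells_eq_2)
  have hadj: "holds x ?u (adj_exp i j) g \<longleftrightarrow> ?a (g 2) (g i) (g j)" if "g 0 = 0" for g i j
    using that by (simp add: adj_exp_def bit0 add.assoc)
  have eadj: "eval x ?u (adj_exp i j) g = of_bool (?a (g 2) (g i) (g j))" if "g 0 = 0" for g i j
    using hadj[of g i j] that by (simp add: holds_def adj_exp_def split: if_splits)
  have deg: "eval x ?u deg_exp g = (\<Sum>j<g 2. of_bool (?a (g 2) (g 3) j))" if "g 0 = 0" for g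
    using that by (simp add: deg_exp_def eadj del: of_bool_conj)
  have differ: "holds x ?u differ_exp g \<longleftrightarrow> ?c (g 3) \<noteq> ?c (g 4)" if "g 1 = 0" for g
    using that by (simp add: differ_exp_def holds_simps bit1[unfolded One_nat_def] del: eval.simps(8))
  have half: "eval x ?u half_exp g =
      2 * (\<Sum>j<g 2. of_bool (?a (g 2) (g 3) j \<and> ?c (g 2 + j)))" if "g 0 = 0" "g 1 = 0" for g
  proof -
    have "eval x ?u (Mul (adj_exp 3 4) (Bit 1 (Add (V 2) (V 4)))) (g(4 := j)) =
        of_bool (?a (g 2) (g 3) j \<and> ?c (g 2 + j))" for j
      using that by (simp add: eadj bit1[unfolded One_nat_def] of_bool_conj del: eval.simps(8))
    then show ?thesis
      unfolding half_exp_def eval.simps(5)[of x ?u "N 2"] eval.simps(1,2,6) by (simp only:)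
  qed
  have "eval x ?u verifier (\<lambda>_. 0) \<noteq> 0 \<longleftrightarrow> (\<exists>n<length x. length x = n + 1 + n * n \<and>
     (\<forall>i<n. i < length x \<and> x ! i) \<and> \<not> (n < length x \<and> x ! n) \<and> certificate n (?a n) ?c)"
    unfolding holds_def[symmetric] verifier_def certificate_def
    by (simp add: holds_simps(1-8) bit0 hadj deg half differ imp_conjL del: eval.simps(8) of_bool_conj sum_of_bool_eq)
  also have "\<dots> \<longleftrightarrow> (\<exists>n. graph_bits n (?a n) x \<and> certificate n (?a n) ?c)"
  proof (intro iff_exI)
    fix n :: nat
    have b: "n + 1 + i * n + j < n + 1 + n * n" if "i < n" "j < n" for i j
    proof -
      have "i * n + j < Suc i * n" using that by simp
      also have "\<dots> \<le> n * n" using that by (intro mult_right_mono) auto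
      finally show ?thesis by simp
    qed
    show "n < length x \<and> length x = n + 1 + n * n \<and>
     (\<forall>i<n. i < length x \<and> x ! i) \<and> \<not> (n < length x \<and> x ! n) \<and> certificate n (?a n) ?c \<longleftrightarrow>
     graph_bits n (?a n) x \<and> certificate n (?a n) ?c"
    proof (cases "length x = n + 1 + n * n")
      case True
      then have "n < length x" "\<forall>i<n. i < length x" by auto
      moreover have "\<forall>i<n. \<forall>j<n. x ! (n + 1 + i * n + j) = ?a n i j" using b True by simp
      ultimately show ?thesis using True unfolding graph_bits_def by blast
    qed (simp add: graph_bits_def)
  qed
  also have "\<dots> \<longleftrightarrow> (\<exists>n a. graph_bits n a x \<and> certificate n a ?c)"
  proof
    assume "\<exists>n a. graph_bits n a x \<and> certificate n a ?c"
    then obtain n a where 1: "graph_bits n a x" "certificate n a ?c" by blast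
    have "a i j = ?a n i j" if "i < n" "j < n" for i j
    proof -
      have "i * n + j < Suc i * n" using that by simp
      also have "\<dots> \<le> n * n" using that by (intro mult_right_mono) auto
      finally show ?thesis using 1(1) that by (simp add: graph_bits_def)
    qed
    note a = this
    have "certificate n (?a n) ?c" 
      by (rule iffD1[OF certificate_cong[of n a "?a n" ?c ?c] 1(2)], rule a, assumption+) (rule refl)
    moreover have "graph_bits n (?a n) x" using 1(1) a unfolding graph_bits_def by metis
    ultimately show "\<exists>n. graph_bits n (?a n) x \<and> certificate n (?a n) ?c" by blast
  qed blast
  finally show ?thesis .
qed

theorem graph_language_in_NP:
  "graph_language (\<lambda>G. instance_graph G) (\<lambda>G. balanced_graph G) \<in> NP"
proof -
  let ?R = "\<lambda>x y. eval x (word_cells y) verifier (\<lambda>_. 0) \<noteq> 0"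
  have "wf_exp 5 verifier"
    by (simp add: verifier_def half_exp_def differ_exp_def deg_exp_def adj_exp_def wf_exp_derived)
  then have "poly_time_rel ?R" by (rule poly_time_rel_exp) simp
  moreover have "x \<in> graph_language (\<lambda>G. instance_graph G) (\<lambda>G. balanced_graph G) \<longleftrightarrow>
      (\<exists>c. length c \<le> poly [:0, 2:] (length x) \<and> ?R x c)" for x
    unfolding graph_language_iff verifier_correct
  proof
    assume "\<exists>n a. graph_bits n a x \<and> (\<exists>c. certificate n a c)"
    then obtain n a c where 1: "graph_bits n a x" "certificate n a c" by blast
    \<comment> \<open>A certificate is consulted below \<open>2 * n\<close> only, and
      \<open>n\<close> is at most the length of \<open>x\<close>; this is the origin of the bound
      \<open>[:0, 2:]\<close>.\<close>
    let ?y = "map c [0..<2 * n]"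
    have "certificate n a (\<lambda>k. k < length ?y \<and> ?y ! k)"
      using 1(2) by (subst certificate_cong[of n _ a _ c]) auto
    moreover have "length ?y \<le> poly [:0, 2:] (length x)" using 1(1) by (simp add: graph_bits_def)
    ultimately show "\<exists>c. length c \<le> poly [:0, 2:] (length x) \<and>
        (\<exists>n a. graph_bits n a x \<and> certificate n a (\<lambda>k. k < length c \<and> c ! k))"
      using 1(1) by blast
  qed blast
  ultimately show ?thesis unfolding NP_def by blast
qed

section \<open>From two-in-four formulas to graphs\<close>

lemma sum_of_bool_filter:
  assumes "{j. j < n \<and> A j} = S"
  shows "(\<Sum>j<(n::nat). of_bool (A j \<and> P j)) = (\<Sum>j\<in>S. of_bool (P j) :: nat)"
  by (rule sum.mono_neutral_cong_right) (use assms in auto)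

text \<open>Literal number \<open>e\<close> is the variable \<open>lv e\<close>, negated iff
  \<open>ls e = 1\<close>; constraint \<open>c\<close> owns the literals \<open>4 * c\<close> to
  \<open>4 * c + 3\<close>. With at least one constraint the graph has a vertex of degree 4, as
  maximum degree 4 demands.\<close>

locale formula =
  fixes nv nc :: nat and lv ls :: "nat \<Rightarrow> nat"
  assumes nc: "0 < nc" and lv: "e < 4 * nc \<Longrightarrow> lv e < nv" and ls: "ls e < 2"
begin

definition satisfies :: "(nat \<Rightarrow> bool) \<Rightarrow> bool" where
  "satisfies v \<longleftrightarrow> (\<forall>c<nc. (\<Sum>r<4. of_bool (v (lv (4 * c + r)) \<noteq> odd (ls (4 * c + r)))) = (2::nat))"

text \<open>The slots are the vertices below \<open>K\<close>. They form a block of \<open>M\<close> vertices for each variable, whose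
  members \<open>2 * e\<close> and \<open>2 * e + 1\<close> stand for the plain and the negated variable as literal number \<open>e\<close> of
  the formula. Vertex \<open>K + y\<close> links slot \<open>y\<close> to its cyclic successor within the block, and vertices
  \<open>2 * K + 2 * c\<close> and \<open>2 * K + 2 * c + 1\<close> are the twins of constraint \<open>c\<close>.\<close>

definition M :: nat where "M = 8 * nc"
definition K :: nat where "K = nv * M"
definition n :: nat where "n = 2 * K + 2 * nc"

definition slot :: "nat \<Rightarrow> nat" where
  "slot e = lv e * M + (2 * e + ls e)"

definition nxt :: "nat \<Rightarrow> nat" where
  "nxt k = (if Suc k mod M = 0 then Suc k - M else Suc k)"

definition prv :: "nat \<Rightarrow> nat" where
  "prv k = (if k mod M = 0 then k + M - 1 else k - 1)"

text \<open>\<open>right i y\<close> joins slot \<open>i\<close> to vertex \<open>K + y\<close>: the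
  slots form one side of the bipartition, the vertices from \<open>K\<close> on the other.\<close>

definition right :: "nat \<Rightarrow> nat \<Rightarrow> bool" where
  "right i y \<longleftrightarrow> (y < K \<and> (i = y \<or> i = nxt y)) \<or>
     (\<exists>c<nc. \<exists>b<2. \<exists>r<4. y = K + (2 * c + b) \<and> i = slot (4 * c + r))"

definition adj :: "nat \<Rightarrow> nat \<Rightarrow> bool" where
  "adj i j \<longleftrightarrow> (i < K \<and> K \<le> j \<and> right i (j - K)) \<or> (j < K \<and> K \<le> i \<and> right j (i - K))"

lemma M_ge: "8 \<le> M" using nc by (simp add: M_def)

lemma even_M: "even M" by (simp add: M_def)

lemma even_K: "even K" by (simp add: K_def M_def)

lemma slot_less: "e < 4 * nc \<Longrightarrow> slot e < K"
proof -
  assume e: "e < 4 * nc"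
  have "2 * e + ls e < M" using e ls[of e] by (simp add: M_def)
  then have "slot e < Suc (lv e) * M" by (simp add: slot_def)
  also have "\<dots> \<le> nv * M" using lv[OF e] by (intro mult_right_mono) auto
  finally show ?thesis by (simp add: K_def)
qed

lemma slot_mod: "e < 4 * nc \<Longrightarrow> slot e mod M = 2 * e + ls e"
  using ls[of e] by (simp add: slot_def M_def)

lemma slot_div: "e < 4 * nc \<Longrightarrow> slot e div M = lv e"
  using ls[of e] by (simp add: slot_def M_def)

text \<open>The offset in the block encodes the literal number, with the sign as its last bit. So
  two occurrences never share a slot, and no slot serves more than one constraint. Two offsets for
  each of \<open>4 * nc\<close> literals give the block length \<open>8 * nc\<close>.\<close>

lemma slot_inj: 
  assumes "e < 4 * nc" "e' < 4 * nc" "slot e = slot e'" shows "e = e'"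
proof -
  have "2 * e + ls e = 2 * e' + ls e'" using assms slot_mod by metis
  then show ?thesis using ls[of e] ls[of e'] by linarith
qed

lemma odd_slot: "odd (slot e) \<longleftrightarrow> odd (ls e)"
  using even_M by (simp add: slot_def)

lemma K_dvd: "M dvd K" by (simp add: K_def)

lemma K_cases: "k < K \<Longrightarrow> Suc k mod M \<noteq> 0 \<Longrightarrow> Suc k < K"
  using K_dvd by (metis Suc_lessI dvd_imp_mod_0)

lemma nxt_less: "k < K \<Longrightarrow> nxt k < K"
  using K_cases M_ge by (auto simp add: nxt_def)

lemma nxt_div: "nxt k div M = k div M"
proof (cases "Suc k mod M = 0")
  case True
  then obtain q where q: "Suc k = M * q" by auto
  then obtain p where p: "q = Suc p" by (cases q) auto
  have k: "Suc k = M + p * M" using q p by simp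
  then have "k div M = p" using M_ge by (intro div_nat_eqI) (auto simp add: mult.commute)
  moreover have "nxt k = p * M" using k True by (simp add: nxt_def)
  moreover have "p * M div M = p" using M_ge by simp
  ultimately show ?thesis by simp
next
  case False
  then show ?thesis using div_Suc[of k M] by (auto simp add: nxt_def mod_Suc split: if_splits)
qed

text \<open>As \<open>M\<close> is even, parity also flips where a block closes up, so values can
  alternate all around the cycle.\<close>

lemma odd_nxt: "odd (nxt k) \<longleftrightarrow> even k"
proof (cases "Suc k mod M = 0")
  case True
  then have "M \<le> Suc k" by (metis mod_less not_le old.nat.distinct(1))
  then have "nxt k + M = Suc k" using True by (simp add: nxt_def)
  then show ?thesis using even_M by (metis even_Suc odd_add)
qed (simp add: nxt_def)

lemma prv_less: "k < K \<Longrightarrow> prv k < K"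
proof (cases "k mod M = 0")
  case True
  assume "k < K"
  then have "k div M < nv" by (simp add: K_def less_mult_imp_div_less)
  then have "Suc (k div M) * M \<le> K" unfolding K_def by (intro mult_right_mono) auto
  moreover have "k = k div M * M" using True by auto
  ultimately show ?thesis using True M_ge by (auto simp add: prv_def)
qed (simp add: prv_def)

lemma nxt_eq_iff: "nxt y = i \<longleftrightarrow> y = prv i"
proof
  assume i: "nxt y = i"
  show "y = prv i"
  proof (cases "Suc y mod M = 0")
    case True
    then have "M \<le> Suc y" by (metis mod_less not_le old.nat.distinct(1))
    then have "i mod M = 0" "i + M = Suc y" using True i by (auto simp add: nxt_def mod_eq_0_iff_dvd)
    then show ?thesis by (simp add: prv_def)
  qed (use i in \<open>auto simp add: nxt_def prv_def\<close>)
next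
  assume y: "y = prv i"
  show "nxt y = i"
  proof (cases "i mod M = 0")
    case True
    then have "Suc y = i + M" using y M_ge by (simp add: prv_def)
    then show ?thesis using True by (simp add: nxt_def)
  next
    case False
    then have "Suc y = i" using y by (cases i) (auto simp add: prv_def)
    then show ?thesis using False by (simp add: nxt_def)
  qed
qed

lemma nxt_neq: "nxt k \<noteq> k"
  using odd_nxt by metis

lemma even_prv: "even (prv k) \<longleftrightarrow> odd k"
  using odd_nxt nxt_eq_iff by metis

text \<open>Two neighbours are the links to the cyclic successor and predecessor. By
  \<open>slot_inj\<close> at most one constraint uses the slot, and it contributes its two
  twins.\<close>

lemma neighbors_left:
  assumes i: "i < K"
  obtains "{j. j < n \<and> adj i j} = {K + i, K + prv i}"
  | c where "c < nc" "{j. j < n \<and> adj i j} = {K + i, K + prv i, K + (K + 2 * c), K + (K + (2 * c + 1))}"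
proof -
  have *: "j < n \<and> adj i j \<longleftrightarrow> j = K + i \<or> j = K + prv i \<or>
      (\<exists>c<nc. \<exists>b<2. \<exists>r<4. j = K + (K + (2 * c + b)) \<and> i = slot (4 * c + r))" for j
  proof
    assume "j < n \<and> adj i j"
    then have j: "K \<le> j" "right i (j - K)" using i by (auto simp add: adj_def)
    from j(2)[unfolded right_def]
    show "j = K + i \<or> j = K + prv i \<or>
      (\<exists>c<nc. \<exists>b<2. \<exists>r<4. j = K + (K + (2 * c + b)) \<and> i = slot (4 * c + r))"
    proof (elim disjE conjE exE)
      fix c b r assume "c < nc" "b < 2" "r < 4" "j - K = K + (2 * c + b)" "i = slot (4 * c + r)"
      moreover from this j(1) have "j = K + (K + (2 * c + b))" by simp
      ultimately show ?thesis by blast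
    qed (use j(1) nxt_eq_iff[of "j - K" i] in auto)
  next
    assume "j = K + i \<or> j = K + prv i \<or>
      (\<exists>c<nc. \<exists>b<2. \<exists>r<4. j = K + (K + (2 * c + b)) \<and> i = slot (4 * c + r))"
    then show "j < n \<and> adj i j"
    proof (elim disjE conjE exE)
      fix c b r assume "c < nc" "b < 2" "r < 4" "j = K + (K + (2 * c + b))" "i = slot (4 * c + r)"
      moreover from this have "right i (j - K)" unfolding right_def by auto
      ultimately show ?thesis using i by (auto simp add: n_def adj_def)
    qed (use i prv_less[OF i] nxt_eq_iff[of "prv i" i] in \<open>auto simp add: n_def adj_def right_def\<close>)
  qed
  show thesis
  proof (cases "\<exists>c<nc. \<exists>r<4. i = slot (4 * c + r)")
    case True
    then obtain c r where c: "c < nc" "r < 4" "i = slot (4 * c + r)" by blast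
    have u: "c' = c" if "c' < nc" "r' < 4" "i = slot (4 * c' + r')" for c' r'
    proof -
      have "4 * c' + r' = 4 * c + r" using slot_inj[of "4 * c' + r'" "4 * c + r"] c that by auto
      then show ?thesis using c(2) that(2) by linarith
    qed
    have "{j. j < n \<and> adj i j} = {K + i, K + prv i, K + (K + 2 * c), K + (K + (2 * c + 1))}"
    proof (rule set_eqI)
      fix j
      have "(\<exists>c<nc. \<exists>b<2. \<exists>r<4. j = K + (K + (2 * c + b)) \<and> i = slot (4 * c + r)) \<longleftrightarrow>
          (\<exists>b<2. j = K + (K + (2 * c + b)))" using u c by blast
      also have "\<dots> \<longleftrightarrow> j = K + (K + 2 * c) \<or> j = K + (K + (2 * c + 1))"
        by (auto simp add: less_2_cases_iff)
      finally show "j \<in> {j. j < n \<and> adj i j} \<longleftrightarrow>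
          j \<in> {K + i, K + prv i, K + (K + 2 * c), K + (K + (2 * c + 1))}"
        using *[of j] by auto
    qed
    then show thesis using that(2) c(1) by blast
  next
    case False
    then have "{j. j < n \<and> adj i j} = {K + i, K + prv i}" using * by blast
    then show thesis using that(1) by blast
  qed
qed

lemma neighbors_link:
  assumes y: "y < K" shows "{j. j < n \<and> adj (K + y) j} = {y, nxt y}"
  using y nxt_less[OF y] by (auto simp add: adj_def right_def n_def)

lemma neighbors_clause:
  assumes c: "c < nc" "b < 2"
  shows "{j. j < n \<and> adj (K + (K + (2 * c + b))) j} = (\<lambda>r. slot (4 * c + r)) ` {..<4}"
proof -
  have e: "c' = c" if "K + (2 * c + b) = K + (2 * c' + b')" "b' < 2" for c' b'
    using that c by linarith
  have "j < n \<and> adj (K + (K + (2 * c + b))) j \<longleftrightarrow> (\<exists>r<4. j = slot (4 * c + r))" for j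
  proof
    assume "j < n \<and> adj (K + (K + (2 * c + b))) j"
    then have "right j (K + (2 * c + b))" by (auto simp add: adj_def)
    then show "\<exists>r<4. j = slot (4 * c + r)" using e unfolding right_def by blast
  next
    assume "\<exists>r<4. j = slot (4 * c + r)"
    then obtain r where r: "r < 4" "j = slot (4 * c + r)" by blast
    then have "j < K" using slot_less c by simp
    moreover have "right j (K + (2 * c + b))" unfolding right_def using c r by blast
    ultimately show "j < n \<and> adj (K + (K + (2 * c + b))) j" by (auto simp add: adj_def n_def)
  qed
  then show ?thesis by auto
qed

lemma slot_inj_on: "c < nc \<Longrightarrow> inj_on (\<lambda>r. slot (4 * c + r)) {..<4}"
proof (rule inj_onI)
  fix r r' assume "c < nc" "r \<in> {..<4}" "r' \<in> {..<4}" "slot (4 * c + r) = slot (4 * c + r')"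
  then show "r = r'" using slot_inj[of "4 * c + r" "4 * c + r'"] by simp
qed

lemma vertex_cases:
  assumes "i < n"
  obtains "i < K" | y where "y < K" "i = K + y" | c b where "c < nc" "b < 2" "i = K + (K + (2 * c + b))"
proof -
  consider "i < K" | "K \<le> i" "i < 2 * K" | "2 * K \<le> i" by linarith
  then show thesis
  proof cases
    case 2
    then show thesis using that(2)[of "i - K"] by simp
  next
    case 3
    define k where "k = i - 2 * K"
    have "i = K + (K + (2 * (k div 2) + k mod 2))" using 3 by (simp add: k_def)
    moreover have "k div 2 < nc" using assms 3 by (auto simp add: k_def n_def)
    ultimately show thesis using that(3)[of "k div 2" "k mod 2"] by simp
  qed (rule that(1))
qed

text \<open>Giving the vertices from \<open>K\<close> on the parity of their number as value balances all slots, whatever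
  the formula; only the values of the slots carry information.\<close>

lemma certificate_iff: "(\<exists>c. certificate n adj c) \<longleftrightarrow> (\<exists>v. satisfies v)"
proof
  assume "\<exists>c. certificate n adj c"
  then obtain c where c: "certificate n adj c" by blast
  define f where "f = (\<lambda>j. c (n + j))"
  have half: "2 * (\<Sum>j\<in>S. of_bool (f j)) = card S" if "i < n" "{j. j < n \<and> adj i j} = S" for i S
  proof -
    have "2 * (\<Sum>j<n. of_bool (adj i j \<and> f j)) = (\<Sum>j<n. of_bool (adj i j) :: nat)"
      using c that(1) unfolding certificate_def f_def by blast
    then show ?thesis
      using sum_of_bool_filter[OF that(2), of f] sum_of_bool_card[of "adj i" n] that(2)
      by (simp del: sum_of_bool_eq)
  qed
  have link: "f (nxt y) \<noteq> f y" if "y < K" for y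
  proof -
    have "K + y < n" using that by (simp add: n_def)
    from half[OF this neighbors_link[OF that]] show ?thesis
      using nxt_neq[of y] by (cases "f y"; cases "f (nxt y)") (simp_all del: sum_of_bool_eq)
  qed
  \<comment> \<open>The links force alternation along a block, so offset \<open>k\<close> has the
    value of the first slot changed by the parity of \<open>k\<close>. Thus offset
    \<open>2 * e + ls e\<close> carries the literal with its sign.\<close>
  have val: "k < M \<Longrightarrow> f (x * M + k) = (f (x * M) \<noteq> odd k)" if "x < nv" for x k
  proof (induction k)
    case (Suc k)
    have "Suc x * M \<le> K" unfolding K_def using that by (intro mult_right_mono) auto
    then have "x * M + k < K" using Suc.prems by simp
    moreover have "nxt (x * M + k) = x * M + Suc k" using Suc.prems by (simp add: nxt_def flip: add_Suc_right)
    ultimately show ?case using link[of "x * M + k"] Suc by auto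
  qed simp
  have "satisfies (\<lambda>x. f (x * M))"
    unfolding satisfies_def
  proof (intro allI impI)
    fix c assume c: "c < nc"
    have fs: "f (slot e) = (f (lv e * M) \<noteq> odd (ls e))" if "e < 4 * nc" for e
    proof -
      have "2 * e + ls e < M" using that ls[of e] by (simp add: M_def)
      from val[OF lv[OF that] this] show ?thesis by (simp add: slot_def)
    qed
    have "K + (K + (2 * c + 0)) < n" using c by (simp add: n_def)
    from half[OF this neighbors_clause[OF c, of 0]]
    have "2 * (\<Sum>j\<in>(\<lambda>r. slot (4 * c + r)) ` {..<4}. of_bool (f j)) = (4::nat)"
      using card_image[OF slot_inj_on[OF c]] by (simp del: sum_of_bool_eq)
    then have "2 * (\<Sum>r<4. of_bool (f (slot (4 * c + r)))) = (4::nat)"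
      using sum.reindex[OF slot_inj_on[OF c], of "\<lambda>j. of_bool (f j) :: nat"]
      by (simp del: sum_of_bool_eq)
    moreover have "(\<Sum>r<4. of_bool (f (slot (4 * c + r)))) =
        (\<Sum>r<4. of_bool (f (lv (4 * c + r) * M) \<noteq> odd (ls (4 * c + r))) :: nat)"
      by (rule sum.cong) (use c fs in auto)
    ultimately show "(\<Sum>r<4. of_bool (f (lv (4 * c + r) * M) \<noteq> odd (ls (4 * c + r)))) = (2::nat)"
      by linarith
  qed
  then show "\<exists>v. satisfies v" by blast
next
  assume "\<exists>v. satisfies v"
  then obtain v where v: "satisfies v" by blast
  define f where "f = (\<lambda>j. if j < K then v (j div M) \<noteq> odd j else odd j)"
  define c where "c = (\<lambda>k. if k < n then k < K else f (k - n))"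
  have cf: "c (n + j) = f j" for j by (simp add: c_def)
  have half: "2 * (\<Sum>j\<in>S. of_bool (f j)) = card S \<and> (card S = 2 \<or> card S = 4)"
    if "i < n" "{j. j < n \<and> adj i j} = S" for i S
    using that(1)
  proof (cases rule: vertex_cases)
    case 1
    have p: "prv i \<noteq> i" using even_prv by metis
    have fi: "f (K + i) = odd i" "f (K + prv i) = even i"
      using even_K even_prv by (auto simp add: f_def)
    from 1 show ?thesis
    proof (cases rule: neighbors_left)
      case 1
      then show ?thesis using that(2) p fi by (cases "odd i") (auto simp del: sum_of_bool_eq)
    next
      case (2 c)
      have fc: "\<not> f (K + (K + 2 * c))" "f (K + (K + (2 * c + 1)))" by (auto simp add: f_def)
      have S: "S = {K + i, K + prv i, K + (K + 2 * c), K + (K + (2 * c + 1))}" using 2 that(2) by simp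
      have "K + i \<notin> {K + (K + 2 * c), K + (K + (2 * c + 1))}" "K + prv i \<notin> {K + (K + 2 * c), K + (K + (2 * c + 1))}"
        using \<open>i < K\<close> prv_less[of i] by auto
      then show ?thesis unfolding S using p fi fc
        by (cases "odd i") (auto simp del: sum_of_bool_eq)
    qed
  next
    case (2 y)
    have "S = {y, nxt y}" using neighbors_link 2 that(2) by simp
    moreover have "f (nxt y) \<noteq> f y" using 2 nxt_less nxt_div odd_nxt by (simp add: f_def)
    ultimately show ?thesis using nxt_neq[of y]
      by (cases "f y"; cases "f (nxt y)") (simp_all del: sum_of_bool_eq)
  next
    case (3 c b)
    have S: "S = (\<lambda>r. slot (4 * c + r)) ` {..<4}" using neighbors_clause 3 that(2) by simp
    have "card S = 4" unfolding S using card_image[OF slot_inj_on[OF 3(1)]] by simp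
    have "(\<Sum>j\<in>S. of_bool (f j)) = (\<Sum>r<4. of_bool (f (slot (4 * c + r))) :: nat)"
      unfolding S using sum.reindex[OF slot_inj_on[OF 3(1)], of "\<lambda>j. of_bool (f j) :: nat"]
      by (simp del: sum_of_bool_eq)
    also have "\<dots> = (\<Sum>r<4. of_bool (v (lv (4 * c + r)) \<noteq> odd (ls (4 * c + r))))"
      by (rule sum.cong) (use 3 slot_less slot_div odd_slot in \<open>auto simp add: f_def\<close>)
    also have "\<dots> = 2" using v 3(1) unfolding satisfies_def by blast
    finally show ?thesis using \<open>card S = 4\<close> by (simp del: sum_of_bool_eq)
  qed
  have deg: "(\<Sum>j<n. of_bool (adj i j)) = card {j. j < n \<and> adj i j}" for i
    by (rule sum_of_bool_card)
  have bal: "2 * (\<Sum>j<n. of_bool (adj i j \<and> c (n + j))) = (\<Sum>j<n. of_bool (adj i j) :: nat)" if "i < n" for i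
    unfolding cf deg sum_of_bool_filter[OF refl] using half[OF that refl] by blast
  have "certificate n adj c"
    unfolding certificate_def
  proof (intro conjI)
    show "\<forall>i<n. \<not> adj i i" by (simp add: adj_def)
    show "\<forall>i<n. \<forall>j<n. adj i j \<longrightarrow> adj j i" by (auto simp add: adj_def)
    show "\<forall>i<n. (\<Sum>j<n. of_bool (adj i j)) = (0::nat) \<or> (\<Sum>j<n. of_bool (adj i j)) = (2::nat) \<or>
        (\<Sum>j<n. of_bool (adj i j)) = (4::nat)"
      unfolding deg using half by blast
    have "2 * K < n" using nc by (simp add: n_def)
    moreover have "card {j. j < n \<and> adj (K + (K + (2 * 0 + 0))) j} = 4"
      using neighbors_clause[OF nc, of 0] card_image[OF slot_inj_on[OF nc]] by simp
    ultimately show "\<exists>i<n. (\<Sum>j<n. of_bool (adj i j)) = (4::nat)"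
      unfolding deg by (intro exI[of _ "K + (K + (2 * 0 + 0))"]) simp
    show "\<forall>i<n. \<forall>j<n. adj i j \<longrightarrow> c i \<noteq> c j" by (auto simp add: adj_def c_def)
    show "\<forall>i<n. 2 * (\<Sum>j<n. of_bool (adj i j \<and> c (n + j))) = (\<Sum>j<n. of_bool (adj i j) :: nat)"
      using bal by blast
  qed
  then show "\<exists>c. certificate n adj c" by blast
qed

end

section \<open>From tilings to two-in-four formulas\<close>

lemma nested_index_less:
  assumes "i < a" "j < b" shows "i * b + j < a * (b::nat)"
proof -
  have "i * b + j < Suc i * b" using assms by simp
  also have "\<dots> \<le> a * b" using assms by (intro mult_right_mono) auto
  finally show ?thesis .
qed

lemma all_less_mult: "(\<forall>c<a * b. P c) \<longleftrightarrow> (\<forall>i<a. \<forall>j<(b::nat). P (i * b + j))"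
proof safe
  fix i j assume "\<forall>c<a * b. P c" "i < a" "j < b"
  then show "P (i * b + j)" using nested_index_less by blast
next
  fix c assume P: "\<forall>i<a. \<forall>j<b. P (i * b + j)" and c: "c < a * b"
  then have "0 < b" by (cases b) auto
  then have "c div b < a" "c mod b < b" using c by (simp_all add: less_mult_imp_div_less)
  then have "P (c div b * b + c mod b)" using P by blast
  then show "P c" by simp
qed

type_synonym literal = "nat \<times> nat \<times> nat \<times> nat \<times> nat"

text \<open>A literal \<open>(i, dt, dp, l, s)\<close> of a constraint at cell \<open>(t, p)\<close> stands for the local variable \<open>l\<close> of
  cell \<open>(t + dt, p + dp)\<close> if \<open>i = 1\<close>, and for variable 0, the constant True, if \<open>i = 0\<close>;
  it is negated if \<open>s = 1\<close>.\<close>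

locale tiling =
  fixes m :: nat and A H U :: "nat \<Rightarrow> nat \<Rightarrow> bool"
begin

abbreviation top :: literal where "top \<equiv> (0, 0, 0, 0, 0)"
abbreviation bot :: literal where "bot \<equiv> (0, 0, 0, 0, 1)"
abbreviation pos :: "nat \<Rightarrow> literal" where "pos l \<equiv> (1, 0, 0, l, 0)"
abbreviation neg :: "nat \<Rightarrow> literal" where "neg l \<equiv> (1, 0, 0, l, 1)"

text \<open>This counts the local variables of a cell and also its constraints, which lets an
  exclusion constraint \<open>q\<close> use local variable \<open>q\<close> as its slack.\<close>

definition Q :: nat where "Q = 2 + 2 * m + 2 * (m * m)"

text \<open>Local variable \<open>1 + a\<close> says that the tile is \<open>a\<close>, variable \<open>1 + m + i\<close> that the tile is less than
  \<open>i\<close>. The variables from \<open>2 + 2 * m\<close> on are slack variables for the exclusion of pairs of tiles.\<close>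

definition template :: "nat \<Rightarrow> nat \<Rightarrow> literal list" where
  "template k q =
    (if q < m then [top, pos (1 + m + q), pos (1 + q), neg (2 + m + q)]
     else if q = m then [top, top, pos (1 + m), pos (1 + m)]
     else if q = m + 1 then [top, top, neg (1 + m + m), neg (1 + m + m)]
     else if q < 2 + 2 * m then
       (let a = q - (2 + m) in if A k a then [top, top, bot, bot] else [top, top, pos (1 + a), pos (1 + a)])
     else if q < 2 + 2 * m + m * m then
       (let a = (q - (2 + 2 * m)) div m; b = (q - (2 + 2 * m)) mod m in
        if H a b then [top, top, bot, bot] else [top, pos (1 + a), (1, 0, 1, 1 + b, 0), pos q])
     else
       (let a = (q - (2 + 2 * m + m * m)) div m; b = (q - (2 + 2 * m + m * m)) mod m in
        if U a b then [top, top, bot, bot] else [top, pos (1 + a), (1, 1, 0, 1 + b, 0), pos q]))"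

lemma length_template: "length (template k q) = 4"
  by (simp add: template_def Let_def)

lemma template_local:
  "q < Q \<Longrightarrow> r < 4 \<Longrightarrow> template k q ! r = (i, d, e, l, s) \<Longrightarrow> i \<le> 1 \<and> d \<le> 1 \<and> e \<le> 1 \<and> l < Q \<and> s \<le> 1"
proof -
  assume q: "q < Q" and r: "r < 4" and t: "template k q ! r = (i, d, e, l, s)"
  have "(i, d, e, l, s) \<in> set (template k q)"
    using r t length_template nth_mem by metis
  moreover
  consider "q < m" | "q = m" | "q = m + 1" | "m + 1 < q" "q < 2 + 2 * m"
    | "2 + 2 * m \<le> q" "q < 2 + 2 * m + m * m" | "2 + 2 * m + m * m \<le> q"
    by linarith
  then have "\<forall>(i, d, e, l, s) \<in> set (template k q). i \<le> 1 \<and> d \<le> 1 \<and> e \<le> 1 \<and> l < Q \<and> s \<le> 1"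
  proof cases
    case 4
    then have "q - (2 + m) < m" by simp
    then show ?thesis using 4 by (simp add: template_def Let_def Q_def del: diff_diff_left)
  next
    case 5
    let ?x = "q - (2 + 2 * m)"
    have "?x div m < m" using 5 by (intro less_mult_imp_div_less) auto
    moreover from this have "?x mod m < m" by (intro mod_less_divisor) auto
    ultimately obtain a b where "?x div m = a" "?x mod m = b" "a < m" "b < m" by blast
    then show ?thesis using 5 by (simp add: template_def Let_def Q_def)
  next
    case 6
    let ?x = "q - (2 + 2 * m + m * m)"
    have "?x div m < m" using 6 q by (intro less_mult_imp_div_less) (auto simp add: Q_def)
    moreover from this have "?x mod m < m" by (intro mod_less_divisor) auto
    ultimately obtain a b where "?x div m = a" "?x mod m = b" "a < m" "b < m" by blast
    then show ?thesis using 6 q by (simp add: template_def Let_def Q_def)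
  qed (simp_all add: template_def Let_def Q_def)
  ultimately show ?thesis by fast
qed

lemma all_template:
  "(\<forall>q<Q. P q) \<longleftrightarrow> (\<forall>i<m. P i) \<and> P m \<and> P (m + 1) \<and> (\<forall>a<m. P (2 + m + a)) \<and>
    (\<forall>a<m. \<forall>b<m. P (2 + 2 * m + (a * m + b))) \<and> (\<forall>a<m. \<forall>b<m. P (2 + 2 * m + m * m + (a * m + b)))"
proof -
  have "(\<forall>q<Q. P q) \<longleftrightarrow> (\<forall>i<m. P i) \<and> P m \<and> P (m + 1) \<and> (\<forall>a<m. P (2 + m + a)) \<and>
    (\<forall>a<m * m. P (2 + 2 * m + a)) \<and> (\<forall>a<m * m. P (2 + 2 * m + m * m + a))" (is "_ \<longleftrightarrow> ?R")
  proof
    assume ?R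
    show "\<forall>q<Q. P q"
    proof (intro allI impI)
      fix q assume q: "q < Q"
      consider "q < m" | "q = m" | "q = m + 1" | "2 + m \<le> q" "q < 2 + 2 * m"
        | "2 + 2 * m \<le> q" "q < 2 + 2 * m + m * m" | "2 + 2 * m + m * m \<le> q"
        by linarith
      then show "P q"
      proof cases
        case 4
        then have "q - (2 + m) < m" "q = 2 + m + (q - (2 + m))" by auto
        then show ?thesis using \<open>?R\<close> by metis
      next
        case 5
        then have "q - (2 + 2 * m) < m * m" "q = 2 + 2 * m + (q - (2 + 2 * m))" by auto
        then show ?thesis using \<open>?R\<close> by metis
      next
        case 6
        then have "q - (2 + 2 * m + m * m) < m * m" "q = 2 + 2 * m + m * m + (q - (2 + 2 * m + m * m))"
          using q by (auto simp add: Q_def)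
        then show ?thesis using \<open>?R\<close> by metis
      qed (use \<open>?R\<close> in auto)
    qed
  qed (auto simp add: Q_def)
  then show ?thesis unfolding all_less_mult .
qed

text \<open>With \<open>top\<close> true, \<open>[top, top, x, x]\<close> forbids \<open>x\<close>
  and \<open>[top, top, bot, bot]\<close> always holds. In \<open>[top, x, y, s]\<close> the slack
  \<open>s\<close> occurs in no other constraint, so the effect is that \<open>x\<close> and
  \<open>y\<close> are not both true. The constraints \<open>i < m\<close> form a ladder: exactly
  one of "less than i", "equal to i" and "greater than i" holds for the tile.\<close>

lemma template_simps:
  "i < m \<Longrightarrow> template k i = [top, pos (1 + m + i), pos (1 + i), neg (2 + m + i)]"
  "template k m = [top, top, pos (1 + m), pos (1 + m)]"
  "template k (m + 1) = [top, top, neg (1 + m + m), neg (1 + m + m)]"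
  "a < m \<Longrightarrow> template k (2 + m + a) =
     (if A k a then [top, top, bot, bot] else [top, top, pos (1 + a), pos (1 + a)])"
  "a < m \<Longrightarrow> b < m \<Longrightarrow> template k (2 + 2 * m + (a * m + b)) =
     (if H a b then [top, top, bot, bot]
      else [top, pos (1 + a), (1, 0, 1, 1 + b, 0), pos (2 + 2 * m + (a * m + b))])"
  "a < m \<Longrightarrow> b < m \<Longrightarrow> template k (2 + 2 * m + m * m + (a * m + b)) =
     (if U a b then [top, top, bot, bot]
      else [top, pos (1 + a), (1, 1, 0, 1 + b, 0), pos (2 + 2 * m + m * m + (a * m + b))])"
proof -
  assume ab: "a < m" "b < m"
  have "a * m + b < Suc a * m" using ab by simp
  also have "\<dots> \<le> m * m" using ab by (intro mult_right_mono) auto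
  finally have "a * m + b < m * m" .
  then show "template k (2 + 2 * m + (a * m + b)) =
     (if H a b then [top, top, bot, bot]
      else [top, pos (1 + a), (1, 0, 1, 1 + b, 0), pos (2 + 2 * m + (a * m + b))])"
    using ab by (simp add: template_def Let_def)
  show "template k (2 + 2 * m + m * m + (a * m + b)) =
     (if U a b then [top, top, bot, bot]
      else [top, pos (1 + a), (1, 1, 0, 1 + b, 0), pos (2 + 2 * m + m * m + (a * m + b))])"
    using ab by (simp add: template_def Let_def)
qed (simp_all add: template_def Let_def)

end

text \<open>The position of a cell influences its constraints only through \<open>kind\<close>. If
  the kinds are bounded, the templates form a finite table however large the rectangle is.\<close>

locale tiling_instance = tiling +
  fixes T W :: nat and kind :: "nat \<Rightarrow> nat \<Rightarrow> nat"
  assumes pos_TW: "0 < T" "0 < W"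
begin

definition tiles :: "(nat \<Rightarrow> nat \<Rightarrow> nat) \<Rightarrow> bool" where
  "tiles f \<longleftrightarrow> (\<forall>t<T. \<forall>p<W. f t p < m \<and> A (kind t p) (f t p) \<and>
     (p + 1 < W \<longrightarrow> H (f t p) (f t (p + 1))) \<and> (t + 1 < T \<longrightarrow> U (f t p) (f (t + 1) p)))"

text \<open>The factor \<open>i\<close> sends constants to variable 0, the otherwise unoccupied
  local variable 0 of cell (0, 0). Rows of length \<open>W + 1\<close> provide variables for cells
  just outside the rectangle, so border cells need no templates of their own.\<close>

definition var :: "nat \<Rightarrow> nat \<Rightarrow> literal \<Rightarrow> nat" where
  "var t p = (\<lambda>(i, d, e, l, s). i * (((t + d) * (W + 1) + (p + e)) * Q + l))"

definition literal_at :: "nat \<Rightarrow> nat \<Rightarrow> nat \<Rightarrow> nat \<Rightarrow> literal" where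
  "literal_at t p q r = template (kind t p) q ! r"

definition lv :: "nat \<Rightarrow> nat" where
  "lv e = (let c = e div 4; t = c div Q div W; p = c div Q mod W in
     var t p (literal_at t p (c mod Q) (e mod 4)))"

definition ls :: "nat \<Rightarrow> nat" where
  "ls e = (let c = e div 4; t = c div Q div W; p = c div Q mod W in
     snd (snd (snd (snd (literal_at t p (c mod Q) (e mod 4))))))"

definition nv :: nat where "nv = (T + 1) * (W + 1) * Q"
definition nc :: nat where "nc = T * W * Q"

lemma Q_pos: "0 < Q" by (simp add: Q_def)

lemma lv_ls_at:
  assumes "p < W" "q < Q" "r < 4"
  shows "lv (4 * ((t * W + p) * Q + q) + r) = var t p (literal_at t p q r)"
    "ls (4 * ((t * W + p) * Q + q) + r) = snd (snd (snd (snd (literal_at t p q r))))"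
proof -
  have 1: "(4 * c + r) div 4 = c" "(4 * c + r) mod 4 = r" for c using assms by simp_all
  have 2: "((t * W + p) * Q + q) div Q = t * W + p" "((t * W + p) * Q + q) mod Q = q"
    using assms by simp_all
  have 3: "(t * W + p) div W = t" "(t * W + p) mod W = p" using assms by simp_all
  show "lv (4 * ((t * W + p) * Q + q) + r) = var t p (literal_at t p q r)"
    "ls (4 * ((t * W + p) * Q + q) + r) = snd (snd (snd (snd (literal_at t p q r))))"
    unfolding lv_def ls_def Let_def 1 2 3 by (rule refl)+
qed

lemma formula: "formula nv nc lv ls"
proof
  show "0 < nc" using pos_TW Q_pos by (simp add: nc_def)
  show "lv e < nv" if e: "e < 4 * nc" for e
  proof -
    let ?c = "e div 4"
    let ?t = "?c div Q div W" and ?p = "?c div Q mod W"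
    have "?c < nc" using e by linarith
    then have "?c div Q < T * W" unfolding nc_def by (rule less_mult_imp_div_less)
    then have t: "?t < T" by (rule less_mult_imp_div_less)
    have p: "?p < W" using pos_TW by simp
    obtain i d f l s where l: "literal_at ?t ?p (?c mod Q) (e mod 4) = (i, d, f, l, s)" by (metis surj_pair)
    have "e mod 4 < 4" by simp
    then have b: "i \<le> 1" "d \<le> 1" "f \<le> 1" "l < Q"
      using template_local[OF mod_less_divisor[OF Q_pos] _ l[unfolded literal_at_def]] by blast+
    have "(?t + d) * (W + 1) + (?p + f) < (T + 1) * (W + 1)"
      by (rule nested_index_less) (use t p b in auto)
    then have "((?t + d) * (W + 1) + (?p + f)) * Q + l < nv"
      unfolding nv_def by (rule nested_index_less) (use b in auto)
    moreover have "lv e = i * (((?t + d) * (W + 1) + (?p + f)) * Q + l)"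
      by (simp add: lv_def Let_def l var_def)
    moreover have "i = 0 \<or> i = 1" using b by auto
    ultimately show ?thesis by auto
  qed
  show "ls e < 2" for e
  proof -
    let ?c = "e div 4"
    let ?t = "?c div Q div W" and ?p = "?c div Q mod W"
    obtain i d f l s where l: "literal_at ?t ?p (?c mod Q) (e mod 4) = (i, d, f, l, s)" by (metis surj_pair)
    have "e mod 4 < 4" by simp
    then have "s \<le> 1"
      using template_local[OF mod_less_divisor[OF Q_pos] _ l[unfolded literal_at_def]] by blast
    then show ?thesis by (simp add: ls_def Let_def l)
  qed
qed

definition truth :: "(nat \<Rightarrow> bool) \<Rightarrow> nat \<Rightarrow> nat \<Rightarrow> literal \<Rightarrow> bool" where
  "truth v t p x \<longleftrightarrow> v (var t p x) \<noteq> odd (snd (snd (snd (snd x))))"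

definition two_true :: "bool list \<Rightarrow> bool" where
  "two_true bs \<longleftrightarrow> (\<Sum>r<4. of_bool (bs ! r)) = (2::nat)"

lemma two_true_iff: "two_true [a, b, c, d] \<longleftrightarrow>
    of_bool a + of_bool b + of_bool c + of_bool d = (2::nat)"
  by (simp add: two_true_def eval_nat_numeral del: sum_of_bool_eq)

lemma satisfies_iff: "formula.satisfies nc lv ls v \<longleftrightarrow>
  (\<forall>t<T. \<forall>p<W. \<forall>q<Q. two_true (map (truth v t p) (template (kind t p) q)))"
proof -
  interpret formula nv nc lv ls by (rule formula)
  have s: "(\<Sum>r<4. of_bool (v (lv (4 * ((t * W + p) * Q + q) + r)) \<noteq> odd (ls (4 * ((t * W + p) * Q + q) + r)))) =
      (\<Sum>r<4. of_bool (map (truth v t p) (template (kind t p) q) ! r) :: nat)"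
    if "p < W" "q < Q" for t p q
    by (rule sum.cong)
      (use that in \<open>simp_all only: lessThan_iff lv_ls_at truth_def literal_at_def nth_map length_template\<close>)
  show ?thesis
    unfolding satisfies_def unfolding nc_def all_less_mult two_true_def
    by (intro all_cong) (simp only: s)
qed

text \<open>Two true literals among four leave two false ones. Hence variable 0 may be assumed to be
  true, as its role as a constant requires.\<close>

lemma satisfies_complement:
  assumes "formula.satisfies nc lv ls v" shows "formula.satisfies nc lv ls (\<lambda>x. \<not> v x)"
proof -
  interpret formula nv nc lv ls by (rule formula)
  have *: "(\<Sum>r<4. of_bool (\<not> P r)) = (2::nat)" if "(\<Sum>r<4. of_bool (P r)) = (2::nat)" for P :: "nat \<Rightarrow> bool"
  proof -
    have "(\<Sum>r<4. of_bool (P r)) + (\<Sum>r<4. of_bool (\<not> P r)) = (\<Sum>r<(4::nat). 1::nat)"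
      unfolding sum.distrib[symmetric] by (rule sum.cong) auto
    moreover have "(\<Sum>r<(4::nat). 1::nat) = 4" by simp
    ultimately show ?thesis using that by linarith
  qed
  show ?thesis unfolding satisfies_def
  proof (intro allI impI)
    fix c assume c: "c < nc"
    have "(\<Sum>r<4. of_bool ((\<not> v (lv (4 * c + r))) \<noteq> odd (ls (4 * c + r)))) =
        (\<Sum>r<4. of_bool (\<not> (v (lv (4 * c + r)) \<noteq> odd (ls (4 * c + r)))) :: nat)"
      by (rule sum.cong) auto
    with *[OF assms[unfolded satisfies_def, rule_format, OF c]]
    show "(\<Sum>r<4. of_bool ((\<not> v (lv (4 * c + r))) \<noteq> odd (ls (4 * c + r)))) = (2::nat)" by (rule trans[rotated])
  qed
qed

lemma satisfies_tiling:
  assumes "formula.satisfies nc lv ls v" "v 0"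
  shows "\<exists>f. tiles f"
proof -
  define u where "u = (\<lambda>t p l. v ((t * (W + 1) + p) * Q + l))"
  have val: "truth v t p top" "\<not> truth v t p bot" "truth v t p (pos l) = u t p l"
    "truth v t p (neg l) = (\<not> u t p l)"
    "truth v t p (1, 0, 1, l, 0) = u t (p + 1) l" "truth v t p (1, 1, 0, l, 0) = u (t + 1) p l" for t p l
    using assms(2) by (auto simp add: truth_def var_def u_def add.assoc)
  note val = val val[unfolded One_nat_def]
  have c: "two_true (map (truth v t p) (template (kind t p) q))" if "t < T" "p < W" "q < Q" for t p q
    using assms(1) that unfolding satisfies_iff by blast
  \<comment> \<open>If no tile variable of the cell were true, the ladder would carry falsity of the
    order variables from 0 up to \<open>m\<close>, where truth is demanded.\<close>
  have ex: "\<exists>a<m. u t p (1 + a)" if tp: "t < T" "p < W" for t p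
  proof (rule ccontr)
    assume no: "\<not> (\<exists>a<m. u t p (1 + a))"
    have q: "\<forall>q<Q. two_true (map (truth v t p) (template (kind t p) q))" using c tp by blast
    note q = q[unfolded all_template]
    have z0: "\<not> u t p (1 + m)" and zm: "u t p (1 + m + m)"
      using q by (auto simp add: template_simps val two_true_iff simp del: One_nat_def split: if_splits)
    have "i \<le> m \<Longrightarrow> \<not> u t p (1 + m + i)" for i
    proof (induction i)
      case (Suc i)
      then have i: "i < m" by simp
      have "two_true (map (truth v t p) (template (kind t p) i))" using q i by blast
      then show ?case using Suc no i
        by (auto simp add: template_simps val two_true_iff split: if_splits)
    qed (use z0 in simp)
    then show False using zm by blast
  qed
  define f where "f = (\<lambda>t p. SOME a. a < m \<and> u t p (1 + a))"
  have f: "f t p < m" "u t p (1 + f t p)" if "t < T" "p < W" for t p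
    using someI_ex[OF ex[OF that]] by (auto simp add: f_def)
  have "tiles f"
    unfolding tiles_def
  proof (intro allI impI conjI)
    fix t p assume tp: "t < T" "p < W"
    have q: "\<forall>q<Q. two_true (map (truth v t p) (template (kind t p) q))" using c tp by blast
    note q = q[unfolded all_template]
    show "f t p < m" using f tp by blast
    have "two_true (map (truth v t p) (template (kind t p) (2 + m + f t p)))" using q f(1)[OF tp] by blast
    from this[unfolded template_simps(4)[OF f(1)[OF tp]]]
    show "A (kind t p) (f t p)" using f[OF tp]
      by (auto simp add: val two_true_iff simp del: One_nat_def split: if_splits)
    show "H (f t p) (f t (p + 1))" if p: "p + 1 < W"
    proof -
      have "two_true (map (truth v t p) (template (kind t p) (2 + 2 * m + (f t p * m + f t (p + 1)))))"
        using q f(1)[OF tp] f(1)[OF tp(1) p] by blast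
      from this[unfolded template_simps(5)[OF f(1)[OF tp] f(1)[OF tp(1) p]]]
      show ?thesis using f[OF tp] f[OF tp(1) p]
        by (auto simp add: val two_true_iff simp del: One_nat_def split: if_splits)
    qed
    show "U (f t p) (f (t + 1) p)" if t: "t + 1 < T"
    proof -
      have "two_true (map (truth v t p) (template (kind t p) (2 + 2 * m + m * m + (f t p * m + f (t + 1) p))))"
        using q f(1)[OF tp] f(1)[OF t tp(2)] by blast
      from this[unfolded template_simps(6)[OF f(1)[OF tp] f(1)[OF t tp(2)]]]
      show ?thesis using f[OF tp] f[OF t tp(2)]
        by (auto simp add: val two_true_iff simp del: One_nat_def split: if_splits)
    qed
  qed
  then show ?thesis by blast
qed

text \<open>Tile variables are false outside the rectangle, which takes care of exclusions across
  the border. A slack is true iff neither of its two tiles is present.\<close>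

lemma tiling_satisfies:
  assumes f: "tiles f"
  shows "\<exists>v. formula.satisfies nc lv ls v"
proof -
  define tile where "tile = (\<lambda>t p a. t < T \<and> p < W \<and> f t p = a)"
  define u where "u = (\<lambda>t p l.
    if l = 0 then True
    else if l < 1 + m then tile t p (l - 1)
    else if l < 2 + 2 * m then f t p < l - (1 + m)
    else if l < 2 + 2 * m + m * m then
      \<not> tile t p ((l - (2 + 2 * m)) div m) \<and> \<not> tile t (p + 1) ((l - (2 + 2 * m)) mod m)
    else \<not> tile t p ((l - (2 + 2 * m + m * m)) div m) \<and>
      \<not> tile (t + 1) p ((l - (2 + 2 * m + m * m)) mod m))"
  define v where "v = (\<lambda>x. u (x div Q div (W + 1)) (x div Q mod (W + 1)) (x mod Q))"
  have vu: "v ((t * (W + 1) + p) * Q + l) = u t p l" if "p \<le> W" "l < Q" for t p l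
  proof -
    have "((t * (W + 1) + p) * Q + l) div Q = t * (W + 1) + p" "((t * (W + 1) + p) * Q + l) mod Q = l"
      using that by auto
    moreover have "(t * (W + 1) + p) div (W + 1) = t" "(t * (W + 1) + p) mod (W + 1) = p"
      using that div_mult_self3[of "W + 1" p t] by (simp_all del: mult_Suc_right mult_Suc)
    ultimately show ?thesis unfolding v_def by simp
  qed
  have v0: "v 0" using vu[of 0 0 0] Q_pos by (simp add: u_def)
  have val: "truth v t p top" "\<not> truth v t p bot"
    "l < Q \<Longrightarrow> truth v t p (pos l) = u t p l" "l < Q \<Longrightarrow> truth v t p (neg l) = (\<not> u t p l)"
    "l < Q \<Longrightarrow> truth v t p (1, 0, 1, l, 0) = u t (p + 1) l"
    "l < Q \<Longrightarrow> truth v t p (1, 1, 0, l, 0) = u (t + 1) p l" if "p < W" for t p l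
    using v0 vu[of p l] vu[of "p + 1" l] that by (auto simp add: truth_def var_def simp del: add_Suc_right)
  have us: "a < m \<Longrightarrow> u t p (1 + a) = tile t p a" "i \<le> m \<Longrightarrow> u t p (1 + m + i) = (f t p < i)"
    "a < m \<Longrightarrow> b < m \<Longrightarrow> u t p (2 + 2 * m + (a * m + b)) = (\<not> tile t p a \<and> \<not> tile t (p + 1) b)"
    "a < m \<Longrightarrow> b < m \<Longrightarrow> u t p (2 + 2 * m + m * m + (a * m + b)) = (\<not> tile t p a \<and> \<not> tile (t + 1) p b)"
    for t p a b i
    using nested_index_less[of a m b m] by (auto simp add: u_def)
  have lQ: "a < m \<Longrightarrow> 1 + a < Q" "i \<le> m \<Longrightarrow> 1 + m + i < Q" "i < m \<Longrightarrow> 2 + m + i < Q"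
    "a < m \<Longrightarrow> b < m \<Longrightarrow> 2 + 2 * m + (a * m + b) < Q"
    "a < m \<Longrightarrow> b < m \<Longrightarrow> 2 + 2 * m + m * m + (a * m + b) < Q" for a b i
    using nested_index_less[of a m b m] by (auto simp add: Q_def)
  have "formula.satisfies nc lv ls v"
    unfolding satisfies_iff all_template
  proof (intro allI impI conjI)
    fix t p assume tp: "t < T" "p < W"
    have F: "f t p < m" "A (kind t p) (f t p)" "p + 1 < W \<Longrightarrow> H (f t p) (f t (p + 1))"
      "t + 1 < T \<Longrightarrow> U (f t p) (f (t + 1) p)"
      using f tp unfolding tiles_def by blast+
    let ?ok = "\<lambda>q. two_true (map (truth v t p) (template (kind t p) q))"
    have ti: "tile t p a = (f t p = a)" for a using tp by (simp add: tile_def)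
    show "?ok i" if "i < m" for i
    proof -
      have "u t p (Suc (Suc (m + i))) = (f t p < Suc i)" using us(2)[of "Suc i" t p] that by simp
      then show ?thesis using that
        by (simp only: template_simps list.map val[OF tp(2)] lQ us two_true_iff ti less_imp_le) auto
    qed
    show "?ok m"
    proof -
      have "1 + m < Q" "u t p (1 + m) = False" using lQ(2)[of 0] us(2)[of 0 t p] by simp_all
      then show ?thesis by (simp only: template_simps list.map val[OF tp(2)] two_true_iff) simp
    qed
    show "?ok (m + 1)"
      by (simp only: template_simps list.map val[OF tp(2)] lQ us two_true_iff le_refl F(1)) simp
    show "?ok (2 + m + a)" if "a < m" for a
      using that F(2) by (cases "A (kind t p) a")
        (simp_all only: template_simps list.map val[OF tp(2)] lQ us two_true_iff ti if_True if_False, auto)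
    show "?ok (2 + 2 * m + (a * m + b))" if "a < m" "b < m" for a b
      using that F(3) by (cases "H a b")
        (simp_all only: template_simps list.map val[OF tp(2)] lQ us two_true_iff if_True if_False, auto simp add: tile_def)
    show "?ok (2 + 2 * m + m * m + (a * m + b))" if "a < m" "b < m" for a b
      using that F(4) by (cases "U a b")
        (simp_all only: template_simps list.map val[OF tp(2)] lQ us two_true_iff if_True if_False, auto simp add: tile_def)
  qed
  then show ?thesis by blast
qed

theorem satisfiable_iff: "(\<exists>v. formula.satisfies nc lv ls v) \<longleftrightarrow> (\<exists>f. tiles f)"
proof
  assume "\<exists>v. formula.satisfies nc lv ls v"
  then obtain v where v: "formula.satisfies nc lv ls v" by blast
  show "\<exists>f. tiles f"
    using satisfies_tiling[OF v] satisfies_tiling[OF satisfies_complement[OF v]] by blast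
qed (use tiling_satisfies in blast)

end

section \<open>From Turing machine runs to tilings\<close>

type_synonym sym = "bool \<times> nat \<times> nat list"
type_synonym tile = "sym \<times> sym \<times> sym \<times> sym"

text \<open>In a tiling the certificate is subject to local conditions only: bounded symbols, and no
  symbol after a blank. They suffice for the first row to spell a word.\<close>

lemma word_cells_exists:
  fixes g :: "nat \<Rightarrow> nat"
  assumes "\<And>i. i < P \<Longrightarrow> g i \<le> 2 \<and> (g i = 0 \<longrightarrow> g (Suc i) = 0)" "\<And>i. P \<le> i \<Longrightarrow> g i = 0"
  shows "\<exists>y. length y \<le> P \<and> (\<forall>i. word_cells y (int i) = g i)"
  using assms
proof (induction P arbitrary: g)
  case 0
  then show ?case by (intro exI[of _ "[]"]) (auto simp add: word_cells_def)
next
  case (Suc P)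
  show ?case
  proof (cases "g 0 = 0")
    case True
    note g = Suc.prems
    have "g i = 0" for i
    proof (induction i)
      case (Suc i)
      then show ?case using g(1)[of i] g(2)[of "Suc i"] by (cases "i < Suc P") auto
    qed (rule True)
    then show ?thesis by (intro exI[of _ "[]"]) (auto simp add: word_cells_def)
  next
    case False
    obtain y where y: "length y \<le> P" "\<And>i. word_cells y (int i) = g (Suc i)"
      using Suc.IH[of "\<lambda>i. g (Suc i)"] Suc.prems by auto
    have "word_cells ((g 0 = 2) # y) (int i) = g i" for i
    proof (cases i)
      case 0
      then show ?thesis using Suc.prems(1)[of 0] False by (auto simp add: word_cells_def)
    next
      case (Suc j)
      moreover have "nat (1 + int j) = Suc j" by simp
      ultimately show ?thesis using y(2)[of j] by (cases "j < length y") (auto simp add: word_cells_def)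
    qed
    then show ?thesis using y(1) by (intro exI[of _ "(g 0 = 2) # y"]) auto
  qed
qed

text \<open>The tape symbols at distance \<open>d\<close> from the respective heads. All cells of a row of the tiling know
  the state; the flag marks the cells under the heads.\<close>

fun view :: "config \<Rightarrow> int \<Rightarrow> sym" where
  "view (q, ts) d = (d = 0, q, map (\<lambda>(p, c). c (p + d)) ts)"

locale machine_run =
  fixes M :: tm
  assumes wf: "wf_tm M"
begin

definition wf_config :: "config \<Rightarrow> bool" where
  "wf_config C \<longleftrightarrow> fst C < tm_states M \<and> length (snd C) = tm_tapes M \<and>
     (\<forall>(p, c) \<in> set (snd C). \<forall>i. c i < tm_symbols M)"

definition syms :: "sym set" where
  "syms = UNIV \<times> {..<tm_states M} \<times> {ss. set ss \<subseteq> {..<tm_symbols M} \<and> length ss = tm_tapes M}"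

text \<open>If a head makes the move \<open>v\<close>, then the cell at distance \<open>d\<close> was at distance \<open>d + offset v\<close> before;
  it is the cell just written iff it carries the flag.\<close>

definition local_rule :: "sym \<Rightarrow> sym \<Rightarrow> sym \<Rightarrow> sym \<Rightarrow> sym" where
  "local_rule g l c r = (case g of (b, q, ss) \<Rightarrow>
     if q \<in> {accept_state, reject_state} then c
     else case tm_delta M q ss of (q', as) \<Rightarrow>
       (fst c, q', map (\<lambda>i. case as ! i of (s, v) \<Rightarrow>
          let x = (case v of Left \<Rightarrow> l | Stay \<Rightarrow> c | Right \<Rightarrow> r) in if fst x then s else snd (snd x) ! i)
        [0..<tm_tapes M]))"

lemma finite_syms: "finite syms"
  unfolding syms_def by (intro finite_cartesian_product finite_lists_length_eq) auto

lemma view_syms: "wf_config C \<Longrightarrow> view C d \<in> syms"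
  by (cases C) (fastforce simp add: wf_config_def syms_def)

lemma delta_wf:
  assumes "wf_config (q, ts)" "q \<notin> {accept_state, reject_state}" "tm_delta M q (map read_tape ts) = (q', as)"
  shows "q' < tm_states M" "length as = tm_tapes M" "fst ` set as \<subseteq> {..<tm_symbols M}"
proof -
  have "set (map read_tape ts) \<subseteq> {..<tm_symbols M}" using assms(1) by (fastforce simp add: wf_config_def)
  then have "case tm_delta M q (map read_tape ts) of (q', as) \<Rightarrow>
           q' < tm_states M \<and> length as = tm_tapes M \<and> fst ` set as \<subseteq> {..<tm_symbols M}"
    using wf assms(1,2) unfolding wf_tm_def wf_config_def by simp
  then show "q' < tm_states M" "length as = tm_tapes M" "fst ` set as \<subseteq> {..<tm_symbols M}"
    using assms(3) by auto
qed

lemma wf_config_step: "wf_config C \<Longrightarrow> wf_config (tm_step M C)"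
proof -
  assume C: "wf_config C"
  obtain q ts where qts: "C = (q, ts)" by (cases C)
  show ?thesis
  proof (cases "q \<in> {accept_state, reject_state}")
    case False
    obtain q' as where d: "tm_delta M q (map read_tape ts) = (q', as)" by (metis surj_pair)
    note w = delta_wf[OF C[unfolded qts] False d]
    have "c i < tm_symbols M" if pc: "(p, c) \<in> set (map2 act_tape as ts)" for p c i
    proof -
      obtain a w where aw: "(a, w) \<in> set (zip as ts)" "(p, c) = act_tape a w"
        using pc by auto
      moreover obtain s v p0 c0 where "a = (s, v)" "w = (p0, c0)" by (metis surj_pair)
      ultimately have sv: "((s, v), (p0, c0)) \<in> set (zip as ts)" "(p, c) = act_tape (s, v) (p0, c0)" by auto
      then have "(s, v) \<in> set as" "(p0, c0) \<in> set ts" by (auto dest: set_zip_leftD set_zip_rightD)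
      then have "s < tm_symbols M" "c0 i < tm_symbols M"
        using w(3) C unfolding qts wf_config_def by force+
      then show ?thesis using sv(2) by auto
    qed
    then have "\<forall>(p, c) \<in> set (map2 act_tape as ts). \<forall>i. c i < tm_symbols M" by blast
    moreover have "tm_step M C = (q', map2 act_tape as ts)" using False qts d by simp
    moreover have "length (map2 act_tape as ts) = tm_tapes M" using w(2) C qts by (simp add: wf_config_def)
    ultimately show ?thesis using w(1) unfolding wf_config_def by (simp only: fst_conv snd_conv)
  qed (use C qts in auto)
qed

lemma view_step:
  assumes C: "wf_config C"
  shows "view (tm_step M C) d = local_rule (view C 0) (view C (d - 1)) (view C d) (view C (d + 1))"
proof -
  obtain q ts where qts: "C = (q, ts)" by (cases C)
  show ?thesis
  proof (cases "q \<in> {accept_state, reject_state}")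
    case False
    have reads: "map (\<lambda>(p, c). c (p + 0)) ts = map read_tape ts" by auto
    obtain q' as where del: "tm_delta M q (map read_tape ts) = (q', as)" by (metis surj_pair)
    note w = delta_wf[OF C[unfolded qts] False del]
    have k: "length ts = tm_tapes M" using C qts by (simp add: wf_config_def)
    have "map (\<lambda>(p, c). c (p + d)) (map2 act_tape as ts) =
      map (\<lambda>i. case as ! i of (s, v) \<Rightarrow>
          let x = (case v of Left \<Rightarrow> view C (d - 1) | Stay \<Rightarrow> view C d | Right \<Rightarrow> view C (d + 1))
          in if fst x then s else snd (snd x) ! i) [0..<tm_tapes M]" (is "?l = ?r")
    proof (rule nth_equalityI)
      fix i assume "i < length ?l"
      then have i: "i < tm_tapes M" using k by simp
      obtain s v where sv: "as ! i = (s, v)" by (cases "as ! i")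
      obtain p c where pc: "ts ! i = (p, c)" by (cases "ts ! i")
      have "?l ! i = (c(p := s)) (p + offset v + d)" using i k w(2) sv pc by simp
      also have "\<dots> = ?r ! i"
        using i k sv pc qts by (cases v) (auto simp add: algebra_simps)
      finally show "?l ! i = ?r ! i" .
    qed (use k w(2) in simp)
    moreover have "view C 0 = (True, q, map read_tape ts)" using qts reads by simp
    ultimately have "local_rule (view C 0) (view C (d - 1)) (view C d) (view C (d + 1)) =
        (fst (view C d), q', map (\<lambda>(p, c). c (p + d)) (map2 act_tape as ts))"
      unfolding local_rule_def using False del by simp
    then show ?thesis using False del qts by simp
  qed (auto simp add: qts local_rule_def)
qed

text \<open>A tile consists of the symbol under the heads and of a cell between its two neighbours.\<close>

definition tile_set :: "tile set" where
  "tile_set = syms \<times> syms \<times> syms \<times> syms"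

text \<open>The certificate is guessed in the first row, where \<open>cert\<close> leaves tape 1
  free up to local conditions; the one on blanks can look to the right because the right neighbour
  is part of the tile. The \<open>centre\<close> clause ties the broadcast component to the symbols
  under the heads.\<close>

definition allowed :: "bool \<Rightarrow> bool \<Rightarrow> bool \<Rightarrow> bool \<Rightarrow> nat \<Rightarrow> tile \<Rightarrow> bool" where
  "allowed centre first cert final a x = (case x of (g, l, (b, q, ss), (b', q', ss')) \<Rightarrow>
     (centre \<longrightarrow> g = (b, q, ss)) \<and>
     (first \<longrightarrow> b = centre \<and> q = 0 \<and> ss ! 0 = a \<and> (\<forall>i. 2 \<le> i \<longrightarrow> i < tm_tapes M \<longrightarrow> ss ! i = 0) \<and>
       (if cert then ss ! 1 \<le> 2 \<and> (ss ! 1 = 0 \<longrightarrow> ss' ! 1 = 0) else ss ! 1 = 0)) \<and>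
     (final \<longrightarrow> q = accept_state))"

text \<open>The numbering is arbitrary, but it depends on the machine alone: the number of tiles is
  a constant of the reduction.\<close>

definition tile :: "nat \<Rightarrow> tile" where
  "tile = (SOME h. bij_betw h {0..<card tile_set} tile_set)"

definition A :: "nat \<Rightarrow> nat \<Rightarrow> bool" where
  "A k a = allowed (odd k) (odd (k div 2)) (odd (k div 2 div 2)) (odd (k div 2 div 2 div 2))
     (k div 2 div 2 div 2 div 2) (tile a)"

definition H :: "nat \<Rightarrow> nat \<Rightarrow> bool" where
  "H a b = (case (tile a, tile b) of ((g, l, c, r), (g', l', c', r')) \<Rightarrow> g = g' \<and> l' = c \<and> r = c')"

definition U :: "nat \<Rightarrow> nat \<Rightarrow> bool" where
  "U a b = (case (tile a, tile b) of ((g, l, c, r), (g', l', c', r')) \<Rightarrow> c' = local_rule g l c r)"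

lemma tile_bij: "bij_betw tile {0..<card tile_set} tile_set"
proof -
  have "finite tile_set" unfolding tile_set_def by (intro finite_cartesian_product finite_syms)
  from someI_ex[OF ex_bij_betw_nat_finite[OF this]] show ?thesis unfolding tile_def .
qed

lemma tile_code: "x \<in> tile_set \<Longrightarrow> \<exists>a<card tile_set. tile a = x"
proof -
  assume "x \<in> tile_set"
  then have "x \<in> tile ` {0..<card tile_set}" using bij_betw_imp_surj_on[OF tile_bij] by simp
  then show ?thesis by auto
qed

text \<open>Column \<open>T + 1\<close> is the one under the heads. Four flags and an input symbol,
  at most 2, are packed into a number that is below 48 for every input.\<close>

definition kind :: "bool list \<Rightarrow> nat \<Rightarrow> nat \<Rightarrow> nat \<Rightarrow> nat \<Rightarrow> nat" where
  "kind x T P t p = of_bool (p = T + 1) + 2 * (of_bool (t = 0) + 2 * (of_bool (T + 1 \<le> p \<and> p < T + 1 + P) +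
     2 * (of_bool (t = T \<and> p = T + 1) + 2 * word_cells x (int p - int (T + 1)))))"

lemma A_kind: "A (kind x T P t p) a = allowed (p = T + 1) (t = 0) (T + 1 \<le> p \<and> p < T + 1 + P)
  (t = T \<and> p = T + 1) (word_cells x (int p - int (T + 1))) (tile a)"
proof -
  have "(of_bool b + 2 * z) div 2 = z" "odd (of_bool b + 2 * z) = b" for b and z :: nat by auto
  then show ?thesis unfolding A_def kind_def by (simp only:)
qed

lemma wf_config_start: "wf_config (tm_start M ws)"
  using wf by (auto simp add: wf_config_def tm_start_def wf_tm_def word_cells_def)

lemma wf_config_run: "wf_config (tm_run M ws t)"
  by (induction t) (simp_all add: tm_run_def wf_config_start wf_config_step)

lemma tm_run_Suc: "tm_run M ws (Suc t) = tm_step M (tm_run M ws t)"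
  by (simp add: tm_run_def)

lemma tapes_ge: "2 \<le> tm_tapes M" using wf by (simp add: wf_tm_def)

lemma view_start:
  "view (tm_start M [x, y]) d = (d = 0, 0, map (\<lambda>i. if i = 0 then word_cells x d
     else if i = 1 then word_cells y d else 0) [0..<tm_tapes M])"
  by (auto simp add: tm_start_def word_cells_def less_Suc_eq)

lemma tiling_of_run:
  assumes y: "length y \<le> P" and acc: "fst (tm_run M [x, y] T) = accept_state"
  shows "\<exists>f. tiling_instance.tiles (card tile_set) A H U (T + 1) (2 * T + 3) (kind x T P) f"
proof -
  interpret tiling_instance "card tile_set" A H U "T + 1" "2 * T + 3" "kind x T P"
    by standard auto
  let ?v = "\<lambda>t. view (tm_run M [x, y] t)"
  let ?tile = "\<lambda>t d. (?v t 0, ?v t (d - 1), ?v t d, ?v t (d + 1))"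
  have "?tile t d \<in> tile_set" for t d
    unfolding tile_set_def using view_syms[OF wf_config_run] by simp
  then have "\<exists>a<card tile_set. tile a = ?tile t d" for t d by (rule tile_code)
  then obtain code where code: "\<And>t d. code t d < card tile_set" "\<And>t d. tile (code t d) = ?tile t d"
    by metis
  let ?f = "\<lambda>t p. code t (int p - int (T + 1))"
  have "A (kind x T P t p) (?f t p)" for t p
  proof -
    let ?d = "int p - int (T + 1)"
    obtain q ts where C: "tm_run M [x, y] t = (q, ts)" by (metis surj_pair)
    have first: "?v 0 d = (d = 0, 0, map (\<lambda>i. if i = 0 then word_cells x d
     else if i = 1 then word_cells y d else 0) [0..<tm_tapes M])" for d
      using view_start by (simp add: tm_run_def)
    have d: "?d = 0 \<longleftrightarrow> p = T + 1" by auto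
    have last: "fst (snd (?v T 0)) = accept_state" using acc by (cases "tm_run M [x, y] T") simp
    have cert: "word_cells y ?d \<le> 2" "word_cells y ?d = 0 \<Longrightarrow> T + 1 \<le> p \<Longrightarrow> word_cells y (?d + 1) = 0"
      "\<not> (T + 1 \<le> p \<and> p < T + 1 + P) \<Longrightarrow> word_cells y ?d = 0"
      using y by (auto simp add: word_cells_def split: if_splits)
    obtain b c ss where c: "?v t ?d = (b, c, ss)" by (metis surj_pair)
    obtain b' c' ss' where r: "?v t (?d + 1) = (b', c', ss')" by (metis surj_pair)
    have 1: "p = T + 1 \<longrightarrow> ?v t 0 = (b, c, ss)" using c d by metis
    have 2: "t = 0 \<longrightarrow> b = (p = T + 1) \<and> c = 0 \<and> ss ! 0 = word_cells x ?d \<and>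
       (\<forall>i. 2 \<le> i \<longrightarrow> i < tm_tapes M \<longrightarrow> ss ! i = 0) \<and>
       (if T + 1 \<le> p \<and> p < T + 1 + P then ss ! 1 \<le> 2 \<and> (ss ! 1 = 0 \<longrightarrow> ss' ! 1 = 0) else ss ! 1 = 0)"
    proof
      assume t: "t = 0"
      have "b = (?d = 0)" "c = 0" "ss = map (\<lambda>i. if i = 0 then word_cells x ?d
         else if i = 1 then word_cells y ?d else 0) [0..<tm_tapes M]"
        "ss' = map (\<lambda>i. if i = 0 then word_cells x (?d + 1)
         else if i = 1 then word_cells y (?d + 1) else 0) [0..<tm_tapes M]"
        using c r first[of ?d] first[of "?d + 1"] unfolding t by simp_all
      then show "b = (p = T + 1) \<and> c = 0 \<and> ss ! 0 = word_cells x ?d \<and>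
       (\<forall>i. 2 \<le> i \<longrightarrow> i < tm_tapes M \<longrightarrow> ss ! i = 0) \<and>
       (if T + 1 \<le> p \<and> p < T + 1 + P then ss ! 1 \<le> 2 \<and> (ss ! 1 = 0 \<longrightarrow> ss' ! 1 = 0) else ss ! 1 = 0)"
        using cert d tapes_ge by simp
    qed
    have 3: "t = T \<and> p = T + 1 \<longrightarrow> c = accept_state" using 1 last by auto
    show ?thesis unfolding A_kind code c r allowed_def prod.case using 1 2 3 by blast
  qed
  moreover have "H (?f t p) (?f t (p + 1))" for t p
    unfolding H_def code by (simp add: algebra_simps)
  moreover have "U (?f t p) (?f (t + 1) p)" for t p
    unfolding U_def code using view_step[OF wf_config_run] by (simp add: tm_run_Suc)
  ultimately have "tiles ?f" using code unfolding tiles_def by simp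
  then show ?thesis by blast
qed

text \<open>A border tile has an unconstrained outer neighbour, so errors may enter there and
  advance one column per row. The width \<open>2 * T + 3\<close> keeps column \<open>T + 1\<close>
  correct up to row \<open>T\<close>, and \<open>P \<le> T\<close> keeps the certificate with its
  right neighbour inside the first row.\<close>

lemma run_of_tiling:
  assumes P: "P \<le> T"
    and "tiling_instance.tiles (card tile_set) A H U (T + 1) (2 * T + 3) (kind x T P) f"
  shows "\<exists>y. length y \<le> P \<and> fst (tm_run M [x, y] T) = accept_state"
proof -
  interpret tiling_instance "card tile_set" A H U "T + 1" "2 * T + 3" "kind x T P"
    by standard auto
  let ?W = "2 * T + 3"
  have "tiles f" by fact
  then have f: "f t p < card tile_set" "A (kind x T P t p) (f t p)"
      "p + 1 < ?W \<Longrightarrow> H (f t p) (f t (p + 1))" "t + 1 < T + 1 \<Longrightarrow> U (f t p) (f (t + 1) p)"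
    if "t < T + 1" "p < ?W" for t p
    using that unfolding tiles_def by auto
  define G where "G = (\<lambda>t p. fst (tile (f t p)))"
  define L where "L = (\<lambda>t p. fst (snd (tile (f t p))))"
  define C where "C = (\<lambda>t p. fst (snd (snd (tile (f t p)))))"
  define R where "R = (\<lambda>t p. snd (snd (snd (tile (f t p)))))"
  have tile: "tile (f t p) = (G t p, L t p, C t p, R t p)" for t p
    by (simp add: G_def L_def C_def R_def)
  have C: "C t p \<in> syms" if "t < T + 1" "p < ?W" for t p
  proof -
    have "tile (f t p) \<in> tile_set" using tile_bij f(1)[OF that] by (auto simp add: bij_betw_def)
    then show ?thesis unfolding tile tile_set_def by simp
  qed
  have al: "allowed (p = T + 1) (t = 0) (T + 1 \<le> p \<and> p < T + 1 + P)
      (t = T \<and> p = T + 1) (word_cells x (int p - int (T + 1))) (G t p, L t p, C t p, R t p)"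
    if "t < T + 1" "p < ?W" for t p
    using f(2)[OF that] unfolding A_kind tile .
  have h: "G t (p + 1) = G t p" "L t (p + 1) = C t p" "R t p = C t (p + 1)" if "t < T + 1" "p + 1 < ?W" for t p
    using f(3)[of t p] that unfolding H_def tile by auto
  have u: "C (t + 1) p = local_rule (G t p) (L t p) (C t p) (R t p)" if "t + 1 < T + 1" "p < ?W" for t p
    using f(4)[of t p] that unfolding U_def tile by auto
  \<comment> \<open>\<open>H\<close> makes the broadcast component constant along a row; the centre
    cell then fixes its value.\<close>
  have g0: "G t p = G t 0" if "t < T + 1" "p < ?W" for t p
    using that by (induction p) (use h in auto)
  have g: "G t p = C t (T + 1)" if "t < T + 1" "p < ?W" for t p
  proof -
    have "G t (T + 1) = C t (T + 1)"
      using al[OF that(1), of "T + 1"] by (auto simp add: allowed_def split: prod.splits)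
    then show ?thesis using g0[OF that] g0[OF that(1), of "T + 1"] by simp
  qed
  have first: "C 0 p = (p = T + 1, 0, snd (snd (C 0 p)))" "snd (snd (C 0 p)) ! 0 = word_cells x (int p - int (T + 1))"
     "2 \<le> i \<Longrightarrow> i < tm_tapes M \<Longrightarrow> snd (snd (C 0 p)) ! i = 0"
     "\<not> (T + 1 \<le> p \<and> p < T + 1 + P) \<Longrightarrow> snd (snd (C 0 p)) ! 1 = 0"
     "T + 1 \<le> p \<Longrightarrow> p < T + 1 + P \<Longrightarrow> snd (snd (C 0 p)) ! 1 \<le> 2 \<and>
        (snd (snd (C 0 p)) ! 1 = 0 \<longrightarrow> snd (snd (R 0 p)) ! 1 = 0)" if "p < ?W" for p i
    using al[of 0 p] that by (auto simp add: allowed_def split: prod.splits)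
  \<comment> \<open>Index \<open>P\<close> is included as the right neighbour of the last
    certificate cell; it lies outside the region and is therefore blank.\<close>
  define s where "s = (\<lambda>i. if i \<le> P then snd (snd (C 0 (T + 1 + i))) ! 1 else 0)"
  have "\<exists>y. length y \<le> P \<and> (\<forall>i. word_cells y (int i) = s i)"
  proof (rule word_cells_exists)
    fix i assume i: "i < P"
    have "R 0 (T + 1 + i) = C 0 (T + 1 + Suc i)" using h(3)[of 0 "T + 1 + i"] i P by simp
    then show "s i \<le> 2 \<and> (s i = 0 \<longrightarrow> s (Suc i) = 0)"
      using first(5)[of "T + 1 + i"] i P by (simp add: s_def)
  next
    fix i assume "P \<le> i"
    then show "s i = 0" using first(4)[of "T + 1 + i"] P by (cases "i = P") (simp_all add: s_def)
  qed
  then obtain y where y: "length y \<le> P" "\<And>i. word_cells y (int i) = s i" by blast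
  let ?v = "\<lambda>t. view (tm_run M [x, y] t)"
  have start: "C 0 p = ?v 0 (int p - int (T + 1))" if p: "p < ?W" for p
  proof -
    let ?d = "int p - int (T + 1)"
    have len: "length (snd (snd (C 0 p))) = tm_tapes M" using C[of 0 p] p by (auto simp add: syms_def)
    have w: "snd (snd (C 0 p)) ! 1 = word_cells y ?d"
    proof (cases "T + 1 \<le> p \<and> p < T + 1 + P")
      case True
      then obtain i where i: "p = T + 1 + i" by (metis le_iff_add)
      then have "?d = int i" by simp
      then show ?thesis using y(2)[of i] True i by (simp add: s_def)
    next
      case False
      then have "word_cells y ?d = 0" using y(1) by (auto simp add: word_cells_def)
      then show ?thesis using first(4)[OF p False] by simp
    qed
    have "snd (snd (C 0 p)) = map (\<lambda>i. if i = 0 then word_cells x ?d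
     else if i = 1 then word_cells y ?d else 0) [0..<tm_tapes M]"
    proof (rule nth_equalityI)
      fix i assume "i < length (snd (snd (C 0 p)))"
      then have i: "i < tm_tapes M" using len by simp
      consider "i = 0" | "i = 1" | "2 \<le> i" by linarith
      then show "snd (snd (C 0 p)) ! i = map (\<lambda>i. if i = 0 then word_cells x ?d
         else if i = 1 then word_cells y ?d else 0) [0..<tm_tapes M] ! i"
        by cases (use first[OF p] w i in auto)
    qed (simp add: len)
    moreover have "p = T + 1 \<longleftrightarrow> ?d = 0" by auto
    ultimately show ?thesis using first(1)[OF p] view_start[of x y ?d] by (simp add: tm_run_def)
  qed
  \<comment> \<open>The part of a row known to agree with the run loses one column on each side per
    step, matching the window of three cells.\<close>
  have cone: "t < T + 1 \<Longrightarrow> t \<le> p \<Longrightarrow> p + t < ?W \<Longrightarrow> C t p = ?v t (int p - int (T + 1))" for t p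
  proof (induction t arbitrary: p)
    case (Suc t)
    then obtain p' where p': "p = p' + 1" by (cases p) auto
    have "L t p = C t p'" "R t p = C t (p + 1)" using h[of t p'] h[of t p] Suc.prems p' by auto
    moreover have "G t p = C t (T + 1)" using g Suc.prems by auto
    moreover have "C t p' = ?v t (int p - int (T + 1) - 1)" "C t p = ?v t (int p - int (T + 1))"
      "C t (p + 1) = ?v t (int p - int (T + 1) + 1)" "C t (T + 1) = ?v t 0"
      using Suc.IH[of p'] Suc.IH[of p] Suc.IH[of "p + 1"] Suc.IH[of "T + 1"] Suc.prems p'
      by (simp_all add: algebra_simps)
    moreover have "C (Suc t) p = local_rule (G t p) (L t p) (C t p) (R t p)" using u[of t p] Suc.prems by simp
    ultimately show ?case using view_step[OF wf_config_run] by (simp add: tm_run_Suc)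
  qed (use start in simp)
  have "fst (snd (C T (T + 1))) = accept_state"
    using al[of T "T + 1"] by (auto simp add: allowed_def split: prod.splits)
  moreover have "C T (T + 1) = ?v T 0" using cone[of T "T + 1"] by simp
  ultimately have "fst (tm_run M [x, y] T) = accept_state" by (cases "tm_run M [x, y] T") simp
  then show ?thesis using y(1) by blast
qed

end

section \<open>NP-hardness\<close>

fun horner_exp :: "nat list \<Rightarrow> exp" where
  "horner_exp [] = N 0"
| "horner_exp (a # as) = Add (N a) (Mul Len (horner_exp as))"

definition poly_exp :: "nat poly \<Rightarrow> exp" where
  "poly_exp p = horner_exp (coeffs p)"

lemma eval_poly_exp: "eval x u (poly_exp p) g = poly p (length x)"
proof -
  have "eval x u (horner_exp as) g = poly (Poly as) (length x)" for as
    by (induction as) auto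
  then show ?thesis by (simp add: poly_exp_def)
qed

lemma wf_poly_exp: "wf_exp m (poly_exp p)" and one_tape_poly_exp: "one_tape (poly_exp p)"
proof -
  have "wf_exp m (horner_exp as) \<and> one_tape (horner_exp as)" for as by (induction as) auto
  then show "wf_exp m (poly_exp p)" "one_tape (poly_exp p)" by (simp_all add: poly_exp_def)
qed

text \<open>Finitely many values of \<open>f\<close> are hard-wired. So the templates can enter a
  program although the numbering of the tiles is merely known to exist.\<close>

fun table_exp :: "exp \<Rightarrow> (nat \<Rightarrow> nat) \<Rightarrow> nat \<Rightarrow> exp" where
  "table_exp e f 0 = N 0"
| "table_exp e f (Suc k) = Add (table_exp e f k) (Mul (Eq_exp e (N k)) (N (f k)))"

definition Bool_exp :: "exp \<Rightarrow> exp" where "Bool_exp e = Not_exp (Not_exp e)"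

lemma eval_Bool_exp: "eval x u (Bool_exp e) g = of_bool (holds x u e g)"
  by (simp add: Bool_exp_def Not_exp_def holds_def)

lemma eval_Eq_exp: "eval x u (Eq_exp a b) g = of_bool (eval x u a g = eval x u b g)"
  by (simp add: Eq_exp_def Not_exp_def)

lemma eval_table_exp:
  "eval x u (table_exp e f k) g = (if eval x u e g < k then f (eval x u e g) else 0)"
  by (induction k) (auto simp add: eval_Eq_exp less_Suc_eq)

lemma wf_table_exp: "wf_exp m e \<Longrightarrow> wf_exp m (table_exp e f k)"
  by (induction k) (auto simp add: wf_exp_derived)

lemma one_tape_table_exp: "one_tape e \<Longrightarrow> one_tape (table_exp e f k)"
  by (induction k) (auto simp add: one_tape_derived)

lemma nested_index_inj:
  assumes "i * n + j = i' * n + j'" "j < n" "j' < (n::nat)" shows "i = i' \<and> j = j'"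
proof -
  have "(i * n + j) div n = i" "(i * n + j) mod n = j" "(i' * n + j') div n = i'" "(i' * n + j') mod n = j'"
    using assms(2,3) by simp_all
  then show ?thesis using assms(1) by metis
qed

text \<open>Expressions have no division; divisibility is decided by a bounded search for the
  quotient.\<close>

lemma mod_eq_0_bounded: 
  assumes "0 < m" shows "Suc y mod m = 0 \<longleftrightarrow> (\<exists>q<y + 2. y + 1 = q * m)"
proof
  assume "Suc y mod m = 0"
  then have "m dvd Suc y" by (simp only: mod_eq_0_iff_dvd)
  then obtain q where "Suc y = m * q" by (rule dvdE)
  then have q: "Suc y = q * m" by (simp only: mult.commute)
  have "q \<le> q * m" using assms by simp
  then have "q < y + 2" using q by linarith
  then show "\<exists>q<y + 2. y + 1 = q * m" using q by (intro exI[of _ q]) simp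
qed auto

section \<open>The code of the constructed graph as an expression\<close>

locale reduction = machine_run +
  fixes pP pT :: "nat poly"
begin

sublocale tiling "card tile_set" A H U .

definition T_exp :: exp where "T_exp = poly_exp pT"
definition P_exp :: exp where "P_exp = poly_exp pP"
definition W_exp :: exp where "W_exp = Add (Mul (N 2) T_exp) (N 3)"
text \<open>\<open>T + 1\<close> is both the number of rows and the column under the heads.\<close>

definition R_exp :: exp where "R_exp = Add T_exp (N 1)"
definition nc_exp :: exp where "nc_exp = Mul (Mul R_exp W_exp) (N Q)"
definition nv_exp :: exp where "nv_exp = Mul (Mul (Add R_exp (N 1)) (Add W_exp (N 1))) (N Q)"
definition M_exp :: exp where "M_exp = Mul (N 8) nc_exp"
definition K_exp :: exp where "K_exp = Mul nv_exp M_exp"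
definition n_exp :: exp where "n_exp = Add (Mul (N 2) K_exp) (Mul (N 2) nc_exp)"

text \<open>Variable 2 is the position of a bit in the code of the graph and 3 and 4 are the vertices of an
  edge; variables 5 to 9 stand for the row, the column and the number of a constraint, the copy of its
  vertex and the position of a literal.\<close>

definition offset_exp :: exp where "offset_exp = Sub (V 6) R_exp"

text \<open>A bit is represented by the symbol one greater. The first guard is needed because
  \<open>offset_exp\<close> is truncated to 0 left of the centre; the guards are normalised to 0 and
  1 because their product enters as a number.\<close>

definition scan_exp :: exp where
  "scan_exp = Mul (Mul (Not_exp (Less_exp (V 6) R_exp)) (Bool_exp (Less_exp (V 6) (Add R_exp Len))))
     (Add (N 1) (Bit 0 offset_exp))"

definition kind_exp :: exp where
  "kind_exp = Add (Eq_exp (V 6) R_exp) (Mul (N 2) (Add (Eq_exp (V 5) (N 0)) (Mul (N 2)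
     (Add (Mul (Not_exp (Less_exp (V 6) R_exp)) (Bool_exp (Less_exp (V 6) (Add R_exp P_exp)))) (Mul (N 2)
     (Add (Mul (Eq_exp (V 5) T_exp) (Eq_exp (V 6) R_exp)) (Mul (N 2) scan_exp)))))))"

text \<open>Kind, constraint and literal position are merged into one table index; the size
  \<open>48 * Q * 4\<close> reflects the 48 codes reserved for kinds.\<close>

definition field_exp :: "(literal \<Rightarrow> nat) \<Rightarrow> exp" where
  "field_exp h = table_exp (Add (Mul (Add (Mul kind_exp (N Q)) (V 7)) (N 4)) (V 9))
     (\<lambda>k. h (template (k div 4 div Q) (k div 4 mod Q) ! (k mod 4))) (48 * Q * 4)"

definition var_exp :: exp where
  "var_exp = Mul (field_exp fst)
     (Add (Mul (Add (Mul (Add (V 5) (field_exp (\<lambda>(i, d, e, l, s). d))) (Add W_exp (N 1)))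
                    (Add (V 6) (field_exp (\<lambda>(i, d, e, l, s). e)))) (N Q))
          (field_exp (\<lambda>(i, d, e, l, s). l)))"

definition constraint_exp :: exp where
  "constraint_exp = Add (Mul (Add (Mul (V 5) W_exp) (V 6)) (N Q)) (V 7)"

definition slot_exp :: exp where
  "slot_exp = Add (Mul var_exp M_exp) (Add (Mul (N 2) (Add (Mul (N 4) constraint_exp) (V 9)))
     (field_exp (\<lambda>(i, d, e, l, s). s)))"

definition multiple_exp :: "exp \<Rightarrow> exp" where
  "multiple_exp y = Sum 5 (Add y (N 2)) (Eq_exp (Add y (N 1)) (Mul (V 5) M_exp))"

definition incident_exp :: "exp \<Rightarrow> exp \<Rightarrow> exp" where
  "incident_exp i y =
     Mul (Eq_exp y (Add K_exp (Add (Mul (N 2) constraint_exp) (V 8)))) (Eq_exp i slot_exp)"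

definition right_exp :: "exp \<Rightarrow> exp \<Rightarrow> exp" where
  "right_exp i y = Add
     (Mul (Less_exp y K_exp) (Add (Eq_exp i y) (Add
        (Mul (multiple_exp y) (Eq_exp (Add i M_exp) (Add y (N 1))))
        (Mul (Not_exp (multiple_exp y)) (Eq_exp i (Add y (N 1)))))))
     (Sum 5 R_exp (Sum 6 W_exp (Sum 7 (N Q) (Sum 8 (N 2) (Sum 9 (N 4)
        (incident_exp i y))))))"

definition adjacent_exp :: exp where
  "adjacent_exp = Add
     (Mul (Less_exp (V 3) K_exp) (Mul (Not_exp (Less_exp (V 4) K_exp)) (right_exp (V 3) (Sub (V 4) K_exp))))
     (Mul (Less_exp (V 4) K_exp) (Mul (Not_exp (Less_exp (V 3) K_exp)) (right_exp (V 4) (Sub (V 3) K_exp))))"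

text \<open>The comparison yields the unary prefix, and at the separator no disjunct holds. For lack
  of division, a matrix position is decoded by searching for its row and column.\<close>

definition bit_exp :: exp where
  "bit_exp = Add (Less_exp (V 2) n_exp) (Sum 3 n_exp (Sum 4 n_exp
     (Mul (Eq_exp (V 2) (Add (Add n_exp (N 1)) (Add (Mul (V 3) n_exp) (V 4)))) adjacent_exp)))"

definition length_exp :: exp where
  "length_exp = Add (Add n_exp (N 1)) (Mul n_exp n_exp)"

lemmas closed_defs = T_exp_def P_exp_def W_exp_def R_exp_def nc_exp_def nv_exp_def M_exp_def K_exp_def n_exp_def

lemma wf_closed: "wf_exp k T_exp" "wf_exp k P_exp" "wf_exp k W_exp" "wf_exp k R_exp" "wf_exp k nc_exp"
  "wf_exp k nv_exp" "wf_exp k M_exp" "wf_exp k K_exp" "wf_exp k n_exp"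
  by (simp_all add: closed_defs wf_poly_exp)

lemma one_tape_closed: "one_tape T_exp" "one_tape P_exp" "one_tape W_exp" "one_tape R_exp" "one_tape nc_exp"
  "one_tape nv_exp" "one_tape M_exp" "one_tape K_exp" "one_tape n_exp"
  by (simp_all add: closed_defs one_tape_poly_exp)

lemma wf_bit_exp: "wf_exp 10 bit_exp" "wf_exp 10 length_exp"
proof -
  have "wf_exp 10 kind_exp"
    by (simp add: kind_exp_def scan_exp_def offset_exp_def Bool_exp_def wf_exp_derived wf_closed)
  then have f: "wf_exp 10 (field_exp h)" for h
    unfolding field_exp_def by (intro wf_table_exp) simp
  have "wf_exp 10 slot_exp" "wf_exp 10 constraint_exp"
    by (simp_all add: slot_exp_def constraint_exp_def var_exp_def f wf_closed)
  then show "wf_exp 10 bit_exp" "wf_exp 10 length_exp"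
    by (simp_all add: bit_exp_def length_exp_def adjacent_exp_def right_exp_def incident_exp_def multiple_exp_def
      wf_exp_derived wf_closed)
qed

lemma one_tape_bit_exp: "one_tape bit_exp" "one_tape length_exp"
proof -
  have "one_tape kind_exp"
    by (simp add: kind_exp_def scan_exp_def offset_exp_def Bool_exp_def one_tape_derived one_tape_closed)
  then have f: "one_tape (field_exp h)" for h
    unfolding field_exp_def by (intro one_tape_table_exp) simp
  have "one_tape slot_exp" "one_tape constraint_exp"
    by (simp_all add: slot_exp_def constraint_exp_def var_exp_def f one_tape_closed)
  then show "one_tape bit_exp" "one_tape length_exp"
    by (simp_all add: bit_exp_def length_exp_def adjacent_exp_def right_exp_def incident_exp_def multiple_exp_def
      one_tape_derived one_tape_closed)
qed

definition reduce :: "bool list \<Rightarrow> bool list" where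
  "reduce x = map (\<lambda>i. eval x (\<lambda>_. 0) bit_exp ((\<lambda>_. 0)(2 := i)) \<noteq> 0) [0..<eval x (\<lambda>_. 0) length_exp (\<lambda>_. 0)]"

lemma poly_time_reduce: "poly_time_fun reduce"
  unfolding reduce_def
  by (rule poly_time_fun_exp[OF wf_bit_exp(2) one_tape_bit_exp(2) wf_bit_exp(1) one_tape_bit_exp(1)]) auto

end

section \<open>Values of the expressions at a fixed input\<close>

locale reduction_at = reduction +
  fixes x :: "bool list"
begin

abbreviation T :: nat where "T \<equiv> poly pT (length x)"
abbreviation P :: nat where "P \<equiv> poly pP (length x)"

sublocale I: tiling_instance "card tile_set" A H U "T + 1" "2 * T + 3" "kind x T P"
  by standard auto

sublocale F: formula I.nv I.nc I.lv I.ls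
  by (rule I.formula)

lemma eval_closed:
  "eval x u T_exp g = T" "eval x u P_exp g = P" "eval x u W_exp g = 2 * T + 3" "eval x u R_exp g = T + 1"
  "eval x u nc_exp g = I.nc" "eval x u nv_exp g = I.nv" "eval x u M_exp g = F.M" "eval x u K_exp g = F.K"
  "eval x u n_exp g = F.n"
proof -
  show t: "eval x u T_exp g = T" "eval x u P_exp g = P" "eval x u W_exp g = 2 * T + 3" "eval x u R_exp g = T + 1"
    by (simp_all add: closed_defs eval_poly_exp)
  show c: "eval x u nc_exp g = I.nc" "eval x u nv_exp g = I.nv"
    unfolding nc_exp_def nv_exp_def by (simp_all only: eval.simps t I.nc_def I.nv_def)
  show "eval x u M_exp g = F.M" "eval x u K_exp g = F.K" "eval x u n_exp g = F.n"
    unfolding M_exp_def K_exp_def n_exp_def by (simp_all only: eval.simps c F.M_def F.K_def F.n_def)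
qed

lemma kind_less: "kind x T P t p < 48"
proof -
  have "word_cells x z \<le> 2" for z by (simp add: word_cells_def)
  from this[of "int p - int (T + 1)"] show ?thesis unfolding kind_def by (auto simp add: of_bool_def)
qed

lemma eval_kind: "g 0 = 0 \<Longrightarrow> eval x u kind_exp g = kind x T P (g 5) (g 6)"
proof -
  assume g: "g 0 = 0"
  have b: "eval x u (Mul (Not_exp a) (Bool_exp b)) g = of_bool (\<not> holds x u a g \<and> holds x u b g)" for a b
    by (simp add: eval_Bool_exp) (simp add: Not_exp_def holds_def)
  have s: "eval x u scan_exp g = word_cells x (int (g 6) - int (T + 1))"
  proof (cases "T + 1 \<le> g 6")
    case True
    have "int (g 6) - int (T + 1) = int (g 6 - (T + 1))" using True by (simp only: of_nat_diff)
    moreover have "word_cells x (int k) = of_bool (k < length x) * (1 + of_bool (k < length x \<and> x ! k))" for k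
      by (simp add: word_cells_def)
    moreover have "eval x u (Bit 0 offset_exp) g = of_bool (g 6 - (T + 1) < length x \<and> x ! (g 6 - (T + 1)))"
      using g by (simp add: offset_exp_def cell_def word_cells_eq_2 eval_closed)
    moreover have "g 6 < T + 1 + length x \<longleftrightarrow> g 6 - (T + 1) < length x" using True by linarith
    ultimately show ?thesis
      unfolding scan_exp_def eval.simps(5)[of x u "Mul (Not_exp _) _"] b
      using True by (simp only: eval.simps(1-3,7) holds_simps eval_closed not_less simp_thms)
  next
    case False
    then have "word_cells x (int (g 6) - int (T + 1)) = 0" by (simp add: word_cells_def)
    then show ?thesis
      unfolding scan_exp_def eval.simps(5)[of x u "Mul (Not_exp _) _"] b
      using False by (simp add: holds_simps eval_closed)
  qed
  show ?thesis
    unfolding kind_exp_def kind_def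
    by (simp only: eval.simps(1-3) eval.simps(5)[of x u "N _"] b s eval_Eq_exp eval_closed holds_simps)
       (auto simp add: eval_Eq_exp eval_closed not_less)
qed

lemma eval_field:
  assumes "g 0 = 0" "g 7 < Q" "g 9 < 4"
  shows "eval x u (field_exp h) g = h (I.literal_at (g 5) (g 6) (g 7) (g 9))"
proof -
  let ?k = "kind x T P (g 5) (g 6)"
  have "?k * Q + g 7 < 48 * Q" by (rule nested_index_less) (use kind_less assms in auto)
  then have "(?k * Q + g 7) * 4 + g 9 < 48 * Q * 4" by (rule nested_index_less) (use assms in auto)
  moreover have "(z * 4 + g 9) div 4 = z" "(z * 4 + g 9) mod 4 = g 9" for z using assms by simp_all
  moreover have "(?k * Q + g 7) div Q = ?k" "(?k * Q + g 7) mod Q = g 7" using assms by simp_all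
  moreover have "eval x u (Add (Mul (Add (Mul kind_exp (N Q)) (V 7)) (N 4)) (V 9)) g = (?k * Q + g 7) * 4 + g 9"
    using assms eval_kind by simp
  ultimately show ?thesis
    unfolding field_exp_def eval_table_exp I.literal_at_def by (simp only: if_True)
qed

lemma eval_slot:
  assumes "g 0 = 0" "g 6 < 2 * T + 3" "g 7 < Q" "g 9 < 4"
  shows "eval x u slot_exp g = F.slot (4 * ((g 5 * (2 * T + 3) + g 6) * Q + g 7) + g 9)"
proof -
  obtain i d e l s where lit: "I.literal_at (g 5) (g 6) (g 7) (g 9) = (i, d, e, l, s)" by (metis surj_pair)
  have f: "eval x u (field_exp h) g = h (i, d, e, l, s)" for h
    using eval_field[of g u h] assms lit by simp
  have "eval x u var_exp g = I.var (g 5) (g 6) (i, d, e, l, s)"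
    unfolding var_exp_def I.var_def eval.simps f eval_closed by simp
  then show ?thesis
    unfolding slot_exp_def F.slot_def constraint_exp_def eval.simps f eval_closed I.lv_ls_at[OF assms(2-4)] lit
    by simp
qed

lemma nxt_iff: "i = F.nxt y \<longleftrightarrow> (\<exists>q<y + 2. y + 1 = q * F.M) \<and> i + F.M = y + 1 \<or>
    \<not> (\<exists>q<y + 2. y + 1 = q * F.M) \<and> i = y + 1"
proof -
  have "0 < F.M" using F.M_ge by linarith
  then have "Suc y mod F.M = 0 \<longleftrightarrow> (\<exists>q<y + 2. y + 1 = q * F.M)" by (rule mod_eq_0_bounded)
  moreover have "F.M \<le> Suc y" if "Suc y mod F.M = 0"
    using that by (metis mod_less not_le old.nat.distinct(1))
  ultimately show ?thesis unfolding F.nxt_def by auto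
qed

lemma ex_less_mult: "(\<exists>c<a * b. Pr c) \<longleftrightarrow> (\<exists>i<a. \<exists>j<(b::nat). Pr (i * b + j))"
  using all_less_mult[of a b "\<lambda>c. \<not> Pr c"] by blast

lemma right_iff: "F.right i y \<longleftrightarrow> (y < F.K \<and> (i = y \<or> i = F.nxt y)) \<or>
  (\<exists>t<T + 1. \<exists>p<2 * T + 3. \<exists>q<Q. \<exists>b<2. \<exists>r<4.
     y = F.K + (2 * ((t * (2 * T + 3) + p) * Q + q) + b) \<and>
     i = F.slot (4 * ((t * (2 * T + 3) + p) * Q + q) + r))"
  unfolding F.right_def unfolding I.nc_def ex_less_mult ..

text \<open>The hypotheses on \<open>ei\<close> and \<open>ey\<close> say that their values are
  insensitive to the variables 5 to 9 bound in \<open>right_exp\<close>; the update of 5 alone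
  serves \<open>multiple_exp\<close>.\<close>

lemma holds_right:
  assumes "g 0 = 0"
    and i: "\<And>a b c d e. eval x u ei (g(5 := a, 6 := b, 7 := c, 8 := d, 9 := e)) = i" "eval x u ei g = i"
      "\<And>a. eval x u ei (g(5 := a)) = i"
    and y: "\<And>a b c d e. eval x u ey (g(5 := a, 6 := b, 7 := c, 8 := d, 9 := e)) = y" "eval x u ey g = y"
      "\<And>a. eval x u ey (g(5 := a)) = y"
  shows "holds x u (right_exp ei ey) g \<longleftrightarrow> F.right i y"
proof -
  have m: "holds x u (multiple_exp ey) g \<longleftrightarrow> (\<exists>q<y + 2. y + 1 = q * F.M)"
    by (simp add: multiple_exp_def holds_simps eval_closed y)
  have s: "holds x u (incident_exp ei ey)
      (g(5 := t, 6 := p, 7 := q, 8 := b, 9 := r)) \<longleftrightarrow>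
    y = F.K + (2 * ((t * (2 * T + 3) + p) * Q + q) + b) \<and>
     i = F.slot (4 * ((t * (2 * T + 3) + p) * Q + q) + r)"
    if "p < 2 * T + 3" "q < Q" "r < 4" for t p q b r
    using that assms(1) eval_slot[of "g(5 := t, 6 := p, 7 := q, 8 := b, 9 := r)" u]
    by (simp add: incident_exp_def holds_simps eval_closed i y constraint_exp_def)
  show ?thesis
    unfolding right_iff nxt_iff right_exp_def
    by (simp only: holds_simps m eval.simps eval_closed i y s cong: conj_cong)
qed

lemma holds_adjacent:
  assumes "g 0 = 0" shows "holds x u adjacent_exp g \<longleftrightarrow> F.adj (g 3) (g 4)"
proof -
  have "holds x u (right_exp (V 3) (Sub (V 4) K_exp)) g \<longleftrightarrow> F.right (g 3) (g 4 - F.K)"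
    "holds x u (right_exp (V 4) (Sub (V 3) K_exp)) g \<longleftrightarrow> F.right (g 4) (g 3 - F.K)"
    by (rule holds_right; simp add: assms eval_closed)+
  then show ?thesis
    unfolding adjacent_exp_def F.adj_def by (simp add: holds_simps eval_closed not_less)
qed

lemma graph_bits_reduce: "graph_bits F.n F.adj (reduce x)"
proof -
  let ?u = "\<lambda>_. 0 :: nat"
  have len: "eval x ?u length_exp (\<lambda>_. 0) = F.n + 1 + F.n * F.n"
    by (simp add: length_exp_def eval_closed)
  have bit: "eval x ?u bit_exp ((\<lambda>_. 0)(2 := k)) \<noteq> 0 \<longleftrightarrow> k < F.n \<or>
      (\<exists>i<F.n. \<exists>j<F.n. k = F.n + 1 + (i * F.n + j) \<and> F.adj i j)" for k
    unfolding holds_def[symmetric] bit_exp_def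
    by (simp add: holds_simps eval_closed holds_adjacent)
  have nth: "reduce x ! k \<longleftrightarrow> k < F.n \<or> (\<exists>i<F.n. \<exists>j<F.n. k = F.n + 1 + (i * F.n + j) \<and> F.adj i j)"
    if "k < F.n + 1 + F.n * F.n" for k
    using that unfolding reduce_def len by (simp only: nth_map_upt diff_zero add_0 bit)
  show ?thesis
    unfolding graph_bits_def
  proof (intro conjI allI impI)
    show "length (reduce x) = F.n + 1 + F.n * F.n" unfolding reduce_def len by simp
    show "reduce x ! i" if "i < F.n" for i using nth[of i] that by simp
    show "\<not> reduce x ! F.n" using nth[of F.n] by simp
    show "reduce x ! (F.n + 1 + i * F.n + j) = F.adj i j" if ij: "i < F.n" "j < F.n" for i j
    proof -
      have "i * F.n + j < F.n * F.n" using ij by (rule nested_index_less)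
      then have "reduce x ! (F.n + 1 + i * F.n + j) \<longleftrightarrow>
          (\<exists>i'<F.n. \<exists>j'<F.n. i * F.n + j = i' * F.n + j' \<and> F.adj i' j')"
        using nth[of "F.n + 1 + i * F.n + j"] by (simp add: add.assoc)
      then show ?thesis using nested_index_inj[of i F.n j] ij by metis
    qed
  qed
qed

text \<open>The number of vertices is the position of the first False, which the string
  determines.\<close>

lemma graph_bits_inj:
  assumes a: "graph_bits n a w" and b: "graph_bits m b w"
  shows "n = m \<and> (\<forall>i<n. \<forall>j<n. a i j = b i j)"
proof -
  have "\<not> n < m" "\<not> m < n" using a b unfolding graph_bits_def by blast+
  then have "n = m" by simp
  then show ?thesis using a b unfolding graph_bits_def by auto
qed

theorem reduce_correct:
  assumes "P \<le> T"
  shows "reduce x \<in> graph_language (\<lambda>G. instance_graph G) (\<lambda>G. balanced_graph G) \<longleftrightarrow>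
    (\<exists>y. length y \<le> P \<and> fst (tm_run M [x, y] T) = accept_state)"
proof -
  have "reduce x \<in> graph_language (\<lambda>G. instance_graph G) (\<lambda>G. balanced_graph G) \<longleftrightarrow>
      (\<exists>c. certificate F.n F.adj c)"
  proof
    assume "reduce x \<in> graph_language (\<lambda>G. instance_graph G) (\<lambda>G. balanced_graph G)"
    then obtain n a c where 1: "graph_bits n a (reduce x)" "certificate n a c"
      unfolding graph_language_iff by blast
    from graph_bits_inj[OF 1(1) graph_bits_reduce]
    have "n = F.n" "\<And>i j. i < n \<Longrightarrow> j < n \<Longrightarrow> a i j = F.adj i j" by auto
    then show "\<exists>c. certificate F.n F.adj c" using 1(2) certificate_cong[of n a F.adj c c] by auto
  next
    assume "\<exists>c. certificate F.n F.adj c"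
    then show "reduce x \<in> graph_language (\<lambda>G. instance_graph G) (\<lambda>G. balanced_graph G)"
      unfolding graph_language_iff using graph_bits_reduce by blast
  qed
  also have "\<dots> \<longleftrightarrow> (\<exists>f. I.tiles f)"
    unfolding F.certificate_iff I.satisfiable_iff ..
  also have "\<dots> \<longleftrightarrow> (\<exists>y. length y \<le> P \<and> fst (tm_run M [x, y] T) = accept_state)"
    using tiling_of_run run_of_tiling[OF assms] by blast
  finally show ?thesis .
qed

end

theorem theorem3p5:
  "NP_complete (graph_language
     (\<lambda>G. even_graph G \<and> bipartite G \<and> max_degree G = 4)
     (\<lambda>G. \<exists>f. two_partition G f \<and> locally_balanced_open G f))"
  unfolding NP_complete_def
proof (intro conjI ballI)
  let ?L = "graph_language (\<lambda>G. instance_graph G) (\<lambda>G. balanced_graph G)"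
  show "?L \<in> NP" by (rule graph_language_in_NP)
  fix L' assume "L' \<in> NP"
  then obtain R pP where R: "poly_time_rel R"
    and L': "\<And>x. x \<in> L' \<longleftrightarrow> (\<exists>c. length c \<le> poly pP (length x) \<and> R x c)"
    unfolding NP_def by blast
  from R obtain M p where M: "wf_tm M"
    and run: "\<And>x y. fst (tm_run M [x, y] (poly p (length x + length y))) =
        (if R x y then accept_state else reject_state)"
    unfolding poly_time_rel_def by blast
  obtain a where a: "\<And>n. poly p n \<le> (n + 2) ^ a"
    using poly_bounded_poly[of p] unfolding poly_bounded_def by blast
  \<comment> \<open>The bound \<open>(n + 2) ^ a\<close> is monotone in \<open>n\<close>, so one
    time \<open>T\<close> serves all certificates of length at most \<open>P\<close>. The summand
    \<open>pP\<close> ensures \<open>P \<le> T\<close>.\<close>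
  define pT where "pT = ([:2, 1:] + pP) ^ a + pP"
  interpret reduction M pP pT by standard (rule M)
  have "x \<in> L' \<longleftrightarrow> reduce x \<in> ?L" for x
  proof -
    interpret reduction_at M pP pT x ..
    have PT: "P \<le> T" by (simp add: pT_def)
    have acc: "fst (tm_run M [x, y] T) = accept_state \<longleftrightarrow> R x y" if y: "length y \<le> P" for y
    proof -
      let ?t = "poly p (length x + length y)"
      have "?t \<le> (length x + length y + 2) ^ a" by (rule a)
      also have "\<dots> \<le> (2 + length x + P) ^ a" using y by (intro power_mono) auto
      also have "\<dots> \<le> T" by (simp add: pT_def)
      \<comment> \<open>The machine has halted after \<open>?t\<close> steps, so running on to
        \<open>T\<close> changes nothing.\<close>
      finally have "tm_run M [x, y] T = tm_run M [x, y] ?t"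
        using run[of x y] by (intro tm_run_halted) auto
      then show ?thesis using run[of x y] by simp
    qed
    show ?thesis unfolding L' reduce_correct[OF PT] using acc by blast
  qed
  then show "L' \<le>\<^sub>p ?L" unfolding poly_reducible_def using poly_time_reduce by blast
qed

end
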